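(* Let $r\ge0$ be an integer, let $I\subset\mathbb{R}^l$ be open, let $\sigma:\mathbb{R}\to\mathbb{R}$ be a bounded, non-constant activation function of class $C^{r+2}$, and let $\varphi\in LdA^{r+1}(T^*Q,I)$ be a parametric Lagrange-d'Alembert map of class $C^{r+1}$. Then for every compact set $K\subset T^*Q\times I$ and every $\epsilon>0$ there exists a finite sequence of maps $LDE^{\mathrm{aug}}_{\tilde T_i,\tilde U_i,\tilde f_i}\in LDE^{r+1}_{\mathcal{N}_\sigma}(T^*Q,I)$, $i=1,\dots,m$, such that $$\big\|\varphi-\pi\circ LDE^{\mathrm{aug}}_{\tilde T_m,\tilde U_m,\tilde f_m}\circ\cdots\circ LDE^{\mathrm{aug}}_{\tilde T_1,\tilde U_1,\tilde f_1}\big\|_{C^r(K)}<\epsilon,$$ where $\pi:T^*Q\times I\to T^*Q$ denotes the projection onto $T^*Q$.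
   Context: Setting: $Q=\mathbb{R}^n$ and $T^*Q=\mathbb{R}^n\times\mathbb{R}^n$ with coordinates $(q,p)$; $TQ=\mathbb{R}^n\times\mathbb{R}^n$; $I\subset\mathbb{R}^l$ is an open set of parameters $\mu$. A parametric time-dependent forced Hamiltonian system with Hamiltonian $H:T^*Q\times[0,\mathcal{T}]\times I\to\mathbb{R}$ and forcing $f:T^*Q\times[0,\mathcal{T}]\times I\to\mathbb{R}^n$ is $$\dot q=\frac{\partial H}{\partial p}(q,p,t,\mu),\qquad \dot p=-\frac{\partial H}{\partial q}(q,p,t,\mu)+f(q,p,t,\mu).$$ Standing assumptions (A) (for given $\mathcal{T}>0$ and integer $r\ge0$): (i) $H\in C^{r+2}(T^*Q\times[0,\mathcal{T}]\times I)$ and $f\in C^{r+1}(T^*Q\times[0,\mathcal{T}]\times I,\mathbb{R}^n)$; (ii) $H$ is hyperregular: for every $t\in[0,\mathcal{T}]$ and $\mu\in I$ the map $T^*Q\ni(q,p)\mapsto(q,\frac{\partial H}{\partial p}(q,p,t,\mu))\in TQ$ is a diffeomorphism; (iii) for every $(q_0,p_0,\mu)\in T^*Q\times I$ and $t_0\in[0,\mathcal{T}]$ the solution with $(q(t_0),p(t_0))=(q_0,p_0)$ exists on all of $[0,\mathcal{T}]$, i.e. the parametric flow map $F_{t,t_0}:T^*Q\times I\to T^*Q$ is well defined for all $t,t_0\in[0,\mathcal{T}]$. Parametric Lagrange-d'Alembert map: a map $\varphi:T^*Q\times I\to T^*Q$ is a parametric Lagrange-d'Alembert map of class $C^{r+1}$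 if there is a parametric time-dependent forced Hamiltonian system satisfying (A) for some $\mathcal{T}>0$, with parametric flow $F_{t,t_0}$, such that $\varphi=F_{\mathcal{T},0}$. The set of all of them is $LdA^{r+1}(T^*Q,I)$. Augmented Lagrange-d'Alembert-Euler map: for $T,U:\mathbb{R}^n\times I\to\mathbb{R}$ and $f:\mathbb{R}^{2n}\times I\to\mathbb{R}^n$, $LDE^{\mathrm{aug}}_{T,U,f}:T^*Q\times I\to T^*Q\times I$ is the map $(q,p,\mu)\mapsto(q',p',\mu)$ with $$q'=q+\frac{\partial T}{\partial p}(p,\mu),\qquad p'=p-\frac{\partial U}{\partial q}(q',\mu)+f(q',p,\mu).$$ Neural networks: $\mathcal{A}^s$ is the set of bounded non-constant functions $\sigma:\mathbb{R}\to\mathbb{R}$ of class $C^s$. For $\sigma\in\mathcal{A}^s$, $\mathcal{N}^s_\sigma(\mathbb{R}^a\times I,\mathbb{R}^b)$ is the set of (restrictions to $\mathbb{R}^a\times I$ of) multilayer perceptrons $\mathbb{R}^{a+l}\to\mathbb{R}^b$ with activation $\sigma$: alternating compositions of affine maps and componentwise application of $\sigma$, with any number ($\ge1$) of hidden layers of arbitrary finite widths and an affine output layer. For an integer $s\ge0$ and $\sigma\in\mathcal{A}^{s+1}$, $$LDE^s_{\mathcal{N}_\sigma}(T^*Q,I)=\{LDE^{\mathrm{aug}}_{\tilde T,\tilde U,\tilde f}\mid \tilde T,\tilde U\in\mathcal{N}^{s+1}_\sigma(\mathbb{R}^n\times I,\mathbb{R}),\ \tilde f\in\mathcal{N}^s_\sigma(\mathbb{R}^{2n}\times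 I,\mathbb{R}^n)\},$$ with the same activation $\sigma$ for all three networks. $\|\cdot\|_{C^r(K)}$ is the usual $C^r$ norm on $K$ (maximum over $0\le j\le r$ of the supremum over $K$ of the norm of the $j$-th derivative with respect to all variables $(q,p,\mu)$). *)

theory Defs
  imports "HOL-Analysis.Analysis"
begin

text \<open>
  The configuration space is \<open>real ^ 'n\<close>; its cotangent and tangent bundles are both
  \<open>real ^ 'n \<times> real ^ 'n\<close>.  The parameter set is a subset of \<open>real ^ 'l\<close>.
\<close>

type_synonym 'n phase = "(real ^ 'n) \<times> (real ^ 'n)"

text \<open>
  Functions of class \<open>C\<^sup>k\<close> on \<open>S\<close>.  For open \<open>S\<close> this is the usual notion.
  It is also used for \<open>S = UNIV \<times> {0..T} \<times> I\<close> with \<open>0 < T\<close> and \<open>I\<close> open, where time derivatives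
  at the endpoints are one-sided; derivatives within such a set are unique.
\<close>

primrec Ck_on :: "nat \<Rightarrow> 'a::real_normed_vector set \<Rightarrow> ('a \<Rightarrow> 'b::real_normed_vector) \<Rightarrow> bool"
where
  "Ck_on 0 S g \<longleftrightarrow> continuous_on S g"
| "Ck_on (Suc k) S g \<longleftrightarrow>
     (\<exists>g'. (\<forall>x\<in>S. (g has_derivative g' x) (at x within S)) \<and> (\<forall>v. Ck_on k S (\<lambda>x. g' x v)))"

definition Ck_diffeomorphism ::
  "nat \<Rightarrow> ('a::real_normed_vector \<Rightarrow> 'b::real_normed_vector) \<Rightarrow> bool"
where
  "Ck_diffeomorphism k g \<longleftrightarrow> bij g \<and> Ck_on k UNIV g \<and> Ck_on k UNIV (inv g)"

definition grad :: "('a::real_inner \<Rightarrow> real) \<Rightarrow> 'a \<Rightarrow> 'a" where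
  "grad g x = (THE D. GDERIV g x :> D)"

lemma grad_eqI:
  assumes "GDERIV g x :> D"
  shows "grad g x = D"
  unfolding grad_def
proof (rule the_equality)
  fix D' assume "GDERIV g x :> D'"
  with assms have "(\<lambda>h. h \<bullet> D') = (\<lambda>h. h \<bullet> D)"
    unfolding gderiv_def by (rule has_derivative_unique[rotated])
  then show "D' = D"
    by (metis vector_eq_ldot)
qed (rule assms)

text \<open>\<open>dir_deriv [v\<^sub>1, \<dots>, v\<^sub>j] g x\<close> is the \<open>j\<close>-th derivative of \<open>g\<close> at \<open>x\<close>, a \<open>j\<close>-linear map,
  evaluated at \<open>(v\<^sub>1, \<dots>, v\<^sub>j)\<close>.\<close>

primrec dir_deriv ::
  "'a list \<Rightarrow> ('a::real_normed_vector \<Rightarrow> 'b::real_normed_vector) \<Rightarrow> 'a \<Rightarrow> 'b"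
where
  "dir_deriv [] g x = g x"
| "dir_deriv (v # vs) g x = frechet_derivative (dir_deriv vs g) (at x) v"

text \<open>The innermost supremum is the operator norm of the \<open>j\<close>-th derivative as a multilinear map.
  The norm is meant for \<open>g\<close> of class \<open>C\<^sup>r\<close> near \<open>K\<close>; taking it in \<open>ennreal\<close> makes it \<open>0\<close> for
  empty \<open>K\<close>.\<close>

definition Cr_norm ::
  "nat \<Rightarrow> 'a set \<Rightarrow> ('a::real_normed_vector \<Rightarrow> 'b::real_normed_vector) \<Rightarrow> ennreal"
where
  "Cr_norm r K g =
     (SUP j\<in>{0..r}. SUP x\<in>K. SUP vs\<in>{vs. length vs = j \<and> (\<forall>v\<in>set vs. norm v \<le> 1)}.
        ennreal (norm (dir_deriv vs g x)))"

definition ham_solution ::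
  "('n::finite phase \<times> real \<times> (real ^ 'l::finite) \<Rightarrow> real) \<Rightarrow>
   ('n phase \<times> real \<times> (real ^ 'l) \<Rightarrow> real ^ 'n) \<Rightarrow>
   real \<Rightarrow> real ^ 'l \<Rightarrow> (real \<Rightarrow> 'n phase) \<Rightarrow> bool"
where
  "ham_solution H f T \<mu> z \<longleftrightarrow>
     (\<forall>t\<in>{0..T}. case z t of (q, p) \<Rightarrow>
        (z has_vector_derivative
           (grad (\<lambda>p'. H ((q, p'), t, \<mu>)) p,
            - grad (\<lambda>q'. H ((q', p), t, \<mu>)) q + f ((q, p), t, \<mu>)))
          (at t within {0..T}))"

text \<open>The flow \<open>F\<^bsub>t,t0\<^esub>\<close>; uniqueness of solutions follows from the regularity imposed
  on \<open>H\<close> and \<open>f\<close> below.\<close>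

definition ham_flow ::
  "('n::finite phase \<times> real \<times> (real ^ 'l::finite) \<Rightarrow> real) \<Rightarrow>
   ('n phase \<times> real \<times> (real ^ 'l) \<Rightarrow> real ^ 'n) \<Rightarrow>
   real \<Rightarrow> real \<Rightarrow> real \<Rightarrow> 'n phase \<times> (real ^ 'l) \<Rightarrow> 'n phase"
where
  "ham_flow H f T t t0 = (\<lambda>(z0, \<mu>).
     THE y. \<exists>z. ham_solution H f T \<mu> z \<and> z t0 = z0 \<and> z t = y)"

definition admissible_system ::
  "nat \<Rightarrow> real \<Rightarrow> (real ^ 'l) set \<Rightarrow>
   ('n::finite phase \<times> real \<times> (real ^ 'l::finite) \<Rightarrow> real) \<Rightarrow>
   ('n phase \<times> real \<times> (real ^ 'l) \<Rightarrow> real ^ 'n) \<Rightarrow> bool"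
where
  "admissible_system r T I H f \<longleftrightarrow>
     Ck_on (r + 2) (UNIV \<times> {0..T} \<times> I) H \<and>
     Ck_on (r + 1) (UNIV \<times> {0..T} \<times> I) f \<and>
     (\<forall>t\<in>{0..T}. \<forall>\<mu>\<in>I.
        Ck_diffeomorphism (r + 1) (\<lambda>(q, p). (q, grad (\<lambda>p'. H ((q, p'), t, \<mu>)) p))) \<and>
     (\<forall>z0. \<forall>\<mu>\<in>I. \<forall>t0\<in>{0..T}. \<exists>z. ham_solution H f T \<mu> z \<and> z t0 = z0)"

text \<open>\<open>LdA s I\<close> is the set of parametric Lagrange-d'Alembert maps of class \<open>C\<^sup>s\<close> (\<open>s \<ge> 1\<close>).
  Its elements are total functions of which only the values on \<open>UNIV \<times> I\<close> are constrained.\<close>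

definition LdA :: "nat \<Rightarrow> (real ^ 'l::finite) set \<Rightarrow> ('n::finite phase \<times> (real ^ 'l) \<Rightarrow> 'n phase) set"
where
  "LdA s I = {\<phi>. \<exists>r T H f. s = r + 1 \<and> 0 < T \<and> admissible_system r T I H f \<and>
     (\<forall>x \<in> UNIV \<times> I. \<phi> x = ham_flow H f T T 0 x)}"

definition LDE_aug ::
  "((real ^ 'n::finite) \<times> (real ^ 'l::finite) \<Rightarrow> real) \<Rightarrow> ((real ^ 'n) \<times> (real ^ 'l) \<Rightarrow> real) \<Rightarrow>
   ('n phase \<times> (real ^ 'l) \<Rightarrow> real ^ 'n) \<Rightarrow>
   'n phase \<times> (real ^ 'l) \<Rightarrow> 'n phase \<times> (real ^ 'l)"
where
  "LDE_aug T U f = (\<lambda>((q, p), \<mu>).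
     let q' = q + grad (\<lambda>p'. T (p', \<mu>)) p;
         p' = p - grad (\<lambda>x. U (x, \<mu>)) q' + f ((q', p), \<mu>)
     in ((q', p'), \<mu>))"

definition activations :: "nat \<Rightarrow> (real \<Rightarrow> real) set" where
  "activations s = {\<sigma>. bounded (range \<sigma>) \<and> \<not> \<sigma> constant_on UNIV \<and> Ck_on s UNIV \<sigma>}"

text \<open>\<open>hidden_layer \<sigma> m h\<close>: the values \<open>h x i\<close> with \<open>i < m\<close> are the outputs, on the input \<open>x\<close>,
  of the last of one or more hidden layers of a perceptron with activation \<open>\<sigma>\<close>; \<open>m\<close> is the width of
  that layer, and values at indices \<open>i \<ge> m\<close> are never used.\<close>

inductive hidden_layer ::
  "(real \<Rightarrow> real) \<Rightarrow> nat \<Rightarrow> ('a::euclidean_space \<Rightarrow> nat \<Rightarrow> real) \<Rightarrow> bool"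
  for \<sigma> :: "real \<Rightarrow> real"
where
  first: "0 < k \<Longrightarrow> hidden_layer \<sigma> k (\<lambda>x i. \<sigma> (w i \<bullet> x + b i))"
| deeper: "hidden_layer \<sigma> m h \<Longrightarrow> 0 < k \<Longrightarrow>
    hidden_layer \<sigma> k (\<lambda>x i. \<sigma> ((\<Sum>j<m. W i j * h x j) + b i))"

definition networks :: "(real \<Rightarrow> real) \<Rightarrow> ('a::euclidean_space \<Rightarrow> 'b::euclidean_space) set" where
  "networks \<sigma> = {\<lambda>x. (\<Sum>j<m. h x j *\<^sub>R c j) + d | m h c d. hidden_layer \<sigma> m h}"

text \<open>The regularity superscript of the network classes is left implicit: as sets of functions
  they depend on \<open>\<sigma>\<close> only.\<close>

definition LDE_networks ::
  "(real \<Rightarrow> real) \<Rightarrow> ('n::finite phase \<times> (real ^ 'l::finite) \<Rightarrow> 'n phase \<times> (real ^ 'l)) set"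
where
  "LDE_networks \<sigma> =
     {LDE_aug T U f | T U f. T \<in> networks \<sigma> \<and> U \<in> networks \<sigma> \<and> f \<in> networks \<sigma>}"

end

theory Submission
  imports Defs
begin

text \<open>
  Neither hyperregularity nor the Hamiltonian structure is needed: only that \<open>\<phi>\<close> is the time-\<open>T\<close> map of a
  \<open>C\<^sup>r\<^sup>+\<^sup>1\<close> field \<open>(X, Y)\<close> whose solutions exist.  Split
  \<open>(X, Y) = (X, - X) + (0, X + Y)\<close>.  An Euler step for \<open>(0, X + Y)\<close> is a Lagrange-d'Alembert-Euler map with \<open>T = 0\<close>,
  and conjugating by the shear \<open>S (q, p) = (q + p, p)\<close>, which is such a map with \<open>T = \<bar>p\<bar>\<^sup>2 / 2\<close>, turns an Euler step for
  \<open>(X, - X)\<close> into an Euler step for a field of the form \<open>(0, Z)\<close>.  So the split Euler scheme consists exactly of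
  Lagrange-d'Alembert-Euler maps with smooth data.  Its iterates converge to the flow in \<open>C\<^sup>r\<close>: their derivatives
  satisfy a linear recursion of the same kind, so smoothness of the flow and convergence follow together by
  induction on the order.

  It remains to replace the data by networks.  Since \<open>\<sigma>\<close> is bounded and not constant, no iterated difference of
  it vanishes, which yields all monomials, hence uniform density.  Averaging a uniformly good approximation \<open>k\<close>
  times in every direction makes it good in \<open>C\<^sup>k\<close>, since a derivative of an average is a difference quotient.
\<close>

section \<open>Families of smooth functions\<close>

text \<open>The position update \<open>q + grad T\<close> of a Lagrange-d'Alembert-Euler map cannot
  depend on \<open>q\<close>, while \<open>X\<close> does; only the momentum update accepts an
  arbitrary function of position and momentum. The field \<open>(X, - X)\<close> leaves
  \<open>q + p\<close> unchanged, so after the shear it moves the momentum alone. Undoing the shear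
  merges with the following kick, hence an Euler step costs two maps, and their composition is an
  Euler step for a field that also depends on the step size. Estimates in higher norms are not
  propagated through compositions. Instead a convergent sequence of maps is one family over a metric
  parameter space, with its limit sitting at a limit point, and \<open>Ck_family\<close> demands
  joint continuity, in parameter and point, of all derivatives up to the given order. This passes
  through sums, products, compositions and integrals, and compactness turns it back into uniform
  closeness near \<open>K\<close>. Derivatives are recorded in basis directions only, so each is
  again a family with values in the same space. The number of Euler steps is fixed before any
  network is chosen.\<close>

primrec Ck_family ::
  "nat \<Rightarrow> 'p::metric_space set \<Rightarrow> 'a::euclidean_space set \<Rightarrow> ('p \<Rightarrow> 'a \<Rightarrow> 'b::real_normed_vector) \<Rightarrow> bool"
where
  "Ck_family 0 P U f \<longleftrightarrow> continuous_on (P \<times> U) (\<lambda>(p, x). f p x)"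
| "Ck_family (Suc k) P U f \<longleftrightarrow> continuous_on (P \<times> U) (\<lambda>(p, x). f p x) \<and>
     (\<exists>f'. (\<forall>p\<in>P. \<forall>x\<in>U. (f p has_derivative f' p x) (at x)) \<and>
        (\<forall>b\<in>Basis. Ck_family k P U (\<lambda>p x. f' p x b)))"

lemma Ck_family_continuous: "Ck_family k P U f \<Longrightarrow> continuous_on (P \<times> U) (\<lambda>(p, x). f p x)"
  by (cases k) auto

lemma Ck_family_continuous_compose:
  assumes "Ck_family k P U f" "continuous_on S a" "continuous_on S b"
    and "\<And>s. s \<in> S \<Longrightarrow> a s \<in> P" "\<And>s. s \<in> S \<Longrightarrow> b s \<in> U"
  shows "continuous_on S (\<lambda>s. f (a s) (b s))"
proof -
  have "continuous_on S (\<lambda>s. (a s, b s))"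
    by (intro continuous_on_Pair assms)
  from continuous_on_compose2[OF Ck_family_continuous[OF assms(1)] this] assms(4,5)
  show ?thesis by auto
qed

lemma Ck_family_SucI:
  assumes "continuous_on (P \<times> U) (\<lambda>(p, x). f p x)"
    and "\<And>p x. p \<in> P \<Longrightarrow> x \<in> U \<Longrightarrow> (f p has_derivative f' p x) (at x)"
    and "\<And>b. b \<in> Basis \<Longrightarrow> Ck_family k P U (\<lambda>p x. f' p x b)"
  shows "Ck_family (Suc k) P U f"
  using assms by auto

lemma Ck_family_SucD:
  assumes "Ck_family (Suc k) P U f"
  shows "\<exists>f'. (\<forall>p\<in>P. \<forall>x\<in>U. (f p has_derivative f' p x) (at x)) \<and>
    (\<forall>b\<in>Basis. Ck_family k P U (\<lambda>p x. f' p x b))"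
  using assms by auto

lemma Ck_family_Suc_imp: "Ck_family (Suc k) P U f \<Longrightarrow> Ck_family k P U f"
proof (induction k arbitrary: f)
  case (Suc k)
  obtain f' where f': "\<And>p x. p \<in> P \<Longrightarrow> x \<in> U \<Longrightarrow> (f p has_derivative f' p x) (at x)"
    "\<And>b. b \<in> Basis \<Longrightarrow> Ck_family (Suc k) P U (\<lambda>p x. f' p x b)"
    using Ck_family_SucD[OF Suc.prems(1)] by blast
  show ?case
    by (rule Ck_family_SucI[OF Ck_family_continuous[OF Suc.prems] f'(1)]) (auto intro: Suc.IH f'(2) simp del: Ck_family.simps)
qed auto

lemma Ck_family_le: "Ck_family k P U f \<Longrightarrow> j \<le> k \<Longrightarrow> Ck_family j P U f"
  by (induction k) (auto simp: le_Suc_eq simp del: Ck_family.simps dest: Ck_family_Suc_imp)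

lemma Ck_family_subset:
  "Ck_family k P U f \<Longrightarrow> Q \<subseteq> P \<Longrightarrow> V \<subseteq> U \<Longrightarrow> Ck_family k Q V f"
proof (induction k arbitrary: f)
  case 0
  then show ?case by (auto elim!: continuous_on_subset)
next
  case (Suc k)
  obtain f' where f': "\<And>p x. p \<in> P \<Longrightarrow> x \<in> U \<Longrightarrow> (f p has_derivative f' p x) (at x)"
    "\<And>b. b \<in> Basis \<Longrightarrow> Ck_family k P U (\<lambda>p x. f' p x b)"
    using Ck_family_SucD[OF Suc.prems(1)] by blast
  show ?case
    by (rule Ck_family_SucI[where f' = f'])
      (use Suc.prems(2,3) in \<open>auto intro!: f' Suc.IH Suc.prems continuous_on_subset[OF Ck_family_continuous[OF Suc.prems(1)]] simp del: Ck_family.simps\<close>)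
qed

lemma Ck_family_cong:
  assumes "open U" and "\<And>p x. p \<in> P \<Longrightarrow> x \<in> U \<Longrightarrow> f p x = g p x" and "Ck_family k P U f"
  shows "Ck_family k P U g"
  using assms(2,3)
proof (induction k arbitrary: f g)
  case 0
  then show ?case by (auto elim!: continuous_on_eq)
next
  case (Suc k)
  obtain f' where f': "\<And>p x. p \<in> P \<Longrightarrow> x \<in> U \<Longrightarrow> (f p has_derivative f' p x) (at x)"
    "\<And>b. b \<in> Basis \<Longrightarrow> Ck_family k P U (\<lambda>p x. f' p x b)"
    using Ck_family_SucD[OF Suc.prems(2)] by blast
  show ?case
  proof (rule Ck_family_SucI[where f' = f'])
    show "continuous_on (P \<times> U) (\<lambda>(p, x). g p x)"
      using Ck_family_continuous[OF Suc.prems(2)]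
      by (rule continuous_on_eq) (use Suc.prems(1) in auto)
    show "(g p has_derivative f' p x) (at x)" if "p \<in> P" "x \<in> U" for p x
      using f'(1)[OF that] \<open>open U\<close> that(2)
      by (rule has_derivative_transform_within_open) (use Suc.prems(1) that in auto)
  qed (use f' in auto)
qed

text \<open>Used to freeze a parameter, to pass from the time interval to the grid, and to turn a
  single function, encoded over one point, into a constant family.\<close>

lemma Ck_family_reindex:
  assumes "continuous_on Q \<pi>" "\<pi> ` Q \<subseteq> P" "Ck_family k P U f"
  shows "Ck_family k Q U (\<lambda>q. f (\<pi> q))"
  using assms(3)
proof (induction k arbitrary: f)
  have *: "continuous_on (Q \<times> U) (\<lambda>(q, x). f (\<pi> q) x)" if "continuous_on (P \<times> U) (\<lambda>(p, x). f p x)"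
    for f
    using assms(2) continuous_on_compose2[OF that, of "Q \<times> U" "\<lambda>y. (\<pi> (fst y), snd y)"]
    by (force simp: split_beta intro!: continuous_intros continuous_on_compose2[OF assms(1)])
  {
    case 0
    then show ?case using * by auto
  next
    case (Suc k)
    obtain f' where f': "\<And>p x. p \<in> P \<Longrightarrow> x \<in> U \<Longrightarrow> (f p has_derivative f' p x) (at x)"
      "\<And>b. b \<in> Basis \<Longrightarrow> Ck_family k P U (\<lambda>p x. f' p x b)"
      using Ck_family_SucD[OF Suc.prems(1)] by blast
    show ?case
      by (rule Ck_family_SucI[where f' = "\<lambda>q. f' (\<pi> q)"])
        (use assms(2) in \<open>auto intro!: f' Suc.IH *[OF Ck_family_continuous[OF Suc.prems(1)]] simp del: Ck_family.simps\<close>)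
  }
qed

lemma Ck_family_param:
  assumes "continuous_on P c"
  shows "Ck_family k P U (\<lambda>p x. c p)"
proof -
  have *: "continuous_on (P \<times> U) (\<lambda>(p, x). c p)" if "continuous_on P c" for c
    unfolding split_beta by (rule continuous_on_compose2[OF that]) (auto intro!: continuous_intros)
  show ?thesis using assms
  proof (induction k arbitrary: c)
    case (Suc k)
    show ?case
      by (rule Ck_family_SucI[where f' = "\<lambda>_ _ _. 0"])
        (use *[OF Suc.prems] Suc.IH in \<open>auto simp del: Ck_family.simps\<close>)
  qed (use * in auto)
qed

lemma Ck_family_const: "Ck_family k P U (\<lambda>p x. c)"
  by (rule Ck_family_param) auto

lemma Ck_family_linear:
  assumes "bounded_linear h" "Ck_family k P U f"
  shows "Ck_family k P U (\<lambda>p x. h (f p x))"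
  using assms(2)
proof (induction k arbitrary: f)
  have *: "continuous_on (P \<times> U) (\<lambda>(p, x). h (f p x))" if "continuous_on (P \<times> U) (\<lambda>(p, x). f p x)" for f
    using bounded_linear.continuous_on[OF assms(1) that] by (simp add: split_beta)
  {
    case 0
    then show ?case using * by simp
  next
    case (Suc k)
    obtain f' where f': "\<And>p x. p \<in> P \<Longrightarrow> x \<in> U \<Longrightarrow> (f p has_derivative f' p x) (at x)"
      "\<And>b. b \<in> Basis \<Longrightarrow> Ck_family k P U (\<lambda>p x. f' p x b)"
      using Ck_family_SucD[OF Suc.prems(1)] by blast
    show ?case
      by (rule Ck_family_SucI[where f' = "\<lambda>p x v. h (f' p x v)"])
        (auto intro!: *[OF Ck_family_continuous[OF Suc.prems(1)]] f' bounded_linear.has_derivative[OF assms(1)] Suc.IH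
          simp del: Ck_family.simps)
  }
qed

lemma Ck_family_ident: "Ck_family k P U (\<lambda>p x. x)"
proof (cases k)
  have *: "continuous_on (P \<times> U) (\<lambda>(p::'a, x::'b). x)"
    by (auto simp: split_beta intro!: continuous_intros)
  case 0
  then show ?thesis using * by simp
next
  have *: "continuous_on (P \<times> U) (\<lambda>(p::'a, x::'b). x)"
    by (auto simp: split_beta intro!: continuous_intros)
  case (Suc j)
  show ?thesis unfolding Suc
    by (rule Ck_family_SucI[where f' = "\<lambda>_ _ v. v"])
      (use * in \<open>auto intro!: Ck_family_const simp del: Ck_family.simps\<close>)
qed

lemma Ck_family_add:
  assumes "Ck_family k P U f" "Ck_family k P U g"
  shows "Ck_family k P U (\<lambda>p x. f p x + g p x)"
  using assms
proof (induction k arbitrary: f g)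
  case 0
  then show ?case by (auto simp: split_beta intro!: continuous_intros)
next
  case (Suc k)
  obtain f' where f': "\<And>p x. p \<in> P \<Longrightarrow> x \<in> U \<Longrightarrow> (f p has_derivative f' p x) (at x)"
    "\<And>b. b \<in> Basis \<Longrightarrow> Ck_family k P U (\<lambda>p x. f' p x b)"
    using Ck_family_SucD[OF Suc.prems(1)] by blast
  obtain g' where g': "\<And>p x. p \<in> P \<Longrightarrow> x \<in> U \<Longrightarrow> (g p has_derivative g' p x) (at x)"
    "\<And>b. b \<in> Basis \<Longrightarrow> Ck_family k P U (\<lambda>p x. g' p x b)"
    using Ck_family_SucD[OF Suc.prems(2)] by blast
  have "continuous_on (P \<times> U) (\<lambda>(p, x). f p x + g p x)"
    using continuous_on_add[OF Suc.prems[THEN Ck_family_continuous]] by (simp add: split_beta)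
  then show ?case
    by (rule Ck_family_SucI[where f' = "\<lambda>p x v. f' p x v + g' p x v"])
      (auto intro!: has_derivative_add f' g' Suc.IH simp del: Ck_family.simps)
qed

lemma Ck_family_sum:
  "finite A \<Longrightarrow> (\<And>i. i \<in> A \<Longrightarrow> Ck_family k P U (f i)) \<Longrightarrow> Ck_family k P U (\<lambda>p x. \<Sum>i\<in>A. f i p x)"
  by (induction A rule: finite_induct) (auto intro: Ck_family_const Ck_family_add)

lemma Ck_family_minus:
  "Ck_family k P U f \<Longrightarrow> Ck_family k P U (\<lambda>p x. - f p x)"
  by (rule Ck_family_linear[OF bounded_linear_minus[OF bounded_linear_ident]])

lemma Ck_family_diff:
  "Ck_family k P U f \<Longrightarrow> Ck_family k P U g \<Longrightarrow> Ck_family k P U (\<lambda>p x. f p x - g p x)"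
  using Ck_family_add[OF _ Ck_family_minus] by fastforce

lemma Ck_family_bilinear:
  assumes "bounded_bilinear h" "Ck_family k P U f" "Ck_family k P U g"
  shows "Ck_family k P U (\<lambda>p x. h (f p x) (g p x))"
  using assms(2,3)
proof (induction k arbitrary: f g)
  have *: "continuous_on (P \<times> U) (\<lambda>(p, x). h (f p x) (g p x))"
    if "continuous_on (P \<times> U) (\<lambda>(p, x). f p x)" "continuous_on (P \<times> U) (\<lambda>(p, x). g p x)" for f g
    using bounded_bilinear.continuous_on[OF assms(1) that] by (simp add: split_beta)
  {
    case 0
    then show ?case using * by auto
  next
    case (Suc k)
    obtain f' where f': "\<And>p x. p \<in> P \<Longrightarrow> x \<in> U \<Longrightarrow> (f p has_derivative f' p x) (at x)"
      "\<And>b. b \<in> Basis \<Longrightarrow> Ck_family k P U (\<lambda>p x. f' p x b)"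
      using Ck_family_SucD[OF Suc.prems(1)] by blast
    obtain g' where g': "\<And>p x. p \<in> P \<Longrightarrow> x \<in> U \<Longrightarrow> (g p has_derivative g' p x) (at x)"
      "\<And>b. b \<in> Basis \<Longrightarrow> Ck_family k P U (\<lambda>p x. g' p x b)"
      using Ck_family_SucD[OF Suc.prems(2)] by blast
    have fg: "Ck_family k P U f" "Ck_family k P U g"
      using Suc.prems by (blast intro: Ck_family_Suc_imp)+
    show ?case
    proof (rule Ck_family_SucI[where f' = "\<lambda>p x v. h (f p x) (g' p x v) + h (f' p x v) (g p x)"])
      show "continuous_on (P \<times> U) (\<lambda>(p, x). h (f p x) (g p x))"
        by (intro * Suc.prems[THEN Ck_family_continuous])
      show "((\<lambda>x. h (f p x) (g p x)) has_derivative (\<lambda>v. h (f p x) (g' p x v) + h (f' p x v) (g p x))) (at x)"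
        if "p \<in> P" "x \<in> U" for p x
        using that by (intro bounded_bilinear.FDERIV[OF assms(1)] f' g')
    qed (intro Ck_family_add Suc.IH fg f' g'; assumption)+
  }
qed

lemmas Ck_family_scaleR = Ck_family_bilinear[OF bounded_bilinear_scaleR]
lemmas Ck_family_mult = Ck_family_bilinear[OF bounded_bilinear_mult]

lemma Ck_family_Pair:
  assumes "Ck_family k P U f" "Ck_family k P U g"
  shows "Ck_family k P U (\<lambda>p x. (f p x, g p x))"
proof -
  have "bounded_linear (\<lambda>x::'c. (x, 0::'d))" "bounded_linear (\<lambda>x::'d. (0::'c, x))"
    by (auto intro!: bounded_linear_Pair bounded_linear_zero bounded_linear_ident)
  from Ck_family_add[OF Ck_family_linear[OF this(1) assms(1)] Ck_family_linear[OF this(2) assms(2)]]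
  show ?thesis by simp
qed

lemmas Ck_family_fst = Ck_family_linear[OF bounded_linear_fst]
lemmas Ck_family_snd = Ck_family_linear[OF bounded_linear_snd]
lemmas Ck_family_inner_left = Ck_family_linear[OF bounded_linear_inner_left]

text \<open>A Lebesgue number of a cover of \<open>C\<close> makes continuity uniform although
  \<open>S\<close> need not be compact; only \<open>c\<close> has to stay in \<open>C\<close>.
  Typically \<open>C\<close> lies over a limit parameter, while \<open>s\<close> also ranges over
  points with nearby parameters.\<close>

lemma continuous_on_compact_neighbourhood:
  fixes f :: "'a::metric_space \<Rightarrow> 'b::metric_space"
  assumes "continuous_on S f" "compact C" "C \<subseteq> S" "0 < e"
  shows "\<exists>d>0. \<forall>c\<in>C. \<forall>s\<in>S. dist s c < d \<longrightarrow> dist (f s) (f c) < e"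
proof -
  have "\<exists>d>0. \<forall>s\<in>S. dist s c < d \<longrightarrow> dist (f s) (f c) < e / 2" if "c \<in> C" for c
    using bspec[OF assms(1)[unfolded continuous_on_iff] subsetD[OF assms(3) that]] half_gt_zero[OF assms(4)] by blast
  then obtain d where d: "\<And>c. c \<in> C \<Longrightarrow> d c > 0"
    "\<And>c s. c \<in> C \<Longrightarrow> s \<in> S \<Longrightarrow> dist s c < d c \<Longrightarrow> dist (f s) (f c) < e / 2"
    by metis
  have "C \<subseteq> \<Union>((\<lambda>c. ball c (d c)) ` C)" using d(1) by force
  then obtain r where r: "r > 0" "\<And>x. x \<in> C \<Longrightarrow> \<exists>G\<in>(\<lambda>c. ball c (d c)) ` C. ball x r \<subseteq> G"
    by (rule Heine_Borel_lemma[OF assms(2)]) auto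
  show ?thesis
  proof (intro exI conjI ballI impI)
    fix c s assume cs: "c \<in> C" "s \<in> S" "dist s c < r"
    then obtain c' where c': "c' \<in> C" "ball c r \<subseteq> ball c' (d c')" using r(2) by blast
    moreover have "c \<in> ball c r" "s \<in> ball c r" using cs r(1) by (auto simp: dist_commute)
    ultimately have "c \<in> ball c' (d c')" "s \<in> ball c' (d c')" by blast+
    then have "dist c c' < d c'" "dist s c' < d c'" by (auto simp: dist_commute)
    then have "dist (f c) (f c') < e / 2" "dist (f s) (f c') < e / 2"
      using d(2)[OF c'(1)] cs assms(3) by auto
    then show "dist (f s) (f c) < e" by (metis dist_triangle_half_l dist_commute)
  qed (rule r)
qed

lemma linear_expand_Basis:
  fixes h :: "'a::euclidean_space \<Rightarrow> 'b::real_normed_vector"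
  assumes "linear h"
  shows "h v = (\<Sum>b\<in>Basis. (v \<bullet> b) *\<^sub>R h b)"
proof -
  have "h (\<Sum>b\<in>Basis. (v \<bullet> b) *\<^sub>R b) = (\<Sum>b\<in>Basis. (v \<bullet> b) *\<^sub>R h b)"
    using assms by (simp add: linear_sum linear_scale)
  then show ?thesis by (simp add: euclidean_representation)
qed

lemma has_derivative_expand_Basis:
  fixes f' :: "'a::euclidean_space \<Rightarrow> 'b::real_normed_vector"
  assumes "(f has_derivative f') F"
  shows "f' v = (\<Sum>b\<in>Basis. (v \<bullet> b) *\<^sub>R f' b)"
  by (rule linear_expand_Basis[OF has_derivative_linear[OF assms]])

lemma Ck_family_compose:
  fixes f :: "'p::metric_space \<Rightarrow> 'a::euclidean_space \<Rightarrow> 'b::euclidean_space"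
  assumes "Ck_family k P V g" "Ck_family k P U f"
    and fV: "\<And>p x. p \<in> P \<Longrightarrow> x \<in> U \<Longrightarrow> f p x \<in> V"
    and "open U"
  shows "Ck_family k P U (\<lambda>p x. g p (f p x))"
  using assms(1,2)
proof (induction k arbitrary: g)
  have *: "continuous_on (P \<times> U) (\<lambda>(p, x). g p (f p x))"
    if "Ck_family k P V g" "Ck_family k P U f" for k and g :: "'p \<Rightarrow> 'b \<Rightarrow> 'c"
    using that(2)[THEN Ck_family_continuous] fV unfolding split_beta
    by (intro Ck_family_continuous_compose[OF that(1)]) (auto intro!: continuous_intros)
  {
    case 0
    then show ?case using *[of 0] by auto
  next
    case (Suc k)
    obtain f' where f': "\<And>p x. p \<in> P \<Longrightarrow> x \<in> U \<Longrightarrow> (f p has_derivative f' p x) (at x)"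
      "\<And>b. b \<in> Basis \<Longrightarrow> Ck_family k P U (\<lambda>p x. f' p x b)"
      using Ck_family_SucD[OF Suc.prems(2)] by blast
    obtain g' where g': "\<And>p x. p \<in> P \<Longrightarrow> x \<in> V \<Longrightarrow> (g p has_derivative g' p x) (at x)"
      "\<And>b. b \<in> Basis \<Longrightarrow> Ck_family k P V (\<lambda>p x. g' p x b)"
      using Ck_family_SucD[OF Suc.prems(1)] by blast
    show ?case
    proof (rule Ck_family_SucI[where f' = "\<lambda>p x v. g' p (f p x) (f' p x v)"])
      show "((\<lambda>x. g p (f p x)) has_derivative (\<lambda>v. g' p (f p x) (f' p x v))) (at x)"
        if "p \<in> P" "x \<in> U" for p x
        using has_derivative_compose[OF f'(1)[OF that] g'(1)[OF that(1) fV[OF that]]] .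
      fix b :: 'a assume b: "b \<in> Basis"
      \<comment> \<open>The regularity of \<open>g'\<close> is known for fixed basis directions
        only, whereas the chain rule feeds it the moving vector \<open>f' p x b\<close>; expanding
        that vector leaves sums of products.\<close>
      have "Ck_family k P U (\<lambda>p x. \<Sum>c\<in>Basis. (f' p x b \<bullet> c) *\<^sub>R g' p (f p x) c)"
        by (intro Ck_family_sum Ck_family_scaleR Ck_family_inner_left f' b Suc.IH g'
            Ck_family_Suc_imp[OF Suc.prems(2)]) auto
      then show "Ck_family k P U (\<lambda>p x. g' p (f p x) (f' p x b))"
        by (rule Ck_family_cong[OF \<open>open U\<close>, rotated])
          (rule has_derivative_expand_Basis[symmetric, OF g'(1)], auto simp: fV)
    qed (use Suc.prems in \<open>intro *[of "Suc k"]\<close>)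
  }
qed

section \<open>Integrals over a parameter\<close>

lemma has_derivative_integral_param:
  fixes f :: "real \<Rightarrow> 'a::euclidean_space \<Rightarrow> 'b::euclidean_space"
  assumes "open U"
    and f: "continuous_on ({0..1} \<times> U) (\<lambda>(s, x). f s x)"
    and f': "\<And>s x. s \<in> {0..1} \<Longrightarrow> x \<in> U \<Longrightarrow> (f s has_derivative f' s x) (at x)"
    and f'_cont: "\<And>b. b \<in> Basis \<Longrightarrow> continuous_on ({0..1} \<times> U) (\<lambda>(s, x). f' s x b)"
    and x: "x \<in> U"
  shows "((\<lambda>x. integral {0..1} (\<lambda>s. f s x)) has_derivative (\<lambda>v. integral {0..1} (\<lambda>s. f' s x v))) (at x)"
proof -
  \<comment> \<open>The Leibniz rule requires the derivative to be continuous as a bounded linear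
    map; in finite dimension this follows from continuity on each basis vector.\<close>
  define F where "F s x = Blinfun (f' s x)" for s x
  have F: "blinfun_apply (F s x) = f' s x" if "s \<in> {0..1}" "x \<in> U" for s x
    unfolding F_def using f'[OF that] by (intro bounded_linear_Blinfun_apply has_derivative_bounded_linear)
  have contF: "continuous_on (U \<times> cbox 0 1) (\<lambda>(x, s). F s x)"
  proof (rule continuous_on_blinfun_componentwise)
    fix b :: 'a assume b: "b \<in> Basis"
    have "continuous_on (U \<times> cbox 0 1) (\<lambda>y. case (snd y, fst y) of (s, x) \<Rightarrow> f' s x b)"
      by (rule continuous_on_compose2[OF f'_cont[OF b]]) (auto intro!: continuous_intros)
    then show "continuous_on (U \<times> cbox 0 1) (\<lambda>y. blinfun_apply (case y of (x, s) \<Rightarrow> F s x) b)"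
      by (rule continuous_on_eq) (use F in auto)
  qed
  obtain e where e: "e > 0" "ball x e \<subseteq> U"
    using \<open>open U\<close> x openE by blast
  have "((\<lambda>x. integral (cbox 0 1) (\<lambda>s. f s x)) has_derivative
    blinfun_apply (integral (cbox 0 1) (\<lambda>s. F s x))) (at x within ball x e)"
  proof (rule leibniz_rule)
    show "((\<lambda>x. f s x) has_derivative blinfun_apply (F s y)) (at y within ball x e)"
      if "y \<in> ball x e" "s \<in> cbox 0 1" for y s
    proof -
      have "y \<in> U" "s \<in> {0..1}" using that e by auto
      then show ?thesis using f' F by (auto intro: has_derivative_at_withinI)
    qed
    show "(\<lambda>s. f s y) integrable_on cbox 0 1" if "y \<in> ball x e" for y
    proof -
      have "y \<in> U" using that e by auto
      then have "continuous_on {0..1} (\<lambda>s. case (s, y) of (s, x) \<Rightarrow> f s x)"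
        by (intro continuous_on_compose2[OF f]) (auto intro!: continuous_intros)
      then show ?thesis using integrable_continuous_interval by auto
    qed
    show "continuous_on (ball x e \<times> cbox 0 1) (\<lambda>(y, s). F s y)"
      using contF by (rule continuous_on_subset) (use e in auto)
  qed (use e in auto)
  then have "((\<lambda>x. integral {0..1} (\<lambda>s. f s x)) has_derivative blinfun_apply (integral {0..1} (\<lambda>s. F s x))) (at x)"
    using e by (simp add: at_within_open[of x "ball x e"])
  moreover have "blinfun_apply (integral {0..1} (\<lambda>s. F s x)) = (\<lambda>v. integral {0..1} (\<lambda>s. f' s x v))"
  proof
    fix v
    have "continuous_on {0..1} (\<lambda>s. F s x)"
      using continuous_on_compose2[OF contF, of "{0..1}" "Pair x"] x
      by (force intro!: continuous_intros)
    then have "(\<lambda>s. F s x) integrable_on {0..1}"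
      by (rule integrable_continuous_interval)
    then have "blinfun_apply (integral {0..1} (\<lambda>s. F s x)) v = integral {0..1} (\<lambda>s. blinfun_apply (F s x) v)"
      by (rule blinfun_apply_integral)
    also have "\<dots> = integral {0..1} (\<lambda>s. f' s x v)"
      by (intro integral_cong) (use F x in auto)
    finally show "blinfun_apply (integral {0..1} (\<lambda>s. F s x)) v = integral {0..1} (\<lambda>s. f' s x v)" .
  qed
  ultimately show ?thesis by simp
qed

text \<open>With the integration variable \<open>s\<close> as part of the parameter, every
  derivative of the integrand is jointly continuous in \<open>(p, s)\<close> and \<open>x\<close>,
  so differentiating under the integral reproduces the same form and the induction closes.\<close>

lemma Ck_family_integral:
  fixes f :: "'p::metric_space \<times> real \<Rightarrow> 'a::euclidean_space \<Rightarrow> 'b::euclidean_space"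
  assumes "open U" "Ck_family k (P \<times> {0..1}) U f"
  shows "Ck_family k P U (\<lambda>p x. integral {0..1} (\<lambda>s. f (p, s) x))"
  using assms(2)
proof (induction k arbitrary: f)
  have *: "continuous_on (P \<times> U) (\<lambda>(p, x). integral {0..1} (\<lambda>s. f (p, s) x))"
    if "Ck_family k (P \<times> {0..1}) U f" for k and f :: "'p \<times> real \<Rightarrow> 'a \<Rightarrow> 'b"
  proof -
    have "continuous_on ((P \<times> U) \<times> cbox 0 (1::real)) (\<lambda>((p, x), s). f (p, s) x)"
      unfolding split_beta
      by (intro Ck_family_continuous_compose[OF that]) (auto intro!: continuous_intros)
    then have "continuous_on ((P \<times> U) \<times> cbox 0 (1::real)) (\<lambda>(y, s). f (fst y, s) (snd y))"
      by (simp add: split_beta)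
    from integral_continuous_on_param[OF this] show ?thesis
      by (simp add: split_beta)
  qed
  {
    case 0
    then show ?case using *[of 0] by auto
  next
    case (Suc k)
    obtain f' where f': "\<And>p x. p \<in> P \<times> {0..1} \<Longrightarrow> x \<in> U \<Longrightarrow> (f p has_derivative f' p x) (at x)"
      "\<And>b. b \<in> Basis \<Longrightarrow> Ck_family k (P \<times> {0..1}) U (\<lambda>p x. f' p x b)"
      using Ck_family_SucD[OF Suc.prems] by blast
    have cont: "continuous_on ({0..1} \<times> U) (\<lambda>(s, x). g (p, s) x)"
      if "Ck_family j (P \<times> {0..1}) U g" "p \<in> P" for g p j
      unfolding split_beta using that(2)
      by (intro Ck_family_continuous_compose[OF that(1)]) (auto intro!: continuous_intros)
    show ?case
    proof (rule Ck_family_SucI[OF *[OF Suc.prems]])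
      show "((\<lambda>x. integral {0..1} (\<lambda>s. f (p, s) x)) has_derivative (\<lambda>v. integral {0..1} (\<lambda>s. f' (p, s) x v))) (at x)"
        if "p \<in> P" "x \<in> U" for p x
        by (rule has_derivative_integral_param[OF \<open>open U\<close> cont[OF Suc.prems that(1)] f'(1) cont[OF f'(2)] that(2)])
          (use that in auto)
    qed (intro Suc.IH f')
  }
qed

section \<open>Euler iterates and flows\<close>

text \<open>A point \<open>(h, t)\<close> of the time grid consists of a step size and a time; step size \<open>0\<close> stands for the
  exact flow.  Joint continuity of a family over the grid therefore encodes locally uniform convergence of
  the discrete iterates, and \<open>Ck_family\<close> over the grid encodes \<open>C\<^sup>k\<close> convergence.\<close>

abbreviation grid_node :: "nat \<Rightarrow> nat \<Rightarrow> real \<times> real" where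
  "grid_node N j \<equiv> (1 / real N, real j / real N)"

definition time_grid :: "(real \<times> real) set" where
  "time_grid = {0} \<times> {0..1} \<union> {(grid_node N j) | N j. 1 \<le> N \<and> j \<le> N}"

lemma time_grid_0: "t \<in> {0..1} \<Longrightarrow> (0, t) \<in> time_grid"
  by (auto simp: time_grid_def)

lemma time_grid_node: "1 \<le> N \<Longrightarrow> j \<le> N \<Longrightarrow> (grid_node N j) \<in> time_grid"
  by (auto simp: time_grid_def)

lemma time_grid_cases:
  assumes "p \<in> time_grid"
  obtains t where "t \<in> {0..1}" "p = (0, t)"
    | N j where "1 \<le> N" "j \<le> N" "p = (grid_node N j)"
  using assms by (auto simp: time_grid_def)

text \<open>Points with positive step size are isolated, so joint continuity over the grid demands
  nothing of the parameter there; all convergence sits at step size zero.\<close>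

lemma time_grid_isolated:
  assumes "1 \<le> N"
  shows "\<exists>e>0. \<forall>p\<in>time_grid. dist p (grid_node N j) < e \<longrightarrow> p = (grid_node N j)"
proof (intro exI conjI ballI impI)
  \<comment> \<open>The gap between \<open>1 / N\<close> and the next smaller step size
    \<open>1 / (N + 1)\<close>. It is at most \<open>1 / N\<close>, which is both the spacing of the
    times and the distance to step size zero.\<close>
  let ?e = "1 / (real N * (real N + 1))"
  show "?e > 0" using assms by simp
  fix p assume p: "p \<in> time_grid" "dist p (grid_node N j) < ?e"
  have e1: "?e \<le> 1 / real N" using assms by (intro divide_left_mono) auto
  have d: "\<bar>fst p - 1 / real N\<bar> < ?e" "\<bar>snd p - real j / real N\<bar> < ?e"
    using dist_fst_le[of p "grid_node N j"] dist_snd_le[of p "grid_node N j"] p(2)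
    by (auto simp: dist_real_def)
  from p(1) show "p = (grid_node N j)"
  proof (cases rule: time_grid_cases)
    case (1 t)
    then show ?thesis using d e1 by auto
  next
    case (2 M i)
    have MN: "M = N"
    proof (rule ccontr)
      assume "M \<noteq> N"
      then consider "M + 1 \<le> N" | "N + 1 \<le> M" by linarith
      then show False
      proof cases
        case 1
        then have "real M + 1 \<le> real N" by linarith
        moreover have "(1 / real M - 1 / real N) * (real M * real N) = real N - real M"
          using \<open>1 \<le> M\<close> assms by (simp add: field_simps)
        ultimately have "1 \<le> (1 / real M - 1 / real N) * (real M * real N)" by linarith
        moreover have "(1 / real M - 1 / real N) * (real M * real N) < ?e * (real M * real N)"
          using d(1) 2 assms by (intro mult_strict_right_mono) auto
        moreover have "?e * (real M * real N) = real M / (real N + 1)" using assms by simp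
        moreover have "real M / (real N + 1) < 1" using \<open>real M + 1 \<le> real N\<close> by simp
        ultimately show False by linarith
      next
        case 2
        then have "real N + 1 \<le> real M" by linarith
        then have "1 / real M \<le> 1 / (real N + 1)" using assms by (intro divide_left_mono) auto
        then have "1 / real N - 1 / (real N + 1) < ?e" using d(1) \<open>p = _\<close> by auto
        then show False using assms by (simp add: field_simps)
      qed
    qed
    have "real i = real j"
    proof (rule ccontr)
      assume "real i \<noteq> real j"
      then have "1 \<le> \<bar>real i - real j\<bar>" by auto
      moreover have "\<bar>real i - real j\<bar> / real N < 1 / real N"
      proof -
        have "\<bar>real i - real j\<bar> / real N = \<bar>real i / real N - real j / real N\<bar>"
          by (metis abs_divide abs_of_nat diff_divide_distrib)
        also have "\<dots> < 1 / real N" using d(2) e1 2 MN by simp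
        finally show ?thesis .
      qed
      ultimately show False using assms by (simp add: field_simps)
    qed
    then show ?thesis using 2 MN by simp
  qed
qed

text \<open>With \<open>n + 1\<close> steps, the last node not later than \<open>t\<close>. The
  sequence reaches \<open>(0, t)\<close> through nodes of positive step size, which carries
  statements about iterates over to the exact flow.\<close>

definition grid_seq :: "real \<Rightarrow> nat \<Rightarrow> real \<times> real" where
  "grid_seq t n = (1 / real (Suc n), real (nat \<lfloor>t * real (Suc n)\<rfloor>) / real (Suc n))"

lemma grid_seq_node:
  assumes "t \<in> {0..1}"
  obtains j where "j \<le> Suc n" "grid_seq t n = (grid_node (Suc n) j)"
proof
  have "t * real (Suc n) \<le> real (Suc n)" using assms by (simp add: mult_left_le_one_le)
  then show "nat \<lfloor>t * real (Suc n)\<rfloor> \<le> Suc n" by linarith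
qed (simp add: grid_seq_def)

lemma grid_seq_in: "t \<in> {0..1} \<Longrightarrow> grid_seq t n \<in> time_grid"
  by (metis grid_seq_node time_grid_node le_add1 plus_1_eq_Suc)

lemma grid_seq_lim:
  assumes "t \<in> {0..1}"
  shows "grid_seq t \<longlonglongrightarrow> (0, t)"
  unfolding grid_seq_def
proof (intro tendsto_Pair)
  show h: "(\<lambda>n. 1 / real (Suc n)) \<longlonglongrightarrow> 0"
    using LIMSEQ_inverse_real_of_nat by (simp add: inverse_eq_divide)
  have "\<bar>real (nat \<lfloor>t * real (Suc n)\<rfloor>) / real (Suc n) - t\<bar> \<le> 1 / real (Suc n)" for n
  proof -
    have "0 \<le> t * real (Suc n)" using assms by simp
    then have "\<bar>real (nat \<lfloor>t * real (Suc n)\<rfloor>) - t * real (Suc n)\<bar> \<le> 1" by linarith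
    then have "\<bar>real (nat \<lfloor>t * real (Suc n)\<rfloor>) - t * real (Suc n)\<bar> / real (Suc n) \<le> 1 / real (Suc n)"
      by (intro divide_right_mono) auto
    also have "\<bar>real (nat \<lfloor>t * real (Suc n)\<rfloor>) - t * real (Suc n)\<bar> / real (Suc n) =
        \<bar>(real (nat \<lfloor>t * real (Suc n)\<rfloor>) - t * real (Suc n)) / real (Suc n)\<bar>"
      by (simp only: abs_divide abs_of_nat)
    finally show ?thesis by (simp add: diff_divide_distrib)
  qed
  then have "\<forall>n. norm (real (nat \<lfloor>t * real (Suc n)\<rfloor>) / real (Suc n) - t) \<le> 1 / real (Suc n)" by simp
  then have "(\<lambda>n. real (nat \<lfloor>t * real (Suc n)\<rfloor>) / real (Suc n) - t) \<longlonglongrightarrow> 0"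
    by (rule Lim_null_comparison[OF always_eventually h])
  then show "(\<lambda>n. real (nat \<lfloor>t * real (Suc n)\<rfloor>) / real (Suc n)) \<longlonglongrightarrow> t"
    by (rule LIM_zero_cancel)
qed

section \<open>Convergence of Euler iterates\<close>

lemma dist_Pair_le: "dist (a, b) (c, d) \<le> dist a c + dist b d"
  by (simp add: dist_Pair_Pair sqrt_sum_squares_le_sum)

text \<open>The starting point \<open>x\<close> and the state are separate arguments of
  \<open>W\<close>, so that a nonlinear field, which ignores \<open>x\<close>, and its variational
  equation, whose coefficients depend on \<open>x\<close>, are both instances. The field also sees
  the step size, as the composition of two split steps requires.\<close>

definition euler_flow ::
  "'x set \<Rightarrow> (real \<times> real \<Rightarrow> 'x \<Rightarrow> 'y \<Rightarrow> 'y) \<Rightarrow> ('x \<Rightarrow> 'y) \<Rightarrow> (real \<times> real \<Rightarrow> 'x \<Rightarrow> 'y::real_normed_vector) \<Rightarrow> bool"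
where
  "euler_flow U W y0 w \<longleftrightarrow> (\<forall>x\<in>U.
     (\<forall>N\<ge>1. w (1 / real N, 0) x = y0 x \<and>
        (\<forall>j<N. w (grid_node N (Suc j)) x = w (grid_node N j) x +
           (1 / real N) *\<^sub>R W (grid_node N j) x (w (grid_node N j) x))) \<and>
     w (0, 0) x = y0 x \<and>
     (\<forall>t\<in>{0..1}. ((\<lambda>t. w (0, t) x) has_vector_derivative W (0, t) x (w (0, t) x)) (at t within {0..1})))"

lemma euler_flow_node:
  assumes "euler_flow U W y0 w" "x \<in> U" "1 \<le> N"
  shows "w (1 / real N, 0) x = y0 x"
    and "j < N \<Longrightarrow> w (grid_node N (Suc j)) x = w (grid_node N j) x +
           (1 / real N) *\<^sub>R W (grid_node N j) x (w (grid_node N j) x)"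
  using assms by (auto simp: euler_flow_def)

lemma euler_flow_solution:
  assumes "euler_flow U W y0 w" "x \<in> U"
  shows "w (0, 0) x = y0 x"
    and "t \<in> {0..1} \<Longrightarrow> ((\<lambda>t. w (0, t) x) has_vector_derivative W (0, t) x (w (0, t) x)) (at t within {0..1})"
  using assms by (auto simp: euler_flow_def)

lemma euler_flow_solution_continuous:
  assumes "euler_flow U W y0 w" "x \<in> U"
  shows "continuous_on {0..1} (\<lambda>t. w (0, t) x)"
  using euler_flow_solution(2)[OF assms]
  by (force simp: continuous_on_eq_continuous_within intro: has_vector_derivative_continuous)

text \<open>A global Lipschitz bound is out of reach for the fields in question. It suffices to
  compare with the reference solution \<open>z\<close> itself, at nodes, for small steps and for
  starting points near \<open>x0\<close>.\<close>

definition lipschitz_along ::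
  "'x::metric_space set \<Rightarrow> (real \<times> real \<Rightarrow> 'x \<Rightarrow> 'y \<Rightarrow> 'y) \<Rightarrow> 'x \<Rightarrow> (real \<Rightarrow> 'y::real_normed_vector) \<Rightarrow> bool"
where
  "lipschitz_along U W x0 z \<longleftrightarrow> (\<exists>L\<ge>0. \<exists>\<rho>>0. \<forall>N j x y. 1 \<le> N \<longrightarrow> j \<le> N \<longrightarrow> x \<in> U \<longrightarrow>
     1 / real N < \<rho> \<longrightarrow> dist x x0 < \<rho> \<longrightarrow> dist y (z (real j / real N)) \<le> \<rho> \<longrightarrow>
     norm (W (grid_node N j) x y - W (grid_node N j) x (z (real j / real N)))
       \<le> L * norm (y - z (real j / real N)))"

lemma lipschitz_alongI:
  assumes "0 \<le> L" "0 < \<rho>"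
    and "\<And>N j x y. 1 \<le> N \<Longrightarrow> j \<le> N \<Longrightarrow> x \<in> U \<Longrightarrow> 1 / real N < \<rho> \<Longrightarrow> dist x x0 < \<rho> \<Longrightarrow>
      dist y (z (real j / real N)) \<le> \<rho> \<Longrightarrow>
      norm (W (grid_node N j) x y - W (grid_node N j) x (z (real j / real N)))
        \<le> L * norm (y - z (real j / real N))"
  shows "lipschitz_along U W x0 z"
  unfolding lipschitz_along_def using assms by metis

text \<open>Truncation errors are small by continuity of \<open>W\<close> at step size zero, and a
  discrete Gronwall argument sums them. The iterates may start at any \<open>x\<close> near
  \<open>x0\<close> while \<open>z\<close> starts from \<open>x0\<close>, so the estimate contains
  continuous dependence on the starting point; \<open>z\<close> is an arbitrary solution, so it
  contains uniqueness as well.\<close>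

lemma euler_flow_converges:
  fixes w :: "real \<times> real \<Rightarrow> 'x::metric_space \<Rightarrow> 'y::real_normed_vector"
  assumes w: "euler_flow U W y0 w"
    and W: "continuous_on (time_grid \<times> U \<times> Y) (\<lambda>(p, x, y). W p x y)"
    and y0: "continuous_on U y0"
    and x0: "x0 \<in> U"
    and z0: "z 0 = y0 x0"
    and z': "\<And>t. t \<in> {0..1} \<Longrightarrow> (z has_vector_derivative W (0, t) x0 (z t)) (at t within {0..1})"
    and zY: "\<And>t. t \<in> {0..1} \<Longrightarrow> z t \<in> Y"
    and lip: "lipschitz_along U W x0 z"
    and "0 < \<eta>"
  shows "\<exists>\<delta>>0. \<forall>N\<ge>1. \<forall>j\<le>N. \<forall>x\<in>U. 1 / real N < \<delta> \<longrightarrow> dist x x0 < \<delta> \<longrightarrow>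
    norm (w (grid_node N j) x - z (real j / real N)) < \<eta>"
proof -
  obtain L \<rho> where L: "L \<ge> 0" "\<rho> > 0" and lip:
    "\<And>N j x y. 1 \<le> N \<Longrightarrow> j \<le> N \<Longrightarrow> x \<in> U \<Longrightarrow> 1 / real N < \<rho> \<Longrightarrow> dist x x0 < \<rho> \<Longrightarrow> dist y (z (real j / real N)) \<le> \<rho> \<Longrightarrow>
     norm (W (grid_node N j) x y - W (grid_node N j) x (z (real j / real N)))
       \<le> L * norm (y - z (real j / real N))"
    using lip unfolding lipschitz_along_def by metis
  have zcont: "continuous_on {0..1} z"
    using z' by (force simp: continuous_on_eq_continuous_within intro: has_vector_derivative_continuous)
  \<comment> \<open>The final error is at most \<open>2 * \<kappa> * exp L\<close>; it must stay
    below the target \<open>\<eta>\<close> and within the tube of radius \<open>\<rho>\<close> in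
    which the Lipschitz bound holds.\<close>
  define \<kappa> where "\<kappa> = min \<eta> \<rho> / (4 * exp L)"
  have \<kappa>: "\<kappa> > 0" "2 * \<kappa> * exp L < \<eta>" "2 * \<kappa> * exp L \<le> \<rho>"
    using L(2) \<open>0 < \<eta>\<close> by (auto simp: \<kappa>_def min_def field_simps)
  have snd01: "snd p \<in> {0..1}" if "p \<in> time_grid" for p
    using that by (cases rule: time_grid_cases) auto
  define G where "G = (\<lambda>(p, x). W p x (z (snd p)))"
  have "continuous_on (time_grid \<times> U) (\<lambda>s. z (snd (fst s)))"
    by (rule continuous_on_compose2[OF zcont]) (use snd01 in \<open>auto intro!: continuous_intros\<close>)
  then have "continuous_on (time_grid \<times> U) (\<lambda>s. (fst s, snd s, z (snd (fst s))))"
    by (auto intro!: continuous_intros)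
  moreover have "(\<lambda>s. (fst s, snd s, z (snd (fst s)))) ` (time_grid \<times> U) \<subseteq> time_grid \<times> U \<times> Y"
    using snd01 zY by fastforce
  ultimately have "continuous_on (time_grid \<times> U) (\<lambda>s. case (fst s, snd s, z (snd (fst s))) of (p, x, y) \<Rightarrow> W p x y)"
    by (rule continuous_on_compose2[OF W])
  then have G: "continuous_on (time_grid \<times> U) G" by (simp add: G_def split_beta)
  define C where "C = ({0::real} \<times> {0..1::real}) \<times> {x0}"
  have "compact C" by (auto simp: C_def intro!: compact_Times)
  moreover have "C \<subseteq> time_grid \<times> U"
    using x0 by (auto simp: C_def time_grid_def)
  ultimately obtain d where d: "d > 0" and
    dG: "\<And>c s. c \<in> C \<Longrightarrow> s \<in> time_grid \<times> U \<Longrightarrow> dist s c < d \<Longrightarrow> dist (G s) (G c) < \<kappa>"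
    using continuous_on_compact_neighbourhood[OF G _ _ \<kappa>(1)] by metis
  obtain d0 where d0: "d0 > 0" "\<And>x. x \<in> U \<Longrightarrow> dist x x0 < d0 \<Longrightarrow> dist (y0 x) (y0 x0) < \<kappa>"
    using y0 x0 \<kappa>(1) unfolding continuous_on_iff by metis
  \<comment> \<open>Step size, time offset within a step and displacement of the starting point each
    contribute less than \<open>d / 4\<close> to a distance that must stay below
    \<open>d\<close>.\<close>
  define \<delta> where "\<delta> = min (min d0 \<rho>) (d / 4)"
  show ?thesis
  proof (intro exI conjI allI impI ballI)
    show "\<delta> > 0" using d d0 L by (auto simp: \<delta>_def)
    fix N j :: nat and x assume N: "1 \<le> N" and "j \<le> N" and x: "x \<in> U" "1 / real N < \<delta>" "dist x x0 < \<delta>"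
    let ?h = "1 / real N"
    let ?e = "\<lambda>j. norm (w (grid_node N j) x - z (real j / real N))"
    have trunc: "norm (z (real (Suc j) / real N) - z (real j / real N) -
        ?h *\<^sub>R W (?h, real j / real N) x (z (real j / real N))) \<le> ?h * \<kappa>" if j: "j < N" for j
    proof -
      let ?a = "real j / real N" and ?b = "real (Suc j) / real N"
      let ?v = "W (?h, ?a) x (z ?a)"
      have ab: "0 \<le> ?a" "?a \<le> ?b" "?b \<le> 1" "?b - ?a = ?h"
        using j by (auto simp: field_simps)
      have der: "((\<lambda>s. z s - s *\<^sub>R ?v) has_derivative (\<lambda>r. r *\<^sub>R (W (0, s) x0 (z s) - ?v))) (at s within {?a..?b})"
        if s: "s \<in> {?a..?b}" for s
      proof -
        have "0 \<le> s" "s \<le> 1" using s ab(1,3) unfolding atLeastAtMost_iff by linarith+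
        then have "(z has_vector_derivative W (0, s) x0 (z s)) (at s within {?a..?b})"
          by (intro has_vector_derivative_within_subset[OF z']) (use s ab in auto)
        then have "((\<lambda>s. z s - s *\<^sub>R ?v) has_vector_derivative (W (0, s) x0 (z s) - ?v)) (at s within {?a..?b})"
          by (auto intro!: derivative_eq_intros)
        then show ?thesis by (simp add: has_vector_derivative_def)
      qed
      have bd: "onorm (\<lambda>r. r *\<^sub>R (W (0, s) x0 (z s) - ?v)) \<le> \<kappa>" if s: "s \<in> {?a..?b}" for s
      proof (rule onorm_le)
        have "dist ((?h, ?a), x) ((0, s), x0) \<le> dist (?h, ?a) (0, s) + dist x x0"
          by (rule dist_Pair_le)
        also have "dist (?h, ?a) (0, s) \<le> dist ?h 0 + dist ?a s"
          by (rule dist_Pair_le)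
        also have "dist ?a s \<le> ?h" using s ab by (auto simp: dist_real_def)
        moreover have "0 \<le> s" "s \<le> 1" using s ab(1,3) unfolding atLeastAtMost_iff by linarith+
        ultimately have "dist ((?h, ?a), x) ((0, s), x0) < d" "0 \<le> s" "s \<le> 1" using x d by (auto simp: \<delta>_def)
        then have "dist (G ((?h, ?a), x)) (G ((0, s), x0)) < \<kappa>"
          using ab j N x by (intro dG) (auto simp: C_def intro: time_grid_node)
        then have "norm (W (0, s) x0 (z s) - ?v) \<le> \<kappa>"
          by (simp add: G_def dist_norm norm_minus_commute)
        then show "norm (r *\<^sub>R (W (0, s) x0 (z s) - ?v)) \<le> \<kappa> * norm r" for r
          by (simp add: mult_right_mono mult.commute[of "\<bar>r\<bar>"])
      qed
      have "norm ((z ?b - ?b *\<^sub>R ?v) - (z ?a - ?a *\<^sub>R ?v)) \<le> \<kappa> * norm (?b - ?a)"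
        by (rule differentiable_bound[OF _ der bd]) (use ab in auto)
      also have "(z ?b - ?b *\<^sub>R ?v) - (z ?a - ?a *\<^sub>R ?v) = z ?b - z ?a - (?b - ?a) *\<^sub>R ?v"
        by (simp add: algebra_simps)
      finally show ?thesis unfolding ab(4) by (simp add: mult.commute)
    qed
    \<comment> \<open>The first \<open>\<kappa>\<close> is the initial error, the second the
      truncation error accumulated up to time \<open>j / N\<close>. The induction hypothesis also
      keeps the iterate inside the tube, which makes the Lipschitz bound available for the next
      step.\<close>
    have "?e j \<le> exp (L * (real j / real N)) * (\<kappa> + \<kappa> * (real j / real N))"
      using \<open>j \<le> N\<close>
    proof (induction j)
      case 0
      then show ?case using d0(2)[OF x(1)] x N euler_flow_node(1)[OF w x(1) N] z0
        by (simp add: dist_norm \<delta>_def)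
    next
      case (Suc j)
      let ?a = "real j / real N" and ?b = "real (Suc j) / real N"
      have IH: "?e j \<le> exp (L * ?a) * (\<kappa> + \<kappa> * ?a)" using Suc by auto
      have a1: "?a \<le> 1" using Suc.prems by auto
      have "?e j \<le> exp L * (\<kappa> + \<kappa>)"
      proof (rule order_trans[OF IH])
        have "L * ?a \<le> L" "\<kappa> * ?a \<le> \<kappa>"
          using L(1) \<kappa>(1) a1 by (simp_all only: mult_left_le less_imp_le)
        then show "exp (L * ?a) * (\<kappa> + \<kappa> * ?a) \<le> exp L * (\<kappa> + \<kappa>)"
          using \<kappa>(1) by (intro mult_mono add_mono) auto
      qed
      then have "dist (w (?h, ?a) x) (z ?a) \<le> \<rho>" using \<kappa>(3) by (simp add: dist_norm algebra_simps)
      then have lipj: "norm (W (?h, ?a) x (w (?h, ?a) x) - W (?h, ?a) x (z ?a)) \<le> L * ?e j"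
        using Suc.prems N x by (intro lip) (auto simp: \<delta>_def)
      have hab: "?b = ?a + ?h" by (simp add: add_divide_distrib)
      have eq: "w (?h, ?b) x - z ?b = (w (?h, ?a) x - z ?a) +
         ?h *\<^sub>R (W (?h, ?a) x (w (?h, ?a) x) - W (?h, ?a) x (z ?a)) -
         (z ?b - z ?a - ?h *\<^sub>R W (?h, ?a) x (z ?a))"
        unfolding euler_flow_node(2)[OF w x(1) N Suc_le_lessD[OF Suc.prems]] scaleR_diff_right by simp
      have "?e (Suc j) \<le> ?e j + ?h * (L * ?e j) + ?h * \<kappa>"
      proof -
        have "norm (?h *\<^sub>R (W (?h, ?a) x (w (?h, ?a) x) - W (?h, ?a) x (z ?a))) \<le> ?h * (L * ?e j)"
          using mult_left_mono[OF lipj, of ?h] by simp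
        note 1 = order_trans[OF norm_triangle_ineq add_mono[OF order_refl this]]
        show ?thesis
          by (rule ord_eq_le_trans[OF arg_cong[OF eq, of norm]
                order_trans[OF norm_triangle_ineq4 add_mono[OF 1 trunc[OF Suc_le_lessD[OF Suc.prems]]]]])
      qed
      also have "\<dots> = (1 + L * ?h) * ?e j + ?h * \<kappa>"
      proof -
        have "e + h * (L * e) + h * \<kappa> = (1 + L * h) * e + h * \<kappa>" for e h by (simp add: algebra_simps)
        then show ?thesis .
      qed
      also have "\<dots> \<le> exp (L * ?h) * (exp (L * ?a) * (\<kappa> + \<kappa> * ?a)) + ?h * \<kappa>"
        using L by (intro add_right_mono mult_mono IH exp_ge_add_one_self) auto
      also have "\<dots> = exp (L * ?b) * (\<kappa> + \<kappa> * ?a) + ?h * \<kappa>"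
        unfolding hab distrib_left[of L] exp_add by simp
      also have "?h * \<kappa> \<le> exp (L * ?b) * (?h * \<kappa>)"
        using mult_right_mono[of 1 "exp (L * ?b)" "?h * \<kappa>"] L \<kappa>(1) by simp
      also have "exp (L * ?b) * (\<kappa> + \<kappa> * ?a) + exp (L * ?b) * (?h * \<kappa>) = exp (L * ?b) * (\<kappa> + \<kappa> * ?b)"
      proof -
        have "E * (\<kappa> + \<kappa> * a) + E * (h * \<kappa>) = E * (\<kappa> + \<kappa> * (a + h))" for E a h by (simp add: algebra_simps)
        then show ?thesis unfolding hab .
      qed
      finally show ?case by simp
    qed
    also have "\<dots> \<le> exp L * (\<kappa> + \<kappa>)"
    proof -
      have "real j / real N \<le> 1" using \<open>j \<le> N\<close> N by simp
      then have "L * (real j / real N) \<le> L" "\<kappa> * (real j / real N) \<le> \<kappa>"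
        using L(1) \<kappa>(1) by (simp_all only: mult_left_le less_imp_le)
      then show ?thesis using \<kappa>(1) by (intro mult_mono add_mono) auto
    qed
    also have "\<dots> < \<eta>" using \<kappa>(2) by (simp add: algebra_simps)
    finally show "?e j < \<eta>" .
  qed
qed

text \<open>Since \<open>z\<close> may be any solution with the right initial value, two solutions
  are limits of the same iterates and coincide; this later serves as the uniqueness theorem for the
  flow.\<close>

lemma euler_flow_grid_seq_lim:
  fixes w :: "real \<times> real \<Rightarrow> 'x::metric_space \<Rightarrow> 'y::real_normed_vector"
  assumes w: "euler_flow U W y0 w"
    and W: "continuous_on (time_grid \<times> U \<times> Y) (\<lambda>(p, x, y). W p x y)"
    and y0: "continuous_on U y0"
    and x0: "x0 \<in> U"
    and z0: "z 0 = y0 x0"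
    and z': "\<And>t. t \<in> {0..1} \<Longrightarrow> (z has_vector_derivative W (0, t) x0 (z t)) (at t within {0..1})"
    and zY: "\<And>t. t \<in> {0..1} \<Longrightarrow> z t \<in> Y"
    and lip: "lipschitz_along U W x0 z"
    and t: "t \<in> {0..1}"
  shows "(\<lambda>n. w (grid_seq t n) x0) \<longlonglongrightarrow> z t"
proof -
  have "(\<lambda>n. w (grid_seq t n) x0 - z (snd (grid_seq t n))) \<longlonglongrightarrow> 0"
  proof (rule LIMSEQ_I)
    fix e :: real assume "0 < e"
    obtain \<delta> where \<delta>: "\<delta> > 0" "\<And>N j. N \<ge> 1 \<Longrightarrow> j \<le> N \<Longrightarrow> 1 / real N < \<delta> \<Longrightarrow>
        norm (w (grid_node N j) x0 - z (real j / real N)) < e"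
      using euler_flow_converges[OF w W y0 x0 z0 z' zY lip \<open>0 < e\<close>] x0 by (metis dist_self)
    obtain n0 where n0: "1 / real (Suc n0) < \<delta>" using \<delta>(1) nat_approx_posE by blast
    show "\<exists>n0. \<forall>n\<ge>n0. norm (w (grid_seq t n) x0 - z (snd (grid_seq t n)) - 0) < e"
    proof (intro exI[of _ n0] allI impI)
      fix n assume n: "n0 \<le> n"
      obtain j where j: "j \<le> Suc n" "grid_seq t n = (grid_node (Suc n) j)"
        using grid_seq_node[OF t] .
      have "1 / real (Suc n) \<le> 1 / real (Suc n0)" using n by (intro divide_left_mono) auto
      then show "norm (w (grid_seq t n) x0 - z (snd (grid_seq t n)) - 0) < e"
        using \<delta>(2)[of "Suc n" j] j n0 by (simp del: of_nat_Suc)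
    qed
  qed
  moreover have "(\<lambda>n. z (snd (grid_seq t n))) \<longlonglongrightarrow> z t"
  proof -
    have "continuous_on {0..1} z"
      using z' by (force simp: continuous_on_eq_continuous_within intro: has_vector_derivative_continuous)
    moreover have "(\<lambda>n. snd (grid_seq t n)) \<longlonglongrightarrow> t"
      using tendsto_snd[OF grid_seq_lim[OF t]] by simp
    moreover have "snd (grid_seq t n) \<in> {0..1}" for n
      using grid_seq_in[OF t, of n] by (cases rule: time_grid_cases) auto
    ultimately show ?thesis using t by (intro continuous_on_tendsto_compose[of _ z]) auto
  qed
  ultimately show ?thesis using tendsto_add by fastforce
qed

text \<open>At a node the iterate is built from finitely many continuous maps. At step size zero,
  nearby nodes are compared with the exact solution from \<open>x\<close> by the convergence
  estimate, and nearby exact solutions are limits of nodes.\<close>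

lemma euler_flow_continuous:
  fixes w :: "real \<times> real \<Rightarrow> 'x::metric_space \<Rightarrow> 'y::real_normed_vector"
  assumes w: "euler_flow U W y0 w"
    and W: "continuous_on (time_grid \<times> U \<times> Y) (\<lambda>(p, x, y). W p x y)"
    and y0: "continuous_on U y0"
    and wY: "\<And>p x. p \<in> time_grid \<Longrightarrow> x \<in> U \<Longrightarrow> w p x \<in> Y"
    and lip: "\<And>x0. x0 \<in> U \<Longrightarrow> lipschitz_along U W x0 (\<lambda>t. w (0, t) x0)"
  shows "continuous_on (time_grid \<times> U) (\<lambda>(p, x). w p x)"
proof -
  have node: "continuous_on U (w (grid_node N j))" if N: "1 \<le> N" "j \<le> N" for N j
    using N(2)
  proof (induction j)
    case 0
    show ?case
      using y0 euler_flow_node(1)[OF w _ N(1)] by (auto elim!: continuous_on_eq)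
  next
    case (Suc j)
    let ?p = "grid_node N j"
    have p: "?p \<in> time_grid" using Suc.prems N by (intro time_grid_node) auto
    have IH: "continuous_on U (w ?p)" using Suc by auto
    have "continuous_on U (\<lambda>x. W ?p x (w ?p x))"
      using continuous_on_compose2[OF W, of U "\<lambda>x. (?p, x, w ?p x)"] IH p wY
      by (force intro!: continuous_intros)
    then have "continuous_on U (\<lambda>x. w ?p x + (1 / real N) *\<^sub>R W ?p x (w ?p x))"
      by (intro continuous_intros IH)
    then show ?case
      by (rule continuous_on_eq) (use euler_flow_node(2)[OF w _ N(1), of _ j] Suc.prems in auto)
  qed
  have lim: "(\<lambda>n. w (grid_seq t n) x) \<longlonglongrightarrow> w (0, t) x" if "x \<in> U" "t \<in> {0..1}" for x t
    using that euler_flow_solution[OF w that(1)]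
    by (intro euler_flow_grid_seq_lim[OF w W y0, where z = "\<lambda>t. w (0, t) x"] lip wY time_grid_0) auto
  show ?thesis
    unfolding continuous_on_iff
  proof (intro ballI allI impI)
    fix px and e :: real assume px: "px \<in> time_grid \<times> U" and "0 < e"
    obtain p x where [simp]: "px = (p, x)" by fastforce
    from px have p: "p \<in> time_grid" and x: "x \<in> U" by auto
    have "\<exists>d>0. \<forall>q\<in>time_grid. \<forall>y\<in>U. dist q p < d \<longrightarrow> dist y x < d \<longrightarrow> dist (w q y) (w p x) < e"
      using p
    proof (cases rule: time_grid_cases)
      case (2 N j)
      obtain d where d: "d > 0" "\<And>q. q \<in> time_grid \<Longrightarrow> dist q p < d \<Longrightarrow> q = p"
        using time_grid_isolated[OF 2(1), of j] 2(3) by metis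
      obtain d' where d': "d' > 0" "\<And>y. y \<in> U \<Longrightarrow> dist y x < d' \<Longrightarrow> dist (w p y) (w p x) < e"
        using node[OF 2(1,2)] x \<open>0 < e\<close> unfolding continuous_on_iff 2(3) by metis
      show ?thesis
        by (rule exI[of _ "min d d'"]) (use d d' in auto)
    next
      case (1 t)
      have e3: "e / 3 > 0" using \<open>0 < e\<close> by simp
      obtain \<delta> where \<delta>: "\<delta> > 0" "\<And>N j y. N \<ge> 1 \<Longrightarrow> j \<le> N \<Longrightarrow> y \<in> U \<Longrightarrow> 1 / real N < \<delta> \<Longrightarrow> dist y x < \<delta> \<Longrightarrow>
        norm (w (grid_node N j) y - w (0, real j / real N) x) < e / 3"
        using euler_flow_converges[OF w W y0 x, of "\<lambda>t. w (0, t) x" "e / 3"]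
          euler_flow_solution[OF w x] lip[OF x] wY[OF time_grid_0 x] e3 by metis
      obtain \<gamma> where \<gamma>: "\<gamma> > 0" "\<And>s. s \<in> {0..1} \<Longrightarrow> dist s t < \<gamma> \<Longrightarrow> dist (w (0, s) x) (w (0, t) x) < e / 3"
        using euler_flow_solution_continuous[OF w x] 1(1) e3 unfolding continuous_on_iff by metis
      have node_close: "dist (w q y) (w (0, snd q) x) \<le> e / 3"
        if "q \<in> time_grid" "0 < fst q" "fst q < \<delta>" "y \<in> U" "dist y x < \<delta>" for q y
        using that(1)
      proof (cases rule: time_grid_cases)
        case (2 N j)
        then show ?thesis using \<delta>(2)[of N j y] that by (auto simp: dist_norm)
      qed (use that in auto)
      \<comment> \<open>Letting the step size tend to zero along \<open>grid_seq s\<close> transfers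
        the estimate from the nodes to the exact solutions.\<close>
      have close: "dist (w (0, s) y) (w (0, s) x) \<le> e / 3" if s: "s \<in> {0..1}" and y: "y \<in> U" "dist y x < \<delta>" for s y
      proof (rule LIMSEQ_le_const2[OF tendsto_dist[OF lim[OF y(1) s]]])
        show "(\<lambda>n. w (0, snd (grid_seq s n)) x) \<longlonglongrightarrow> w (0, s) x"
        proof (rule continuous_on_tendsto_compose[OF euler_flow_solution_continuous[OF w x]])
          show "(\<lambda>n. snd (grid_seq s n)) \<longlonglongrightarrow> s"
            using tendsto_snd[OF grid_seq_lim[OF s]] by simp
          have "snd (grid_seq s n) \<in> {0..1}" for n
            using grid_seq_in[OF s, of n] by (cases rule: time_grid_cases) auto
          then show "\<forall>\<^sub>F n in sequentially. snd (grid_seq s n) \<in> {0..1}" by simp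
        qed (rule s)
        obtain n0 where n0: "1 / real (Suc n0) < \<delta>" using \<delta>(1) nat_approx_posE by blast
        have "dist (w (grid_seq s n) y) (w (0, snd (grid_seq s n)) x) \<le> e / 3" if "n \<ge> n0" for n
        proof (rule node_close[OF grid_seq_in[OF s] _ _ y])
          have "1 / real (Suc n) \<le> 1 / real (Suc n0)" using that by (intro divide_left_mono) auto
          then show "fst (grid_seq s n) < \<delta>" "0 < fst (grid_seq s n)" using n0 by (auto simp: grid_seq_def)
        qed
        then show "\<exists>n0. \<forall>n\<ge>n0. dist (w (grid_seq s n) y) (w (0, snd (grid_seq s n)) x) \<le> e / 3" by blast
      qed
      show ?thesis
      proof (intro exI[of _ "min \<delta> \<gamma>"] conjI ballI impI)
        fix q y assume q: "q \<in> time_grid" "dist q p < min \<delta> \<gamma>" and y: "y \<in> U" "dist y x < min \<delta> \<gamma>"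
        have fs: "dist (fst q) 0 < \<delta>" "dist (snd q) t < \<gamma>"
          using dist_fst_le[of q p] dist_snd_le[of q p] q(2) 1(2) by auto
        have sq: "snd q \<in> {0..1}" using q(1) by (cases rule: time_grid_cases) auto
        have "dist (w q y) (w (0, snd q) x) \<le> e / 3"
          using q(1)
        proof (cases rule: time_grid_cases)
          case (1 s)
          then show ?thesis using close[of s y] y by auto
        next
          case (2 N j)
          then show ?thesis using fs y q(1) by (intro node_close) auto
        qed
        moreover have "dist (w (0, snd q) x) (w p x) < e / 3"
          using \<gamma>(2)[OF sq fs(2)] 1(2) by simp
        ultimately show "dist (w q y) (w p x) < e"
          using dist_triangle[of "w q y" "w p x" "w (0, snd q) x"] \<open>0 < e\<close> by linarith
      qed (use \<delta> \<gamma> in auto)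
    qed
    then obtain d where d: "d > 0" "\<And>q y. q \<in> time_grid \<Longrightarrow> y \<in> U \<Longrightarrow> dist q p < d \<Longrightarrow> dist y x < d \<Longrightarrow> dist (w q y) (w p x) < e"
      by blast
    show "\<exists>d>0. \<forall>x'\<in>time_grid \<times> U. dist x' px < d \<longrightarrow> dist (case x' of (p, x) \<Rightarrow> w p x) (case px of (p, x) \<Rightarrow> w p x) < e"
    proof (intro exI[of _ d] conjI ballI impI d)
      fix x' assume "x' \<in> time_grid \<times> U" "dist x' px < d"
      then show "dist (case x' of (p, x) \<Rightarrow> w p x) (case px of (p, x) \<Rightarrow> w p x) < e"
        using dist_fst_le[of x' px] dist_snd_le[of x' px] by (auto simp: split_beta intro!: d(2))
    qed
  qed
qed

text \<open>If the derivatives of the discrete iterates extend continuously to step size \<open>0\<close>, they converge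
  locally uniformly, so the limit is differentiable.\<close>

lemma time_grid_has_derivative_limit:
  fixes f :: "real \<times> real \<Rightarrow> 'a::euclidean_space \<Rightarrow> 'b::banach"
  assumes "open U"
    and f: "continuous_on (time_grid \<times> U) (\<lambda>(p, x). f p x)"
    and f'_cont: "\<And>b. b \<in> Basis \<Longrightarrow> continuous_on (time_grid \<times> U) (\<lambda>(p, x). f' p x b)"
    and f'_lin: "\<And>p x v. p \<in> time_grid \<Longrightarrow> x \<in> U \<Longrightarrow> f' p x v = (\<Sum>b\<in>Basis. (v \<bullet> b) *\<^sub>R f' p x b)"
    and der: "\<And>N j x. 1 \<le> N \<Longrightarrow> j \<le> N \<Longrightarrow> x \<in> U \<Longrightarrow>
      (f (grid_node N j) has_derivative f' (grid_node N j) x) (at x)"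
    and t: "t \<in> {0..1}" and x: "x \<in> U"
  shows "(f (0, t) has_derivative f' (0, t) x) (at x)"
proof -
  obtain r where r: "r > 0" "cball x r \<subseteq> U"
    using \<open>open U\<close> x open_contains_cball by blast
  have t0: "(0, t) \<in> time_grid" using t by (rule time_grid_0)
  have flim: "(\<lambda>n. f (grid_seq t n) y) \<longlonglongrightarrow> f (0, t) y" if "y \<in> U" for y
  proof -
    have "(\<lambda>n. (grid_seq t n, y)) \<longlonglongrightarrow> ((0, t), y)"
      by (intro tendsto_Pair grid_seq_lim[OF t] tendsto_const)
    from continuous_on_tendsto_compose[OF f this] that t0 grid_seq_in[OF t] show ?thesis by auto
  qed
  have "\<exists>g. \<forall>y\<in>ball x r. (\<lambda>n. f (grid_seq t n) y) \<longlonglongrightarrow> g y \<and> (g has_derivative f' (0, t) y) (at y within ball x r)"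
  proof (rule has_derivative_sequence)
    show "(f (grid_seq t n) has_derivative f' (grid_seq t n) y) (at y within ball x r)"
      if y: "y \<in> ball x r" for n y
    proof -
      obtain j where j: "j \<le> Suc n" "grid_seq t n = (grid_node (Suc n) j)"
        using grid_seq_node[OF t] .
      show ?thesis unfolding j(2)
        by (rule has_derivative_at_withinI, rule der) (use j r y in auto)
    qed
    fix e :: real assume "e > 0"
    \<comment> \<open>An error of \<open>?e\<close> on each basis vector adds up to at most
      \<open>e * norm v\<close> on \<open>v\<close>, the form in which
      \<open>has_derivative_sequence\<close> asks for uniform convergence.\<close>
    let ?e = "e / DIM('a)"
    have e: "?e > 0" using \<open>e > 0\<close> by simp
    let ?C = "{(0::real, t)} \<times> cball x r"
    have C: "compact ?C" "?C \<subseteq> time_grid \<times> U" using r t0 by (auto intro!: compact_Times)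
    have "\<forall>b\<in>Basis. \<exists>d>0. \<forall>q\<in>time_grid. \<forall>y\<in>cball x r. dist q (0, t) < d \<longrightarrow> dist (f' q y b) (f' (0, t) y b) < ?e"
    proof
      fix b :: 'a assume b: "b \<in> Basis"
      obtain d where d: "d > 0" "\<forall>c\<in>?C. \<forall>s\<in>time_grid \<times> U. dist s c < d \<longrightarrow>
          dist (case s of (p, x) \<Rightarrow> f' p x b) (case c of (p, x) \<Rightarrow> f' p x b) < ?e"
        using continuous_on_compact_neighbourhood[OF f'_cont[OF b] C e] by blast
      have "dist (f' q y b) (f' (0, t) y b) < ?e" if "q \<in> time_grid" "y \<in> cball x r" "dist q (0, t) < d" for q y
      proof -
        have "dist (q, y) ((0, t), y) < d" using that(3) by (simp add: dist_Pair_Pair)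
        then show ?thesis using d(2) that r by force
      qed
      then show "\<exists>d>0. \<forall>q\<in>time_grid. \<forall>y\<in>cball x r. dist q (0, t) < d \<longrightarrow> dist (f' q y b) (f' (0, t) y b) < ?e"
        using d(1) by blast
    qed
    then obtain d where d: "\<And>b. b \<in> Basis \<Longrightarrow> d b > 0"
      "\<And>b q y. b \<in> Basis \<Longrightarrow> q \<in> time_grid \<Longrightarrow> y \<in> cball x r \<Longrightarrow> dist q (0, t) < d b \<Longrightarrow> dist (f' q y b) (f' (0, t) y b) < ?e"
      by metis
    have "\<forall>\<^sub>F n in sequentially. \<forall>b\<in>Basis. dist (grid_seq t n) (0, t) < d b"
      using grid_seq_lim[OF t] d(1) by (intro eventually_ball_finite) (auto simp: tendsto_iff)
    then show "\<forall>\<^sub>F n in sequentially. \<forall>y\<in>ball x r. \<forall>v. norm (f' (grid_seq t n) y v - f' (0, t) y v) \<le> e * norm v"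
    proof (rule eventually_mono, intro ballI allI)
      fix n y v assume n: "\<forall>b\<in>Basis. dist (grid_seq t n) (0, t) < d b" and y: "y \<in> ball x r"
      have yU: "y \<in> U" using y r by auto
      have "f' (grid_seq t n) y v - f' (0, t) y v = (\<Sum>b\<in>Basis. (v \<bullet> b) *\<^sub>R (f' (grid_seq t n) y b - f' (0, t) y b))"
        unfolding f'_lin[OF grid_seq_in[OF t] yU, of n v] f'_lin[OF t0 yU, of v]
        by (simp add: sum_subtractf scaleR_diff_right)
      also have "norm \<dots> \<le> (\<Sum>b\<in>(Basis::'a set). norm v * ?e)"
      proof (rule sum_norm_le)
        fix b :: 'a assume b: "b \<in> Basis"
        have "norm (f' (grid_seq t n) y b - f' (0, t) y b) \<le> ?e"
          using d(2)[OF b grid_seq_in[OF t], of y n] n b y by (auto simp: dist_norm intro: less_imp_le)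
        then show "norm ((v \<bullet> b) *\<^sub>R (f' (grid_seq t n) y b - f' (0, t) y b)) \<le> norm v * ?e"
          unfolding norm_scaleR by (intro mult_mono Basis_le_norm b) auto
      qed
      also have "\<dots> = e * norm v" by simp
      finally show "norm (f' (grid_seq t n) y v - f' (0, t) y v) \<le> e * norm v" .
    qed
  next
    show "(\<lambda>n. f (grid_seq t n) x) \<longlonglongrightarrow> f (0, t) x" by (rule flim[OF x])
  qed (use r in auto)
  then obtain g where g: "\<And>y. y \<in> ball x r \<Longrightarrow> (\<lambda>n. f (grid_seq t n) y) \<longlonglongrightarrow> g y"
    "\<And>y. y \<in> ball x r \<Longrightarrow> (g has_derivative f' (0, t) y) (at y within ball x r)"
    by blast
  have gf: "g y = f (0, t) y" if "y \<in> ball x r" for y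
  proof -
    have "y \<in> U" using that r by auto
    then show ?thesis by (rule LIMSEQ_unique[OF g(1)[OF that] flim])
  qed
  have "(g has_derivative f' (0, t) x) (at x)"
    using g(2)[of x] r by (simp add: at_within_open[of x "ball x r"])
  then show ?thesis
    by (rule has_derivative_transform_within_open[OF _ open_ball[of x r]]) (use gf r in auto)
qed

text \<open>The iterates exist by recursion whatever the field; only the solutions at step size zero
  have to be supplied.\<close>

lemma euler_flow_exists:
  assumes z0: "\<And>x. x \<in> U \<Longrightarrow> z x 0 = y0 x"
    and z': "\<And>x t. x \<in> U \<Longrightarrow> t \<in> {0..1} \<Longrightarrow> (z x has_vector_derivative W (0, t) x (z x t)) (at t within {0..1})"
  obtains w where "euler_flow U W y0 w" "\<And>x t. w (0, t) x = z x t"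
proof -
  define \<Psi> where "\<Psi> N x = rec_nat (y0 x) (\<lambda>j y. y + (1 / real N) *\<^sub>R W (grid_node N j) x y)" for N x
  \<comment> \<open>A node stores only \<open>1 / N\<close> and \<open>j / N\<close>; rounding
    \<open>1 / fst p\<close> and \<open>snd p / fst p\<close> recovers \<open>N\<close> and
    \<open>j\<close>.\<close>
  define w where "w p x = (if fst p = 0 then z x (snd p)
     else \<Psi> (nat (round (1 / fst p))) x (nat (round (snd p / fst p))))" for p x
  have node: "w (grid_node N j) x = \<Psi> N x j" if "1 \<le> N" for N j x
    using that by (simp add: w_def)
  have "\<Psi> N x (Suc j) = \<Psi> N x j + (1 / real N) *\<^sub>R W (grid_node N j) x (\<Psi> N x j)" for N x j
    by (simp add: \<Psi>_def)
  then have suc: "w (grid_node N (Suc j)) x = w (grid_node N j) x +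
           (1 / real N) *\<^sub>R W (grid_node N j) x (w (grid_node N j) x)"
    if "1 \<le> N" for N j x
    unfolding node[OF that] .
  have zero: "w (1 / real N, 0) x = y0 x" if "1 \<le> N" for N x
    using node[OF that, of 0] by (simp add: \<Psi>_def)
  have "w (0, t) x = z x t" for t x by (simp add: w_def)
  moreover from this have "euler_flow U W y0 w" using suc zero z0 z' unfolding euler_flow_def by auto
  ultimately show thesis using that by blast
qed

section \<open>Linear equations\<close>

lemma linear_ode_exists:
  fixes A :: "real \<Rightarrow> 'y::euclidean_space \<Rightarrow> 'y"
  assumes lin: "\<And>t. t \<in> {0..1} \<Longrightarrow> linear (A t)"
    and A: "\<And>b. b \<in> Basis \<Longrightarrow> continuous_on {0..1} (\<lambda>t. A t b)"
    and B: "continuous_on {0..1} B"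
  obtains z where "z 0 = w0"
    "\<And>t. t \<in> {0..1} \<Longrightarrow> (z has_vector_derivative A t (z t) + B t) (at t within {0..1})"
proof -
  have Aexp: "A t y = (\<Sum>b\<in>Basis. (y \<bullet> b) *\<^sub>R A t b)" if "t \<in> {0..1}" for t y
    by (rule linear_expand_Basis[OF lin[OF that]])
  have Acont: "continuous_on {0..1} (\<lambda>t. A t (y t))" if "continuous_on {0..1} y" for y
  proof (rule continuous_on_eq)
    show "continuous_on {0..1} (\<lambda>t. \<Sum>b\<in>Basis. (y t \<bullet> b) *\<^sub>R A t b)"
      by (intro continuous_intros that A)
  qed (use Aexp in auto)
  obtain L where L: "L \<ge> 0" "\<And>t y. t \<in> {0..1} \<Longrightarrow> norm (A t y) \<le> L * norm y"
  proof -
    have "\<forall>b\<in>Basis. \<exists>M. \<forall>t\<in>{0..1}. norm (A t b) \<le> M"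
      using compact_imp_bounded[OF compact_continuous_image[OF A compact_Icc]] by (force simp: bounded_iff)
    then obtain M where M: "\<And>b t. b \<in> Basis \<Longrightarrow> t \<in> {0..1} \<Longrightarrow> norm (A t b) \<le> M b" by metis
    show thesis
    proof (rule that[of "\<Sum>b\<in>Basis. M b"])
      have "0 \<le> M b" if "b \<in> Basis" for b using order_trans[OF norm_ge_zero M[OF that, of 0]] by simp
      then show "0 \<le> (\<Sum>b\<in>Basis. M b)" by (simp add: sum_nonneg)
      fix t :: real and y assume t: "t \<in> {0..1}"
      have "norm (A t y) \<le> (\<Sum>b\<in>Basis. M b * norm y)"
        unfolding Aexp[OF t, of y]
      proof (rule sum_norm_le)
        fix b :: 'y assume b: "b \<in> Basis"
        show "norm ((y \<bullet> b) *\<^sub>R A t b) \<le> M b * norm y"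
          using mult_mono[OF Basis_le_norm[OF b, of y] M[OF b t]] by (simp add: mult.commute)
      qed
      then show "norm (A t y) \<le> (\<Sum>b\<in>Basis. M b) * norm y" by (simp add: sum_distrib_right)
    qed
  qed
  \<comment> \<open>Picard increments: \<open>u 0\<close> is the solution for \<open>A = 0\<close>,
    and each later term integrates \<open>A\<close> applied to the previous one. The factorial in
    the bound \<open>C * (L * t) ^ n / fact n\<close> makes the series converge on the whole
    interval, however large \<open>L\<close> is.\<close>
  define u where "u = rec_nat (\<lambda>t. w0 + integral {0..t} B) (\<lambda>_ y t. integral {0..t} (\<lambda>s. A s (y s)))"
  have u0: "u 0 = (\<lambda>t. w0 + integral {0..t} B)" and uS: "u (Suc n) = (\<lambda>t. integral {0..t} (\<lambda>s. A s (u n s)))" for n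
    by (simp_all add: u_def)
  have indef: "continuous_on {0..1} (\<lambda>t. integral {0..t} g)" if "continuous_on {0..1} g" for g :: "real \<Rightarrow> 'y"
    using indefinite_integral_continuous_1[OF integrable_continuous_interval[OF that]] .
  have ucont: "continuous_on {0..1} (u n)" for n
    by (induction n) (auto simp: u0 uS intro!: continuous_intros indef B Acont)
  obtain C where C: "C \<ge> 0" "\<And>t. t \<in> {0..1} \<Longrightarrow> norm (u 0 t) \<le> C"
  proof -
    obtain C where C: "\<And>t. t \<in> {0..1} \<Longrightarrow> norm (u 0 t) \<le> C"
      using compact_imp_bounded[OF compact_continuous_image[OF ucont[of 0] compact_Icc]] by (force simp: bounded_iff)
    have "0 \<le> C" by (rule order_trans[OF norm_ge_zero C[of 0]]) simp
    with C show thesis using that by blast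
  qed
  have ubound: "norm (u n t) \<le> C * (L * t) ^ n / fact n" if "t \<in> {0..1}" for n t
    using that
  proof (induction n arbitrary: t)
    case 0
    then show ?case using C by simp
  next
    case (Suc n)
    have "((\<lambda>s. L * (C * (L * s) ^ n / fact n)) has_integral
       (C * (L * t) ^ Suc n / fact (Suc n) - C * (L * 0) ^ Suc n / fact (Suc n))) {0..t}"
    proof (rule fundamental_theorem_of_calculus)
      fix s :: real
      have *: "((\<lambda>s. C * (L * s) ^ Suc n / fact (Suc n)) has_real_derivative
         C * (of_nat (Suc n) * (L * s) ^ n * L) / fact (Suc n)) (at s within {0..t})"
        by (auto intro!: derivative_eq_intros simp del: power_Suc fact_Suc)
      have "C * (of_nat (Suc n) * (L * s) ^ n * L) / fact (Suc n) = L * (C * (L * s) ^ n / fact n)"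
        by (simp add: field_simps del: of_nat_Suc)
      with * show "((\<lambda>s. C * (L * s) ^ Suc n / fact (Suc n)) has_vector_derivative L * (C * (L * s) ^ n / fact n))
         (at s within {0..t})"
        by (simp only: has_real_derivative_iff_has_vector_derivative)
    qed (use Suc in auto)
    then have hi: "((\<lambda>s. L * (C * (L * s) ^ n / fact n)) has_integral (C * (L * t) ^ Suc n / fact (Suc n))) {0..t}"
      by simp
    have sub: "{0..t} \<subseteq> {0..1}" using Suc.prems by auto
    have "norm (integral {0..t} (\<lambda>s. A s (u n s))) \<le> integral {0..t} (\<lambda>s. L * (C * (L * s) ^ n / fact n))"
    proof (rule integral_norm_bound_integral)
      show "(\<lambda>s. A s (u n s)) integrable_on {0..t}"
        by (intro integrable_continuous_interval continuous_on_subset[OF Acont[OF ucont] sub])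
      show "norm (A s (u n s)) \<le> L * (C * (L * s) ^ n / fact n)" if "s \<in> {0..t}" for s
        using that sub Suc.IH[of s] L by (intro order_trans[OF L(2)] mult_left_mono) auto
    qed (use hi in auto)
    then show ?case unfolding uS using integral_unique[OF hi] by simp
  qed
  define M where "M n = C * L ^ n / fact n" for n
  have uM: "norm (u n t) \<le> M n" if t: "t \<in> {0..1}" for n t
  proof (rule order_trans[OF ubound[OF t]])
    have "(L * t) ^ n \<le> L ^ n" using t L by (intro power_mono) (auto simp: mult_left_le)
    then show "C * (L * t) ^ n / fact n \<le> M n"
      unfolding M_def using C by (intro divide_right_mono mult_left_mono) auto
  qed
  have Msum: "summable M"
    using summable_mult[OF summable_exp[of L], of C] by (simp add: M_def[abs_def] field_simps)
  define z where "z t = (\<Sum>n. u n t)" for t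
  have ulim: "uniform_limit {0..1} (\<lambda>n t. \<Sum>i<n. u i t) z sequentially"
    unfolding z_def by (rule Weierstrass_m_test[OF uM Msum]) auto
  have zcont: "continuous_on {0..1} z"
    by (rule uniform_limit_theorem[OF _ ulim]) (auto intro!: always_eventually continuous_intros ucont)
  have zeq: "z t = w0 + integral {0..t} (\<lambda>s. A s (z s) + B s)" if t: "t \<in> {0..1}" for t
  proof (rule LIMSEQ_unique)
    have sub: "{0..t} \<subseteq> {0..1}" using t by auto
    show "(\<lambda>n. \<Sum>i<Suc n. u i t) \<longlonglongrightarrow> z t"
      using tendsto_uniform_limitI[OF ulim t] by (rule LIMSEQ_Suc)
    \<comment> \<open>The partial sums are the Picard iterates; linearity of \<open>A s\<close>
      collects the sum under the integral.\<close>
    have part: "(\<Sum>i<Suc n. u i t) = w0 + integral {0..t} B + integral {0..t} (\<lambda>s. A s (\<Sum>i<n. u i s))" for n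
    proof -
      have int: "(\<lambda>s. A s (u i s)) integrable_on {0..t}" for i
        by (intro integrable_continuous_interval continuous_on_subset[OF Acont[OF ucont] sub])
      have "(\<Sum>i<Suc n. u i t) = u 0 t + (\<Sum>i<n. u (Suc i) t)" by (rule sum.lessThan_Suc_shift)
      also have "(\<Sum>i<n. u (Suc i) t) = integral {0..t} (\<lambda>s. \<Sum>i<n. A s (u i s))"
        unfolding uS using int by (simp add: integral_sum)
      also have "\<dots> = integral {0..t} (\<lambda>s. A s (\<Sum>i<n. u i s))"
        by (intro integral_cong) (use sub lin in \<open>auto simp: linear_sum subset_iff\<close>)
      finally show ?thesis by (simp add: u0)
    qed
    have intAz: "(\<lambda>s. A s (z s)) integrable_on {0..t}"
      by (intro integrable_continuous_interval continuous_on_subset[OF Acont[OF zcont] sub])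
    have "(\<lambda>n. integral {0..t} (\<lambda>s. A s (\<Sum>i<n. u i s))) \<longlonglongrightarrow> integral {0..t} (\<lambda>s. A s (z s))"
    proof (rule LIMSEQ_I)
      fix e :: real assume "0 < e"
      define e' where "e' = e / (L + 1)"
      have e': "e' > 0" "L * e' < e" using \<open>0 < e\<close> L(1) by (auto simp: e'_def field_simps)
      from uniform_limitD[OF ulim e'(1)] obtain n0 where n0:
        "\<And>n s. n \<ge> n0 \<Longrightarrow> s \<in> {0..1} \<Longrightarrow> norm ((\<Sum>i<n. u i s) - z s) < e'"
        unfolding eventually_sequentially dist_norm by blast
      show "\<exists>n0. \<forall>n\<ge>n0. norm (integral {0..t} (\<lambda>s. A s (\<Sum>i<n. u i s)) - integral {0..t} (\<lambda>s. A s (z s))) < e"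
      proof (intro exI[of _ n0] allI impI)
        fix n assume n: "n0 \<le> n"
        have intn: "(\<lambda>s. A s (\<Sum>i<n. u i s)) integrable_on {0..t}"
          by (intro integrable_continuous_interval continuous_on_subset[OF Acont sub] continuous_intros ucont)
        have "norm (integral {0..t} (\<lambda>s. A s (\<Sum>i<n. u i s) - A s (z s))) \<le> integral {0..t} (\<lambda>s. L * e')"
        proof (rule integral_norm_bound_integral)
          fix s assume s: "s \<in> {0..t}"
          then have s1: "s \<in> {0..1}" using sub by blast
          have "A s (\<Sum>i<n. u i s) - A s (z s) = A s ((\<Sum>i<n. u i s) - z s)"
            using lin[OF s1] by (simp add: linear_diff)
          also have "norm \<dots> \<le> L * e'"
            using n0[OF n s1] L(1) by (intro order_trans[OF L(2)[OF s1]] mult_left_mono) auto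
          finally show "norm (A s (\<Sum>i<n. u i s) - A s (z s)) \<le> L * e'" .
        qed (auto intro!: integrable_diff intn intAz)
        also have "\<dots> = L * e' * t" using t by simp
        also have "\<dots> \<le> L * e'" using t L e' by (intro mult_left_le) auto
        finally show "norm (integral {0..t} (\<lambda>s. A s (\<Sum>i<n. u i s)) - integral {0..t} (\<lambda>s. A s (z s))) < e"
          using e'(2) by (simp add: integral_diff[OF intn intAz])
      qed
    qed
    then have "(\<lambda>n. w0 + integral {0..t} B + integral {0..t} (\<lambda>s. A s (\<Sum>i<n. u i s))) \<longlonglongrightarrow>
      w0 + integral {0..t} B + integral {0..t} (\<lambda>s. A s (z s))"
      by (intro tendsto_intros)
    moreover have intB: "B integrable_on {0..t}"
      by (intro integrable_continuous_interval continuous_on_subset[OF B sub])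
    ultimately show "(\<lambda>n. \<Sum>i<Suc n. u i t) \<longlonglongrightarrow> w0 + integral {0..t} (\<lambda>s. A s (z s) + B s)"
      unfolding part integral_add[OF intAz intB] by (simp only: add_ac)
  qed
  show thesis
  proof (rule that[of z])
    show "z 0 = w0" using zeq[of 0] by simp
    fix t :: real assume t: "t \<in> {0..1}"
    have "continuous_on {0..1} (\<lambda>s. A s (z s) + B s)" by (intro continuous_intros Acont zcont B)
    from has_vector_derivative_add[OF has_vector_derivative_const integral_has_vector_derivative[OF this t]]
    have "((\<lambda>t. w0 + integral {0..t} (\<lambda>s. A s (z s) + B s)) has_vector_derivative A t (z t) + B t) (at t within {0..1})"
      by simp
    then show "(z has_vector_derivative A t (z t) + B t) (at t within {0..1})"
      by (rule has_vector_derivative_transform[OF t zeq, rotated])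
  qed
qed

text \<open>The curve \<open>((0, t), c t)\<close> is compact, so a function continuous over the
  grid is bounded near it, uniformly in time and for small steps. Applied to coefficients or
  derivatives, this produces Lipschitz constants.\<close>

lemma time_grid_bounded_near:
  fixes f :: "real \<times> real \<Rightarrow> 'x::metric_space \<Rightarrow> 'b::real_normed_vector"
  assumes f: "continuous_on (time_grid \<times> U) (\<lambda>(p, x). f p x)"
    and c: "continuous_on {0..1} c" "\<And>t. t \<in> {0..1} \<Longrightarrow> c t \<in> U"
  shows "\<exists>M\<ge>0. \<exists>\<rho>>0. \<forall>N j x. 1 \<le> N \<longrightarrow> j \<le> N \<longrightarrow> x \<in> U \<longrightarrow> 1 / real N < \<rho> \<longrightarrow>
    dist x (c (real j / real N)) < \<rho> \<longrightarrow> norm (f (grid_node N j) x) \<le> M"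
proof -
  define C where "C = (\<lambda>t. ((0::real, t), c t)) ` {0..1}"
  have "compact C"
    unfolding C_def by (intro compact_continuous_image continuous_intros c(1)) auto
  have CU: "C \<subseteq> time_grid \<times> U" using c(2) by (auto simp: C_def intro: time_grid_0)
  obtain d where d: "d > 0" "\<And>a s. a \<in> C \<Longrightarrow> s \<in> time_grid \<times> U \<Longrightarrow> dist s a < d \<Longrightarrow>
      dist (case s of (p, x) \<Rightarrow> f p x) (case a of (p, x) \<Rightarrow> f p x) < 1"
    using continuous_on_compact_neighbourhood[OF f \<open>compact C\<close> CU zero_less_one] by metis
  obtain M where "\<forall>y\<in>(\<lambda>(p, x). f p x) ` C. norm y \<le> M"
    using compact_imp_bounded[OF compact_continuous_image[OF continuous_on_subset[OF f CU] \<open>compact C\<close>]]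
    unfolding bounded_iff by blast
  then have M: "norm (case a of (p, x) \<Rightarrow> f p x) \<le> M" if "a \<in> C" for a
    using that by blast
  show ?thesis
  proof (rule exI[of _ "\<bar>M\<bar> + 1"], rule conjI, simp, rule exI[of _ "d / 2"], intro conjI allI impI)
    fix N j :: nat and x
    assume N: "1 \<le> N" "j \<le> N" "x \<in> U" "1 / real N < d / 2" "dist x (c (real j / real N)) < d / 2"
    let ?p = "grid_node N j" and ?a = "((0, real j / real N), c (real j / real N))"
    have a: "?a \<in> C" using N(1,2) by (auto simp: C_def)
    have "dist (?p, x) ?a \<le> dist ?p (0, real j / real N) + dist x (c (real j / real N))"
      by (rule dist_Pair_le)
    also have "dist ?p (0, real j / real N) \<le> 1 / real N"
      using dist_Pair_le[of "1 / real N" "real j / real N" 0 "real j / real N"] by simp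
    finally have "dist (?p, x) ?a < d" using N by simp
    then have "dist (f ?p x) (f (0, real j / real N) (c (real j / real N))) < 1"
      using d(2)[OF a, of "(?p, x)"] N time_grid_node by auto
    moreover have "norm (f (0, real j / real N) (c (real j / real N))) \<le> M" using M[OF a] by simp
    ultimately show "norm (f ?p x) \<le> \<bar>M\<bar> + 1"
      using norm_triangle_sub[of "f ?p x" "f (0, real j / real N) (c (real j / real N))"]
      by (simp add: dist_norm)
  qed (use d in auto)
qed

text \<open>At a node the derivative of an iterate follows from its recursion; for the exact flow
  there is no such formula. It is therefore enough to name families \<open>wd b\<close> that agree
  with the partial derivatives at the nodes, and \<open>time_grid_has_derivative_limit\<close> takes
  care of step size zero.\<close>

lemma time_grid_Ck_family_SucI:
  fixes w :: "real \<times> real \<Rightarrow> 'a::euclidean_space \<Rightarrow> 'b::banach"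
  assumes "open U"
    and w: "continuous_on (time_grid \<times> U) (\<lambda>(p, x). w p x)"
    and wd: "\<And>b. b \<in> Basis \<Longrightarrow> Ck_family k time_grid U (wd b)"
    and node: "\<And>N j x. 1 \<le> N \<Longrightarrow> j \<le> N \<Longrightarrow> x \<in> U \<Longrightarrow>
      \<exists>D. (w (grid_node N j) has_derivative D) (at x) \<and>
        (\<forall>b\<in>Basis. D b = wd b (grid_node N j) x)"
  shows "Ck_family (Suc k) time_grid U w"
proof -
  define w' where "w' p x v = (\<Sum>b\<in>Basis. (v \<bullet> b) *\<^sub>R wd b p x)" for p x v
  have basis: "w' p x b = wd b p x" if "b \<in> Basis" for b p x
  proof -
    have "w' p x b = (\<Sum>c\<in>Basis. if c = b then wd b p x else 0)"
      unfolding w'_def by (intro sum.cong) (auto simp: inner_Basis that)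
    then show ?thesis using that by simp
  qed
  have der: "(w (grid_node N j) has_derivative w' (grid_node N j) x) (at x)"
    if N: "1 \<le> N" "j \<le> N" "x \<in> U" for N j x
  proof -
    obtain D where D: "(w (grid_node N j) has_derivative D) (at x)"
      "\<And>b. b \<in> Basis \<Longrightarrow> D b = wd b (grid_node N j) x"
      using node[OF N] by blast
    have "D = w' (grid_node N j) x"
      using has_derivative_expand_Basis[OF D(1)] D(2) by (auto simp: w'_def)
    with D show ?thesis by simp
  qed
  have w'_Ck: "Ck_family k time_grid U (\<lambda>p x. w' p x b)" if "b \<in> Basis" for b
    using wd[OF that] by (simp add: basis[OF that])
  show ?thesis
  proof (rule Ck_family_SucI[OF w _ w'_Ck])
    fix p x assume "p \<in> time_grid" and x: "x \<in> U"
    from this(1) show "(w p has_derivative w' p x) (at x)"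
    proof (cases rule: time_grid_cases)
      case (1 t)
      show ?thesis unfolding 1(2)
        by (rule time_grid_has_derivative_limit[OF \<open>open U\<close> w _ _ der 1(1) x])
          (use Ck_family_continuous[OF w'_Ck] basis in \<open>auto simp: w'_def\<close>)
    next
      case (2 N j)
      then show ?thesis using der[OF 2(1,2) x] by simp
    qed
  qed
qed

lemma linear_flow_exists:
  fixes A :: "real \<times> real \<Rightarrow> 'x::euclidean_space \<Rightarrow> 'y::euclidean_space \<Rightarrow> 'y"
  assumes lin: "\<And>p x. p \<in> time_grid \<Longrightarrow> x \<in> U \<Longrightarrow> linear (A p x)"
    and A: "\<And>b. b \<in> Basis \<Longrightarrow> Ck_family k time_grid U (\<lambda>p x. A p x b)"
    and B: "Ck_family k time_grid U B"
  obtains w where "euler_flow U (\<lambda>p x y. A p x y + B p x) w0 w"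
proof -
  have "\<exists>z. z 0 = w0 x \<and> (\<forall>t\<in>{0..1}. (z has_vector_derivative A (0, t) x (z t) + B (0, t) x) (at t within {0..1}))"
    if x: "x \<in> U" for x
  proof (rule linear_ode_exists[of "\<lambda>t. A (0, t) x" "\<lambda>t. B (0, t) x" "w0 x"])
    show "continuous_on {0..1} (\<lambda>t. A (0, t) x b)" if "b \<in> Basis" for b
      by (rule Ck_family_continuous_compose[OF A[OF that]])
        (use x in \<open>auto intro!: continuous_intros time_grid_0\<close>)
    show "continuous_on {0..1} (\<lambda>t. B (0, t) x)"
      by (rule Ck_family_continuous_compose[OF B])
        (use x in \<open>auto intro!: continuous_intros time_grid_0\<close>)
  qed (use x in \<open>auto intro!: lin time_grid_0\<close>)
  then obtain z where z: "\<And>x. x \<in> U \<Longrightarrow> z x 0 = w0 x"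
    "\<And>x t. x \<in> U \<Longrightarrow> t \<in> {0..1} \<Longrightarrow> (z x has_vector_derivative A (0, t) x (z x t) + B (0, t) x) (at t within {0..1})"
    by metis
  show thesis
    by (rule euler_flow_exists[of U z w0 "\<lambda>p x y. A p x y + B p x", OF z]) (assumption+, rule that)
qed

lemma linear_flow_continuous:
  fixes A :: "real \<times> real \<Rightarrow> 'x::euclidean_space \<Rightarrow> 'y::euclidean_space \<Rightarrow> 'y"
  assumes lin: "\<And>p x. p \<in> time_grid \<Longrightarrow> x \<in> U \<Longrightarrow> linear (A p x)"
    and A: "\<And>b. b \<in> Basis \<Longrightarrow> Ck_family k time_grid U (\<lambda>p x. A p x b)"
    and B: "Ck_family k time_grid U B"
    and w0: "continuous_on U w0"
    and w: "euler_flow U (\<lambda>p x y. A p x y + B p x) w0 w"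
  shows "continuous_on (time_grid \<times> U) (\<lambda>(p, x). w p x)"
proof (rule euler_flow_continuous[OF w, where Y = UNIV])
  have "continuous_on (time_grid \<times> U \<times> UNIV) (\<lambda>s. (\<Sum>b\<in>Basis. (snd (snd s) \<bullet> b) *\<^sub>R A (fst s) (fst (snd s)) b) +
      B (fst s) (fst (snd s)))"
    by (intro continuous_intros Ck_family_continuous_compose[OF A] Ck_family_continuous_compose[OF B]) auto
  then show "continuous_on (time_grid \<times> U \<times> UNIV) (\<lambda>(p, x, y). A p x y + B p x)"
    by (rule continuous_on_eq) (auto simp: split_beta linear_expand_Basis[OF lin, symmetric])
  fix x0 assume x0: "x0 \<in> U"
  have "\<forall>b\<in>Basis. \<exists>M\<ge>0. \<exists>\<rho>>0. \<forall>N j x. 1 \<le> N \<longrightarrow> j \<le> N \<longrightarrow> x \<in> U \<longrightarrow> 1 / real N < \<rho> \<longrightarrow>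
    dist x x0 < \<rho> \<longrightarrow> norm (A (grid_node N j) x b) \<le> M"
    using time_grid_bounded_near[OF Ck_family_continuous[OF A], where c = "\<lambda>_. x0"] x0 by simp
  then obtain M \<rho> where M: "\<And>b. b \<in> Basis \<Longrightarrow> M b \<ge> 0" "\<And>b. b \<in> Basis \<Longrightarrow> \<rho> b > 0"
    "\<And>b N j x. b \<in> Basis \<Longrightarrow> 1 \<le> N \<Longrightarrow> j \<le> N \<Longrightarrow> x \<in> U \<Longrightarrow> 1 / real N < \<rho> b \<Longrightarrow>
      dist x x0 < \<rho> b \<Longrightarrow> norm (A (grid_node N j) x b) \<le> M b"
    by metis
  show "lipschitz_along U (\<lambda>p x y. A p x y + B p x) x0 (\<lambda>t. w (0, t) x0)"
  proof (rule lipschitz_alongI[where L = "\<Sum>b\<in>Basis. M b" and \<rho> = "Min (\<rho> ` Basis)"])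
    show "0 \<le> sum M Basis" using M(1) by (rule sum_nonneg)
    show "0 < Min (\<rho> ` Basis)" using M(2) by (subst Min_gr_iff) auto
    fix N j :: nat and x y
    let ?p = "grid_node N j" and ?z = "w (0, real j / real N) x0"
    assume N: "1 \<le> N" "j \<le> N" "x \<in> U" "1 / real N < Min (\<rho> ` Basis)" "dist x x0 < Min (\<rho> ` Basis)"
    have l: "linear (A ?p x)" using lin[OF time_grid_node] N by auto
    have "A ?p x y + B ?p x - (A ?p x ?z + B ?p x) = (\<Sum>b\<in>Basis. ((y - ?z) \<bullet> b) *\<^sub>R A ?p x b)"
      unfolding linear_expand_Basis[OF l, symmetric] by (simp add: linear_diff[OF l])
    also have "norm \<dots> \<le> (\<Sum>b\<in>Basis. M b * norm (y - ?z))"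
    proof (rule sum_norm_le)
      fix b :: 'y assume b: "b \<in> Basis"
      have "norm (A ?p x b) \<le> M b" using M(3)[OF b N(1-3)] N b by auto
      then have "\<bar>(y - ?z) \<bullet> b\<bar> * norm (A ?p x b) \<le> norm (y - ?z) * M b"
        by (intro mult_mono Basis_le_norm b) auto
      then show "norm (((y - ?z) \<bullet> b) *\<^sub>R A ?p x b) \<le> M b * norm (y - ?z)" by (simp add: mult.commute)
    qed
    finally show "norm (A ?p x y + B ?p x - (A ?p x ?z + B ?p x)) \<le> sum M Basis * norm (y - ?z)"
      by (simp add: sum_distrib_right)
  qed
qed (use w0 in auto)

lemma time_grid_not_empty: "(0, 0) \<in> time_grid"
  by (rule time_grid_0) auto

text \<open>Linear equations are closed under differentiation in \<open>x\<close>: the derivative in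
  direction \<open>b\<close> obeys an equation with the same \<open>A\<close>, a new source
  \<open>B1 b\<close> and the differentiated initial value. The source contains \<open>w\<close>
  itself, but only to the order \<open>k\<close> that the induction already provides.\<close>

theorem linear_flow_Ck_family:
  fixes A :: "real \<times> real \<Rightarrow> 'x::euclidean_space \<Rightarrow> 'y::euclidean_space \<Rightarrow> 'y"
  assumes "open U" and lin: "\<And>p x. p \<in> time_grid \<Longrightarrow> x \<in> U \<Longrightarrow> linear (A p x)"
    and A: "\<And>b. b \<in> Basis \<Longrightarrow> Ck_family k time_grid U (\<lambda>p x. A p x b)"
    and B: "Ck_family k time_grid U B"
    and w0: "Ck_family k time_grid U (\<lambda>_. w0)"
    and w: "euler_flow U (\<lambda>p x y. A p x y + B p x) w0 w"
  shows "Ck_family k time_grid U w"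
  using A B w0 w
proof (induction k arbitrary: B w0 w)
  have w0_cont: "continuous_on U w0" if "Ck_family k time_grid U (\<lambda>_. w0)" for k w0
    using Ck_family_continuous_compose[OF that, of U "\<lambda>_. (0, 0)" "\<lambda>x. x"] time_grid_not_empty by auto
  {
    case 0
    then show ?case using linear_flow_continuous[OF lin 0(1,2) w0_cont[OF 0(3)] 0(4)] by simp
  next
    case (Suc k)
    note w_euler = Suc.prems(4)
    have wk: "Ck_family k time_grid U w"
      by (rule Suc.IH[OF Ck_family_Suc_imp[OF Suc.prems(1)] Suc.prems(2,3)[THEN Ck_family_Suc_imp] Suc.prems(4)])
    have "\<forall>c\<in>Basis. \<exists>A'. (\<forall>p\<in>time_grid. \<forall>x\<in>U. ((\<lambda>x. A p x c) has_derivative A' p x) (at x)) \<and>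
        (\<forall>b\<in>Basis. Ck_family k time_grid U (\<lambda>p x. A' p x b))"
      using Ck_family_SucD[OF Suc.prems(1)] by blast
    then obtain A' where A':
      "\<And>c p x. c \<in> Basis \<Longrightarrow> p \<in> time_grid \<Longrightarrow> x \<in> U \<Longrightarrow> ((\<lambda>x. A p x c) has_derivative A' c p x) (at x)"
      "\<And>c b. c \<in> Basis \<Longrightarrow> b \<in> Basis \<Longrightarrow> Ck_family k time_grid U (\<lambda>p x. A' c p x b)"
      by metis
    obtain B' where B':
      "\<And>p x. p \<in> time_grid \<Longrightarrow> x \<in> U \<Longrightarrow> (B p has_derivative B' p x) (at x)"
      "\<And>b. b \<in> Basis \<Longrightarrow> Ck_family k time_grid U (\<lambda>p x. B' p x b)"
      using Ck_family_SucD[OF Suc.prems(2)] by blast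
    obtain w0' where w0':
      "\<And>p x. p \<in> time_grid \<Longrightarrow> x \<in> U \<Longrightarrow> (w0 has_derivative w0' p x) (at x)"
      "\<And>b. b \<in> Basis \<Longrightarrow> Ck_family k time_grid U (\<lambda>p x. w0' p x b)"
      using Ck_family_SucD[OF Suc.prems(3)] by blast
    define B1 where "B1 b p x = (\<Sum>c\<in>Basis. (w p x \<bullet> c) *\<^sub>R A' c p x b) + B' p x b" for b p x
    have B1: "Ck_family k time_grid U (B1 b)" if b: "b \<in> Basis" for b
      unfolding B1_def
      by (intro Ck_family_add Ck_family_sum Ck_family_scaleR Ck_family_inner_left wk A' B' b) auto
    \<comment> \<open>The candidate derivatives come from solving the variational equation, exact
      solution included, before the exact flow is known to be differentiable.\<close>
    have "\<forall>b\<in>Basis. \<exists>u. euler_flow U (\<lambda>p x y. A p x y + B1 b p x) (\<lambda>x. w0' (0, 0) x b) u"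
      by (rule ballI, rule linear_flow_exists[OF lin Suc.prems(1)[THEN Ck_family_Suc_imp] B1]) (assumption+, rule exI)
    from bchoice[OF this] obtain wd where
      "\<forall>b\<in>Basis. euler_flow U (\<lambda>p x y. A p x y + B1 b p x) (\<lambda>x. w0' (0, 0) x b) (wd b)" ..
    then have wd: "\<And>b. b \<in> Basis \<Longrightarrow> euler_flow U (\<lambda>p x y. A p x y + B1 b p x) (\<lambda>x. w0' (0, 0) x b) (wd b)"
      by (rule bspec)
    have w0'_Ck: "Ck_family k time_grid U (\<lambda>_ x. w0' (0, 0) x b)" if "b \<in> Basis" for b
      using Ck_family_reindex[OF continuous_on_const _ w0'(2)[OF that], of "(0, 0)" time_grid] time_grid_not_empty
      by blast
    show ?case
    proof (rule time_grid_Ck_family_SucI[OF \<open>open U\<close> Ck_family_continuous[OF wk]])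
      show "Ck_family k time_grid U (wd b)" if b: "b \<in> Basis" for b
        by (rule Suc.IH[OF Ck_family_Suc_imp[OF Suc.prems(1)] B1[OF b] w0'_Ck[OF b] wd[OF b]])
      fix N j :: nat and x assume N: "1 \<le> N" and "j \<le> N" and x: "x \<in> U"
      from \<open>j \<le> N\<close> show "\<exists>D. (w (grid_node N j) has_derivative D) (at x) \<and>
        (\<forall>b\<in>Basis. D b = wd b (grid_node N j) x)"
      proof (induction j)
        case 0
        have "(w (1 / real N, 0) has_derivative w0' (0, 0) x) (at x)"
          by (rule has_derivative_transform_within_open[OF w0'(1)[OF time_grid_not_empty x] \<open>open U\<close> x])
            (use euler_flow_node(1)[OF w_euler _ N] in auto)
        then show ?case using euler_flow_node(1)[OF wd x N] by (intro exI[of _ "w0' (0, 0) x"]) auto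
      next
        case (Suc j)
        let ?p = "grid_node N j" and ?q = "grid_node N (Suc j)"
        have jN: "j < N" and p: "?p \<in> time_grid" using Suc.prems N by (auto intro!: time_grid_node)
        from Suc obtain D where D: "(w ?p has_derivative D) (at x)" "\<And>b. b \<in> Basis \<Longrightarrow> D b = wd b ?p x"
          by auto
        \<comment> \<open>\<open>A\<close> is known to be differentiable in \<open>x\<close> on
          fixed basis vectors, so the step is differentiated in the expanded form of
          \<open>A\<close>.\<close>
        let ?D = "\<lambda>v. D v + (1 / real N) *\<^sub>R
          ((\<Sum>c\<in>Basis. (w ?p x \<bullet> c) *\<^sub>R A' c ?p x v + (D v \<bullet> c) *\<^sub>R A ?p x c) + B' ?p x v)"
        have "((\<lambda>x. w ?p x + (1 / real N) *\<^sub>R ((\<Sum>c\<in>Basis. (w ?p x \<bullet> c) *\<^sub>R A ?p x c) + B ?p x)) has_derivative ?D) (at x)"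
          by (intro has_derivative_add D has_derivative_scaleR_right has_derivative_sum has_derivative_scaleR
              has_derivative_inner_left A' B' p x)
        then have "(w ?q has_derivative ?D) (at x)"
        proof (rule has_derivative_transform_within_open[OF _ \<open>open U\<close> x])
          fix y assume y: "y \<in> U"
          show "w ?p y + (1 / real N) *\<^sub>R ((\<Sum>c\<in>Basis. (w ?p y \<bullet> c) *\<^sub>R A ?p y c) + B ?p y) = w ?q y"
            unfolding euler_flow_node(2)[OF w_euler y N jN] linear_expand_Basis[OF lin[OF p y], symmetric] ..
        qed
        moreover have "?D b = wd b ?q x" if b: "b \<in> Basis" for b
          unfolding euler_flow_node(2)[OF wd[OF b] x N jN] linear_expand_Basis[OF lin[OF p x], of "wd b ?p x"]
          by (simp add: D(2)[OF b] B1_def sum.distrib add_ac)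
        ultimately show ?case by blast
      qed
    qed
  }
qed

section \<open>Nonlinear fields\<close>

lemma lipschitz_along_C1:
  fixes W :: "real \<times> real \<Rightarrow> 'a::euclidean_space \<Rightarrow> 'a"
  assumes "open U" and W: "Ck_family (Suc k) time_grid U W"
    and z: "continuous_on {0..1} z" "\<And>t. t \<in> {0..1} \<Longrightarrow> z t \<in> U"
  shows "lipschitz_along U (\<lambda>p x. W p) x0 z"
proof -
  obtain W' where W': "\<And>p x. p \<in> time_grid \<Longrightarrow> x \<in> U \<Longrightarrow> (W p has_derivative W' p x) (at x)"
    "\<And>b. b \<in> Basis \<Longrightarrow> Ck_family k time_grid U (\<lambda>p x. W' p x b)"
    using Ck_family_SucD[OF W] by blast
  have "\<forall>b\<in>Basis. \<exists>M\<ge>0. \<exists>\<rho>>0. \<forall>N j x. 1 \<le> N \<longrightarrow> j \<le> N \<longrightarrow> x \<in> U \<longrightarrow> 1 / real N < \<rho> \<longrightarrow>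
      dist x (z (real j / real N)) < \<rho> \<longrightarrow> norm (W' (grid_node N j) x b) \<le> M"
    by (intro ballI time_grid_bounded_near[OF Ck_family_continuous[OF W'(2)] z])
  then obtain M \<rho> where M: "\<And>b. b \<in> Basis \<Longrightarrow> M b \<ge> 0" "\<And>b. b \<in> Basis \<Longrightarrow> \<rho> b > 0"
    "\<And>b N j x. b \<in> Basis \<Longrightarrow> 1 \<le> N \<Longrightarrow> j \<le> N \<Longrightarrow> x \<in> U \<Longrightarrow> 1 / real N < \<rho> b \<Longrightarrow>
      dist x (z (real j / real N)) < \<rho> b \<Longrightarrow> norm (W' (grid_node N j) x b) \<le> M b"
    by metis
  \<comment> \<open>A tube of uniform radius around the compact trajectory stays in
    \<open>U\<close>; its balls are convex, as the mean value inequality requires.\<close>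
  have "compact (z ` {0..1})" by (intro compact_continuous_image z) auto
  then obtain r where r: "r > 0" "(\<Union>y\<in>z ` {0..1}. cball y r) \<subseteq> U"
    using compact_subset_open_imp_cball_epsilon_subset[OF _ \<open>open U\<close>, of "z ` {0..1}"] z(2) by blast
  \<comment> \<open>Halving makes \<open>\<rho>' < \<rho> b\<close> strict:
    \<open>lipschitz_along\<close> admits points at distance exactly \<open>\<rho>'\<close>, while
    the derivative bounds hold for distances strictly below \<open>\<rho> b\<close>.\<close>
  define \<rho>' where "\<rho>' = min r (Min (\<rho> ` Basis)) / 2"
  have pos: "Min (\<rho> ` Basis) > 0" using M(2) by (subst Min_gr_iff) auto
  have \<rho>': "\<rho>' > 0" "\<rho>' \<le> r" "\<And>b. b \<in> Basis \<Longrightarrow> \<rho>' < \<rho> b"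
  proof -
    show "\<rho>' > 0" "\<rho>' \<le> r" using r pos by (auto simp: \<rho>'_def)
    fix b :: 'a assume "b \<in> Basis"
    then have "Min (\<rho> ` Basis) \<le> \<rho> b" by auto
    moreover have "\<rho>' \<le> Min (\<rho> ` Basis) / 2" by (simp add: \<rho>'_def)
    ultimately show "\<rho>' < \<rho> b" using pos by linarith
  qed
  show ?thesis
  proof (rule lipschitz_alongI[where L = "\<Sum>b\<in>Basis. M b" and \<rho> = \<rho>'])
    show "0 \<le> sum M Basis" using M(1) by (rule sum_nonneg)
    show "0 < \<rho>'" by (rule \<rho>')
    fix N j :: nat and y
    let ?p = "grid_node N j" and ?c = "z (real j / real N)"
    assume N: "1 \<le> N" "j \<le> N" "1 / real N < \<rho>'" and y: "dist y ?c \<le> \<rho>'"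
    have p: "?p \<in> time_grid" using N by (intro time_grid_node)
    have sub: "cball ?c \<rho>' \<subseteq> U"
    proof -
      have "real j / real N \<in> {0..1}" using N by auto
      then have "cball ?c r \<subseteq> U" using r(2) by blast
      moreover have "cball ?c \<rho>' \<subseteq> cball ?c r" using \<rho>'(2) by auto
      ultimately show ?thesis by blast
    qed
    show "norm (W ?p y - W ?p ?c) \<le> sum M Basis * norm (y - ?c)"
    proof (rule differentiable_bound[where S = "cball ?c \<rho>'"])
      show "(W ?p has_derivative W' ?p u) (at u within cball ?c \<rho>')" if "u \<in> cball ?c \<rho>'" for u
        by (rule has_derivative_at_withinI[OF W'(1)[OF p subsetD[OF sub that]]])
      show "onorm (W' ?p u) \<le> sum M Basis" if u: "u \<in> cball ?c \<rho>'" for u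
      proof (rule onorm_le)
        fix v
        have "norm (W' ?p u v) \<le> (\<Sum>b\<in>Basis. M b * norm v)"
          unfolding has_derivative_expand_Basis[OF W'(1)[OF p subsetD[OF sub u]], of v]
        proof (rule sum_norm_le)
          fix b :: 'a assume b: "b \<in> Basis"
          have "norm (W' ?p u b) \<le> M b"
            using M(3)[OF b N(1,2), of u] \<rho>'(3)[OF b] N(3) u sub by (auto simp: dist_commute)
          then have "\<bar>v \<bullet> b\<bar> * norm (W' ?p u b) \<le> norm v * M b"
            by (intro mult_mono Basis_le_norm b) auto
          then show "norm ((v \<bullet> b) *\<^sub>R W' ?p u b) \<le> M b * norm v" by (simp add: mult.commute)
        qed
        then show "norm (W' ?p u v) \<le> sum M Basis * norm v" by (simp add: sum_distrib_right)
      qed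
    qed (use y \<rho>' in \<open>auto simp: dist_commute\<close>)
  qed
qed

text \<open>The derivatives of the iterates obey a linear recursion with coefficient
  \<open>W' p (w p x)\<close>. Knowing \<open>w\<close> to order \<open>j\<close> makes this
  coefficient, and hence the derivative of \<open>w\<close>, of order \<open>j\<close>; so the order
  rises by one at a time until the regularity of \<open>W\<close> is used up. Order zero is the
  convergence of the scheme.\<close>

theorem euler_flow_Ck_family:
  fixes W :: "real \<times> real \<Rightarrow> 'a::euclidean_space \<Rightarrow> 'a"
  assumes "open U" and W: "Ck_family (Suc k) time_grid U W"
    and w: "euler_flow U (\<lambda>p x. W p) (\<lambda>x. x) w"
    and wU: "\<And>p x. p \<in> time_grid \<Longrightarrow> x \<in> U \<Longrightarrow> w p x \<in> U"
  shows "Ck_family (Suc k) time_grid U w"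
proof -
  have "Ck_family j time_grid U w" if "j \<le> Suc k" for j
    using that
  proof (induction j)
    case 0
    have "continuous_on (time_grid \<times> U) (\<lambda>(p, x). w p x)"
    proof (rule euler_flow_continuous[OF w, where Y = U])
      show "continuous_on (time_grid \<times> U \<times> U) (\<lambda>(p, x, y). W p y)"
        unfolding split_beta by (rule Ck_family_continuous_compose[OF W]) (auto intro!: continuous_intros)
      fix x0 assume x0: "x0 \<in> U"
      let ?z = "\<lambda>t. w (0, t) x0"
      have z: "continuous_on {0..1} ?z" "\<And>t. t \<in> {0..1} \<Longrightarrow> ?z t \<in> U"
        using euler_flow_solution_continuous[OF w x0] wU[OF time_grid_0 x0] by auto
      show "lipschitz_along U (\<lambda>p x. W p) x0 ?z"
        by (rule lipschitz_along_C1[OF \<open>open U\<close> W z])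
    qed (use wU in \<open>auto intro!: continuous_intros\<close>)
    then show ?case by simp
  next
    case (Suc j)
    then have wj: "Ck_family j time_grid U w" by simp
    obtain W' where W': "\<And>p x. p \<in> time_grid \<Longrightarrow> x \<in> U \<Longrightarrow> (W p has_derivative W' p x) (at x)"
      "\<And>b. b \<in> Basis \<Longrightarrow> Ck_family j time_grid U (\<lambda>p x. W' p x b)"
      using Ck_family_SucD[OF Ck_family_le[OF W Suc.prems]] by blast
    define A where "A p x = W' p (w p x)" for p x
    have lin: "linear (A p x)" if "p \<in> time_grid" "x \<in> U" for p x
      unfolding A_def using W'(1)[OF that(1) wU[OF that]] by (rule has_derivative_linear)
    have A: "Ck_family j time_grid U (\<lambda>p x. A p x b)" if "b \<in> Basis" for b
      unfolding A_def by (rule Ck_family_compose[OF W'(2)[OF that] wj wU \<open>open U\<close>])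
    have "\<exists>u. euler_flow U (\<lambda>p x y. A p x y + 0) (\<lambda>x. b) u" for b
      by (rule linear_flow_exists[OF lin A Ck_family_const[of j time_grid U 0]]) (assumption+, rule exI)
    from choice[OF allI[OF this]] obtain wd where "\<forall>b. euler_flow U (\<lambda>p x y. A p x y + 0) (\<lambda>x. b) (wd b)" ..
    then have wd: "\<And>b. euler_flow U (\<lambda>p x y. A p x y + 0) (\<lambda>x. b) (wd b)"
      by (rule spec)
    show ?case
    proof (rule time_grid_Ck_family_SucI[OF \<open>open U\<close> Ck_family_continuous[OF wj]])
      show "Ck_family j time_grid U (wd b)" if b: "b \<in> Basis" for b
        by (rule linear_flow_Ck_family[OF \<open>open U\<close> lin A Ck_family_const Ck_family_const wd])
      fix N j :: nat and x assume N: "1 \<le> N" and "j \<le> N" and x: "x \<in> U"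
      from \<open>j \<le> N\<close> show "\<exists>D. (w (grid_node N j) has_derivative D) (at x) \<and>
        (\<forall>b\<in>Basis. D b = wd b (grid_node N j) x)"
      proof (induction j)
        case 0
        have "(w (1 / real N, 0) has_derivative (\<lambda>v. v)) (at x)"
          by (rule has_derivative_transform_within_open[OF has_derivative_ident \<open>open U\<close> x])
            (use euler_flow_node(1)[OF w _ N] in auto)
        then show ?case using euler_flow_node(1)[OF wd x N] by (intro exI[of _ "\<lambda>v. v"]) auto
      next
        case (Suc j)
        let ?p = "grid_node N j" and ?q = "grid_node N (Suc j)"
        have jN: "j < N" and p: "?p \<in> time_grid" using Suc.prems N by (auto intro!: time_grid_node)
        from Suc obtain D where D: "(w ?p has_derivative D) (at x)" "\<And>b. b \<in> Basis \<Longrightarrow> D b = wd b ?p x"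
          by auto
        let ?D = "\<lambda>v. D v + (1 / real N) *\<^sub>R W' ?p (w ?p x) (D v)"
        have "((\<lambda>x. w ?p x + (1 / real N) *\<^sub>R W ?p (w ?p x)) has_derivative ?D) (at x)"
          by (intro has_derivative_add D has_derivative_scaleR_right has_derivative_compose[OF D(1)] W' p wU x)
        then have "(w ?q has_derivative ?D) (at x)"
          by (rule has_derivative_transform_within_open[OF _ \<open>open U\<close> x])
            (simp only: euler_flow_node(2)[OF w _ N jN])
        moreover have "?D b = wd b ?q x" if b: "b \<in> Basis" for b
          unfolding euler_flow_node(2)[OF wd x N jN] by (simp add: D(2)[OF b] A_def)
        ultimately show ?case by blast
      qed
    qed
  qed
  then show ?thesis by blast
qed

section \<open>Smallness of derivatives\<close>

text \<open>Only derivatives in basis directions occur, all with the same bound, so that sums,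
  linear maps and components are handled by plain induction. Passing to operator norms costs a power
  of the dimension, paid once at the end.\<close>

primrec Ck_small ::
  "nat \<Rightarrow> 'a::euclidean_space set \<Rightarrow> real \<Rightarrow> ('a \<Rightarrow> 'b::real_normed_vector) \<Rightarrow> bool"
where
  "Ck_small 0 S e h \<longleftrightarrow> (\<forall>x\<in>S. norm (h x) \<le> e)"
| "Ck_small (Suc k) S e h \<longleftrightarrow> (\<forall>x\<in>S. norm (h x) \<le> e) \<and>
     (\<exists>h'. (\<forall>x\<in>S. (h has_derivative h' x) (at x)) \<and> (\<forall>b\<in>Basis. Ck_small k S e (\<lambda>x. h' x b)))"

lemma Ck_small_bound: "Ck_small k S e h \<Longrightarrow> x \<in> S \<Longrightarrow> norm (h x) \<le> e"
  by (cases k) auto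

lemma Ck_small_SucI:
  assumes "\<And>x. x \<in> S \<Longrightarrow> norm (h x) \<le> e"
    and "\<And>x. x \<in> S \<Longrightarrow> (h has_derivative h' x) (at x)"
    and "\<And>b. b \<in> Basis \<Longrightarrow> Ck_small k S e (\<lambda>x. h' x b)"
  shows "Ck_small (Suc k) S e h"
  using assms by auto

lemma Ck_small_SucD:
  assumes "Ck_small (Suc k) S e h"
  shows "\<exists>h'. (\<forall>x\<in>S. (h has_derivative h' x) (at x)) \<and> (\<forall>b\<in>Basis. Ck_small k S e (\<lambda>x. h' x b))"
  using assms by auto

lemma Ck_small_mono: "Ck_small k S e h \<Longrightarrow> S' \<subseteq> S \<Longrightarrow> e \<le> e' \<Longrightarrow> Ck_small k S' e' h"
proof (induction k arbitrary: h)
  case 0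
  then show ?case by force
next
  case (Suc k)
  obtain h' where h': "\<And>x. x \<in> S \<Longrightarrow> (h has_derivative h' x) (at x)"
    "\<And>b. b \<in> Basis \<Longrightarrow> Ck_small k S e (\<lambda>x. h' x b)"
    using Ck_small_SucD[OF Suc.prems(1)] by blast
  show ?case
    by (rule Ck_small_SucI[where h' = h'])
      (use Suc.prems(2,3) in \<open>auto intro!: h' Suc.IH order_trans[OF Ck_small_bound[OF Suc.prems(1)]]\<close>)
qed

lemma Ck_small_cong:
  assumes "open S" "\<And>x. x \<in> S \<Longrightarrow> h x = g x" "Ck_small k S e h"
  shows "Ck_small k S e g"
proof (cases k)
  case 0
  then show ?thesis using assms by simp
next
  case (Suc j)
  obtain h' where h': "\<And>x. x \<in> S \<Longrightarrow> (h has_derivative h' x) (at x)"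
    "\<And>b. b \<in> Basis \<Longrightarrow> Ck_small j S e (\<lambda>x. h' x b)"
    using Ck_small_SucD[OF assms(3)[unfolded Suc]] by blast
  show ?thesis unfolding Suc
  proof (rule Ck_small_SucI[where h' = h'])
    show "norm (g x) \<le> e" if "x \<in> S" for x
      using Ck_small_bound[OF assms(3) that] assms(2)[OF that] by simp
    show "(g has_derivative h' x) (at x)" if "x \<in> S" for x
      by (rule has_derivative_transform_within_open[OF h'(1)[OF that] \<open>open S\<close> that assms(2)])
  qed (rule h')
qed

lemma Ck_small_add:
  "Ck_small k S e h \<Longrightarrow> Ck_small k S e' g \<Longrightarrow> Ck_small k S (e + e') (\<lambda>x. h x + g x)"
proof (induction k arbitrary: h g)
  case 0
  then show ?case by (auto intro!: norm_triangle_le add_mono)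
next
  case (Suc k)
  obtain h' where h': "\<And>x. x \<in> S \<Longrightarrow> (h has_derivative h' x) (at x)"
    "\<And>b. b \<in> Basis \<Longrightarrow> Ck_small k S e (\<lambda>x. h' x b)"
    using Ck_small_SucD[OF Suc.prems(1)] by blast
  obtain g' where g': "\<And>x. x \<in> S \<Longrightarrow> (g has_derivative g' x) (at x)"
    "\<And>b. b \<in> Basis \<Longrightarrow> Ck_small k S e' (\<lambda>x. g' x b)"
    using Ck_small_SucD[OF Suc.prems(2)] by blast
  show ?case
    by (rule Ck_small_SucI[where h' = "\<lambda>x v. h' x v + g' x v"])
      (auto intro!: has_derivative_add h' g' Suc.IH norm_triangle_le add_mono Ck_small_bound[OF Suc.prems(1)]
        Ck_small_bound[OF Suc.prems(2)])
qed

lemma Ck_small_linear: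
  assumes "bounded_linear f" "\<And>y. norm (f y) \<le> c * norm y" "0 \<le> c"
  shows "Ck_small k S e h \<Longrightarrow> Ck_small k S (c * e) (\<lambda>x. f (h x))"
proof (induction k arbitrary: h)
  case 0
  then show ?case using order_trans[OF assms(2) mult_left_mono[OF _ assms(3)]] by auto
next
  case (Suc k)
  obtain h' where h': "\<And>x. x \<in> S \<Longrightarrow> (h has_derivative h' x) (at x)"
    "\<And>b. b \<in> Basis \<Longrightarrow> Ck_small k S e (\<lambda>x. h' x b)"
    using Ck_small_SucD[OF Suc.prems(1)] by blast
  show ?case
    by (rule Ck_small_SucI[where h' = "\<lambda>x v. f (h' x v)"])
      (auto intro!: bounded_linear.has_derivative[OF assms(1)] h' Suc.IH
        order_trans[OF assms(2) mult_left_mono[OF _ assms(3)]] Ck_small_bound[OF Suc.prems(1)])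
qed

lemma Ck_small_zero: "0 \<le> e \<Longrightarrow> Ck_small k S e (\<lambda>x. 0)"
  by (induction k) (auto intro!: Ck_small_SucI[where h' = "\<lambda>_ _. 0"] simp del: Ck_small.simps(2))

lemma Ck_small_scaleR:
  fixes h :: "'a::euclidean_space \<Rightarrow> 'b::real_normed_vector"
  shows "Ck_small k S e h \<Longrightarrow> Ck_small k S (\<bar>c\<bar> * e) (\<lambda>x. c *\<^sub>R h x)"
  by (rule Ck_small_linear) (auto intro!: bounded_linear_intros)

lemma Ck_small_minus: "Ck_small k S e h \<Longrightarrow> Ck_small k S e (\<lambda>x. - h x)"
  using Ck_small_scaleR[of k S e h "-1"] by simp

lemma Ck_small_sum:
  assumes "finite A" "\<And>i. i \<in> A \<Longrightarrow> Ck_small k S (e i) (h i)"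
  shows "Ck_small k S (\<Sum>i\<in>A. e i) (\<lambda>x. \<Sum>i\<in>A. h i x)"
  using assms by (induction A rule: finite_induct) (auto intro!: Ck_small_zero Ck_small_add)

text \<open>Turns convergence encoded as joint continuity back into an estimate: compactness of
  \<open>C\<close> makes continuity in the parameter at \<open>p0\<close> uniform over
  \<open>S\<close>, for each of the finitely many derivatives.\<close>

lemma Ck_family_imp_Ck_small:
  assumes "Ck_family k P U f" "p0 \<in> P" "compact C" "C \<subseteq> U" "S \<subseteq> C" "0 < e"
  shows "\<exists>d>0. \<forall>p\<in>P. dist p p0 < d \<longrightarrow> Ck_small k S e (\<lambda>x. f p x - f p0 x)"
  using assms(1)
proof (induction k arbitrary: f)
  have C: "compact ({p0} \<times> C)" "{p0} \<times> C \<subseteq> P \<times> U" using assms by (auto intro!: compact_Times)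
  have bound: "\<exists>d>0. \<forall>p\<in>P. dist p p0 < d \<longrightarrow> (\<forall>x\<in>S. norm (f p x - f p0 x) \<le> e)"
    if F: "Ck_family k P U f" for k and f :: "'a \<Rightarrow> 'b \<Rightarrow> 'c"
  proof -
    obtain d where d: "d > 0" "\<And>c s. c \<in> {p0} \<times> C \<Longrightarrow> s \<in> P \<times> U \<Longrightarrow> dist s c < d \<Longrightarrow>
        dist (case s of (p, x) \<Rightarrow> f p x) (case c of (p, x) \<Rightarrow> f p x) < e"
      using continuous_on_compact_neighbourhood[OF Ck_family_continuous[OF F] C \<open>0 < e\<close>] by metis
    have "norm (f p x - f p0 x) \<le> e" if "p \<in> P" "dist p p0 < d" "x \<in> S" for p x
    proof -
      have "dist (p, x) (p0, x) < d" using that by (simp add: dist_Pair_Pair)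
      moreover have "(p0, x) \<in> {p0} \<times> C" "(p, x) \<in> P \<times> U" using that assms by auto
      ultimately show ?thesis using d(2)[of "(p0, x)" "(p, x)"] by (simp add: dist_norm)
    qed
    with d(1) show ?thesis by blast
  qed
  {
    case 0
    then show ?case using bound[OF 0] by simp
  next
    case (Suc k)
    obtain f' where f': "\<And>p x. p \<in> P \<Longrightarrow> x \<in> U \<Longrightarrow> (f p has_derivative f' p x) (at x)"
      "\<And>b. b \<in> Basis \<Longrightarrow> Ck_family k P U (\<lambda>p x. f' p x b)"
      using Ck_family_SucD[OF Suc.prems] by blast
    obtain d0 where d0: "d0 > 0" "\<And>p x. p \<in> P \<Longrightarrow> dist p p0 < d0 \<Longrightarrow> x \<in> S \<Longrightarrow> norm (f p x - f p0 x) \<le> e"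
      using bound[OF Suc.prems] by metis
    have "\<forall>b\<in>Basis. \<exists>d>0. \<forall>p\<in>P. dist p p0 < d \<longrightarrow> Ck_small k S e (\<lambda>x. f' p x b - f' p0 x b)"
      using Suc.IH[OF f'(2)] by blast
    from bchoice[OF this] obtain d where d:
      "\<forall>b\<in>Basis. d b > 0 \<and> (\<forall>p\<in>P. dist p p0 < d b \<longrightarrow> Ck_small k S e (\<lambda>x. f' p x b - f' p0 x b))" ..
    let ?d = "min d0 (Min (d ` Basis))"
    have "?d > 0" using d0 d by auto
    moreover have "Ck_small (Suc k) S e (\<lambda>x. f p x - f p0 x)" if p: "p \<in> P" "dist p p0 < ?d" for p
    proof (rule Ck_small_SucI[where h' = "\<lambda>x v. f' p x v - f' p0 x v"])
      show "norm (f p x - f p0 x) \<le> e" if "x \<in> S" for x using d0(2) p that by auto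
      show "((\<lambda>x. f p x - f p0 x) has_derivative (\<lambda>v. f' p x v - f' p0 x v)) (at x)" if "x \<in> S" for x
        using that assms p by (intro has_derivative_diff f') auto
      fix b :: 'b assume "b \<in> Basis"
      then show "Ck_small k S e (\<lambda>x. f' p x b - f' p0 x b)" using d p by auto
    qed
    ultimately show ?case by blast
  }
qed

section \<open>Riemann sums\<close>

lemma riemann_sum_bound:
  fixes F :: "real \<Rightarrow> 'b::euclidean_space"
  assumes F: "continuous_on {0..1} F" and "1 \<le> n"
    and osc: "\<And>s s'. s \<in> {0..1} \<Longrightarrow> s' \<in> {0..1} \<Longrightarrow> \<bar>s - s'\<bar> \<le> 1 / real n \<Longrightarrow> norm (F s - F s') \<le> e"
  shows "norm (integral {0..1} F - (1 / real n) *\<^sub>R (\<Sum>i<n. F (real i / real n))) \<le> e"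
proof -
  have int: "F integrable_on {a..b}" if "0 \<le> a" "b \<le> 1" for a b
    by (intro integrable_continuous_interval continuous_on_subset[OF F]) (use that in auto)
  have "norm (integral {0..real m / real n} F - (1 / real n) *\<^sub>R (\<Sum>i<m. F (real i / real n))) \<le> e * (real m / real n)"
    if "m \<le> n" for m
    using that
  proof (induction m)
    case (Suc m)
    let ?a = "real m / real n" and ?b = "real (Suc m) / real n"
    have ab: "0 \<le> ?a" "?a \<le> ?b" "?b \<le> 1"
      using Suc.prems \<open>1 \<le> n\<close> by (auto simp: divide_right_mono)
    have ab4: "?b = ?a + 1 / real n" by (simp add: add_divide_distrib)
    have "norm (integral {?a..?b} F - integral {?a..?b} (\<lambda>s. F ?a)) \<le> integral {?a..?b} (\<lambda>s. e)"
      unfolding integral_diff[OF int[OF ab(1,3)] integrable_const_ivl, symmetric]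
    proof (rule integral_norm_bound_integral)
      show "(\<lambda>s. F s - F ?a) integrable_on {?a..?b}"
        by (intro integrable_diff int ab integrable_const_ivl)
      fix s assume s: "s \<in> {?a..?b}"
      then have "s \<in> {0..1}" using ab unfolding atLeastAtMost_iff by linarith
      moreover have "?a \<in> {0..1}" using ab unfolding atLeastAtMost_iff by linarith
      moreover have "\<bar>s - ?a\<bar> \<le> 1 / real n" using s ab4 unfolding atLeastAtMost_iff by linarith
      ultimately show "norm (F s - F ?a) \<le> e" by (rule osc)
    qed (auto intro: integrable_const_ivl)
    then have step: "norm (integral {?a..?b} F - (1 / real n) *\<^sub>R F ?a) \<le> e * (1 / real n)"
      using ab ab4 by (simp add: mult.commute)
    have "integral {0..?b} F = integral {0..?a} F + integral {?a..?b} F"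
      by (rule Henstock_Kurzweil_Integration.integral_combine[symmetric]) (use ab int in auto)
    then have "integral {0..?b} F - (1 / real n) *\<^sub>R (\<Sum>i<Suc m. F (real i / real n)) =
      (integral {0..?a} F - (1 / real n) *\<^sub>R (\<Sum>i<m. F (real i / real n))) + (integral {?a..?b} F - (1 / real n) *\<^sub>R F ?a)"
      by (simp add: scaleR_add_right)
    also have "norm \<dots> \<le> e * ?a + e * (1 / real n)"
      using Suc step by (intro norm_triangle_le add_mono) auto
    also have "\<dots> = e * ?b" unfolding ab4 by (simp only: distrib_left)
    finally show ?case .
  qed simp
  from this[OF order_refl] \<open>1 \<le> n\<close> show ?thesis by simp
qed

text \<open>Lets finite sums of networks stand in for integrals of networks in higher norms.
  Derivatives pass under the integral and through the sum alike, so the derivative of the error is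
  again the error of a Riemann sum.\<close>

lemma riemann_Ck_small:
  fixes F :: "real \<Rightarrow> 'a::euclidean_space \<Rightarrow> 'b::euclidean_space"
  assumes "open U" "Ck_family k {0..1} U F" "compact C" "C \<subseteq> U" "S \<subseteq> C" "0 < e"
  shows "\<exists>n0\<ge>1. \<forall>n\<ge>n0. Ck_small k S e
    (\<lambda>x. integral {0..1} (\<lambda>s. F s x) - (1 / real n) *\<^sub>R (\<Sum>i<n. F (real i / real n) x))"
  using assms(2)
proof (induction k arbitrary: F)
  have bound: "\<exists>n0\<ge>1. \<forall>n\<ge>n0. \<forall>x\<in>S. norm (integral {0..1} (\<lambda>s. F s x) - (1 / real n) *\<^sub>R (\<Sum>i<n. F (real i / real n) x)) \<le> e"
    if F: "Ck_family k {0..1} U F" for k and F :: "real \<Rightarrow> 'a \<Rightarrow> 'b"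
  proof -
    have "compact ({0..1::real} \<times> C)" using assms by (auto intro!: compact_Times)
    moreover have "{0..1::real} \<times> C \<subseteq> {0..1} \<times> U" using assms by auto
    ultimately obtain d where d: "d > 0" "\<And>c s. c \<in> {0..1} \<times> C \<Longrightarrow> s \<in> {0..1} \<times> U \<Longrightarrow> dist s c < d \<Longrightarrow>
        dist (case s of (p, x) \<Rightarrow> F p x) (case c of (p, x) \<Rightarrow> F p x) < e"
      using continuous_on_compact_neighbourhood[OF Ck_family_continuous[OF F] _ _ \<open>0 < e\<close>] by metis
    obtain n0 where n0: "1 / real (Suc n0) < d" using d(1) nat_approx_posE by blast
    show ?thesis
    proof (intro exI[of _ "Suc n0"] conjI allI impI ballI)
      fix n x assume n: "Suc n0 \<le> n" and x: "x \<in> S"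
      have "1 / real n \<le> 1 / real (Suc n0)" using n by (intro divide_left_mono) auto
      then have nd: "1 / real n < d" using n0 by linarith
      show "norm (integral {0..1} (\<lambda>s. F s x) - (1 / real n) *\<^sub>R (\<Sum>i<n. F (real i / real n) x)) \<le> e"
      proof (rule riemann_sum_bound)
        show "continuous_on {0..1} (\<lambda>s. F s x)"
          by (rule Ck_family_continuous_compose[OF F]) (use x assms in \<open>auto intro!: continuous_intros\<close>)
        fix s s' :: real assume s: "s \<in> {0..1}" "s' \<in> {0..1}" "\<bar>s - s'\<bar> \<le> 1 / real n"
        have "dist (s, x) (s', x) < d" using s nd by (simp add: dist_Pair_Pair dist_real_def)
        moreover have "(s, x) \<in> {0..1} \<times> U" "(s', x) \<in> {0..1} \<times> C" using s x assms by auto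
        ultimately show "norm (F s x - F s' x) \<le> e" using d(2)[of "(s', x)" "(s, x)"] by (simp add: dist_norm)
      qed (use n in auto)
    qed auto
  qed
  {
    case 0
    then show ?case using bound[OF 0] by simp
  next
    case (Suc k)
    obtain F' where F': "\<And>p x. p \<in> {0..1} \<Longrightarrow> x \<in> U \<Longrightarrow> (F p has_derivative F' p x) (at x)"
      "\<And>b. b \<in> Basis \<Longrightarrow> Ck_family k {0..1} U (\<lambda>p x. F' p x b)"
      using Ck_family_SucD[OF Suc.prems] by blast
    obtain n0 where n0: "\<And>n x. n \<ge> n0 \<Longrightarrow> x \<in> S \<Longrightarrow>
       norm (integral {0..1} (\<lambda>s. F s x) - (1 / real n) *\<^sub>R (\<Sum>i<n. F (real i / real n) x)) \<le> e"
      using bound[OF Suc.prems] by metis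
    have "\<forall>b\<in>Basis. \<exists>n1. \<forall>n\<ge>n1. Ck_small k S e (\<lambda>x. integral {0..1} (\<lambda>s. F' s x b) -
        (1 / real n) *\<^sub>R (\<Sum>i<n. F' (real i / real n) x b))"
      using Suc.IH[OF F'(2)] by blast
    from bchoice[OF this] obtain n1 where n1: "\<forall>b\<in>Basis. \<forall>n\<ge>n1 b. Ck_small k S e (\<lambda>x. integral {0..1} (\<lambda>s. F' s x b) -
        (1 / real n) *\<^sub>R (\<Sum>i<n. F' (real i / real n) x b))" ..
    show ?case
    proof (intro exI[of _ "Suc (n0 + Max (n1 ` Basis))"] conjI allI impI)
      fix n assume n: "Suc (n0 + Max (n1 ` Basis)) \<le> n"
      show "Ck_small (Suc k) S e (\<lambda>x. integral {0..1} (\<lambda>s. F s x) - (1 / real n) *\<^sub>R (\<Sum>i<n. F (real i / real n) x))"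
      proof (rule Ck_small_SucI[where h' = "\<lambda>x v. integral {0..1} (\<lambda>s. F' s x v) -
          (1 / real n) *\<^sub>R (\<Sum>i<n. F' (real i / real n) x v)"])
        show "norm (integral {0..1} (\<lambda>s. F s x) - (1 / real n) *\<^sub>R (\<Sum>i<n. F (real i / real n) x)) \<le> e"
          if "x \<in> S" for x using n that by (intro n0) auto
        show "((\<lambda>x. integral {0..1} (\<lambda>s. F s x) - (1 / real n) *\<^sub>R (\<Sum>i<n. F (real i / real n) x)) has_derivative
          (\<lambda>v. integral {0..1} (\<lambda>s. F' s x v) - (1 / real n) *\<^sub>R (\<Sum>i<n. F' (real i / real n) x v))) (at x)"
          if "x \<in> S" for x
        proof -
          have x: "x \<in> U" using that assms by auto
          have "((\<lambda>x. integral {0..1} (\<lambda>s. F s x)) has_derivative (\<lambda>v. integral {0..1} (\<lambda>s. F' s x v))) (at x)"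
            by (rule has_derivative_integral_param[OF \<open>open U\<close> Ck_family_continuous[OF Suc.prems] F'(1)
                  Ck_family_continuous[OF F'(2)] x])
          then show ?thesis
            by (intro has_derivative_diff has_derivative_scaleR_right has_derivative_sum F' x) auto
        qed
        fix b :: 'a assume b: "b \<in> Basis"
        then have "n1 b \<le> Max (n1 ` Basis)" by auto
        then have "n1 b \<le> n" using n by linarith
        then show "Ck_small k S e (\<lambda>x. integral {0..1} (\<lambda>s. F' s x b) - (1 / real n) *\<^sub>R (\<Sum>i<n. F' (real i / real n) x b))"
          using n1 b by blast
      qed
    qed auto
  }
qed

section \<open>Uniform density of shallow networks\<close>

text \<open>One hidden layer and no output offset, built up neuron by neuron, so that the closure
  properties are short inductions.\<close>

inductive_set shallow :: "(real \<Rightarrow> real) \<Rightarrow> ('a::euclidean_space \<Rightarrow> 'b::euclidean_space) set"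
  for \<sigma> :: "real \<Rightarrow> real"
where
  shallow_zero: "(\<lambda>x. 0) \<in> shallow \<sigma>"
| shallow_neuron: "g \<in> shallow \<sigma> \<Longrightarrow> (\<lambda>x. g x + \<sigma> (w \<bullet> x + b) *\<^sub>R c) \<in> shallow \<sigma>"

lemma shallow_single: "(\<lambda>x. \<sigma> (w \<bullet> x + b) *\<^sub>R c) \<in> shallow \<sigma>"
  using shallow_neuron[OF shallow_zero, where \<sigma> = \<sigma>] by simp

lemma shallow_add:
  assumes "f \<in> shallow \<sigma>" "g \<in> shallow \<sigma>"
  shows "(\<lambda>x. f x + g x) \<in> shallow \<sigma>"
  using assms(2)
proof induction
  case (shallow_neuron g w b c)
  from shallow.shallow_neuron[OF shallow_neuron.IH] show ?case by (simp add: add.assoc)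
qed (use assms in simp)

lemma shallow_scaleR: "g \<in> shallow \<sigma> \<Longrightarrow> (\<lambda>x. a *\<^sub>R g x) \<in> shallow \<sigma>"
proof (induction rule: shallow.induct)
  case (shallow_neuron g w b c)
  from shallow.shallow_neuron[OF shallow_neuron.IH, of w b "a *\<^sub>R c"] show ?case
    by (simp add: scaleR_add_right mult.commute)
qed (simp add: shallow_zero)

lemma shallow_sum: "finite A \<Longrightarrow> (\<And>i. i \<in> A \<Longrightarrow> f i \<in> shallow \<sigma>) \<Longrightarrow> (\<lambda>x. \<Sum>i\<in>A. f i x) \<in> shallow \<sigma>"
  by (induction A rule: finite_induct) (auto intro: shallow_zero shallow_add)

lemma shallow_translate: "g \<in> shallow \<sigma> \<Longrightarrow> (\<lambda>x. g (x + v)) \<in> shallow \<sigma>"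
proof (induction rule: shallow.induct)
  case (shallow_neuron g w b c)
  from shallow.shallow_neuron[OF shallow_neuron.IH, of w "w \<bullet> v + b" c] show ?case
    by (simp add: inner_add_right add_ac)
qed (simp add: shallow_zero)

lemma shallow_scaleR_const:
  "(g :: 'a::euclidean_space \<Rightarrow> real) \<in> shallow \<sigma> \<Longrightarrow> (\<lambda>x. g x *\<^sub>R (c :: 'b::euclidean_space)) \<in> shallow \<sigma>"
proof (induction rule: shallow.induct)
  case (shallow_neuron g w b a)
  from shallow.shallow_neuron[OF shallow_neuron.IH, of w b "a *\<^sub>R c"] show ?case
    by (simp add: scaleR_add_left)
qed (simp add: shallow_zero)

lemma shallow_imp_networks:
  assumes "g \<in> shallow \<sigma>"
  shows "g \<in> networks \<sigma>"
proof -
  from assms have "\<exists>(m::nat) w b c. g = (\<lambda>x. \<Sum>j<m. \<sigma> (w j \<bullet> x + b j) *\<^sub>R c j)"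
  proof induction
    case shallow_zero
    show ?case by (rule exI[of _ 0]) simp
  next
    case (shallow_neuron g w b c)
    then obtain m :: nat and w' b' c' where g: "g = (\<lambda>x. \<Sum>j<m. \<sigma> (w' j \<bullet> x + b' j) *\<^sub>R c' j)" by blast
    show ?case
      by (rule exI[of _ "Suc m"], rule exI[of _ "w'(m := w)"], rule exI[of _ "b'(m := b)"], rule exI[of _ "c'(m := c)"])
        (auto simp: g)
  qed
  then obtain m :: nat and w b c where g: "g = (\<lambda>x. \<Sum>j<m. \<sigma> (w j \<bullet> x + b j) *\<^sub>R c j)" by blast
  \<comment> \<open>A hidden layer must have positive width while the sum may be empty; an extra
    neuron with output weight zero covers this case.\<close>
  let ?c = "c(m := 0)"
  have "g = (\<lambda>x. (\<Sum>j<Suc m. \<sigma> (w j \<bullet> x + b j) *\<^sub>R ?c j) + 0)" by (simp add: g)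
  moreover have "hidden_layer \<sigma> (Suc m) (\<lambda>x i. \<sigma> (w i \<bullet> x + b i))" by (rule hidden_layer.first) simp
  ultimately show ?thesis
    unfolding networks_def
    by (intro CollectI exI[of _ "Suc m"] exI[of _ "\<lambda>x i. \<sigma> (w i \<bullet> x + b i)"] exI[of _ ?c] exI[of _ 0] conjI)
qed

text \<open>A single function is encoded as a family with a one-point parameter set.\<close>

abbreviation Ck :: "nat \<Rightarrow> 'a::euclidean_space set \<Rightarrow> ('a \<Rightarrow> 'b::real_normed_vector) \<Rightarrow> bool" where
  "Ck k U f \<equiv> Ck_family k {0::real} U (\<lambda>_. f)"

lemma Ck_imp_Ck_family: "Ck k U f \<Longrightarrow> Ck_family k P U (\<lambda>_. f)"
  using Ck_family_reindex[of P "\<lambda>_. 0" "{0}" k U "\<lambda>_. f"] by auto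

lemma Ck_on_imp_Ck:
  assumes "open U"
  shows "Ck_on k U f \<Longrightarrow> Ck k U f"
proof (induction k arbitrary: f)
  have *: "continuous_on ({0::real} \<times> U) (\<lambda>(p, x). f x)" if "continuous_on U f" for f :: "'a \<Rightarrow> 'b"
    unfolding split_beta by (rule continuous_on_compose2[OF that]) (auto intro!: continuous_intros)
  {
    case 0
    then show ?case using * by simp
  next
    case (Suc k)
    then obtain f' where f': "\<And>x. x \<in> U \<Longrightarrow> (f has_derivative f' x) (at x)" "\<And>v. Ck_on k U (\<lambda>x. f' x v)"
      using \<open>open U\<close> by (auto simp: at_within_open[OF _ \<open>open U\<close>])
    have "continuous_on U f"
      using f'(1) by (meson continuous_at_imp_continuous_on has_derivative_continuous)
    then show ?case
      by (intro Ck_family_SucI[where f' = "\<lambda>_. f'"] * f' Suc.IH)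
  }
qed

lemma shallow_Ck:
  assumes "Ck k UNIV \<sigma>" "g \<in> shallow \<sigma>"
  shows "Ck k UNIV g"
  using assms(2)
proof induction
  case (shallow_neuron g w b c)
  have "Ck k UNIV (\<lambda>x. w \<bullet> x + b)"
    by (intro Ck_family_add Ck_family_const Ck_family_linear[OF bounded_linear_inner_right] Ck_family_ident)
  from Ck_family_compose[OF assms(1) this] show ?case
    by (intro Ck_family_add shallow_neuron.IH Ck_family_scaleR Ck_family_const) auto
qed (rule Ck_family_const)

section \<open>The closure of the shallow networks\<close>

definition Ck_closure ::
  "nat \<Rightarrow> ('a::euclidean_space \<Rightarrow> 'b::real_normed_vector) set \<Rightarrow> ('a \<Rightarrow> 'b) set"
where
  "Ck_closure k M = {f. \<forall>R e. 0 < e \<longrightarrow> (\<exists>g\<in>M. Ck_small k (ball 0 R) e (\<lambda>x. f x - g x))}"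

lemma Ck_closureD:
  "f \<in> Ck_closure k M \<Longrightarrow> 0 < e \<Longrightarrow> \<exists>g\<in>M. Ck_small k (ball 0 R) e (\<lambda>x. f x - g x)"
  by (auto simp: Ck_closure_def)

lemma Ck_closure_mem: "g \<in> M \<Longrightarrow> g \<in> Ck_closure k M"
  by (auto simp: Ck_closure_def intro!: bexI[of _ g] Ck_small_zero)

lemma Ck_closure_closed:
  assumes "\<And>R e. 0 < e \<Longrightarrow> \<exists>g\<in>Ck_closure k M. Ck_small k (ball 0 R) e (\<lambda>x. f x - g x)"
  shows "f \<in> Ck_closure k M"
  unfolding Ck_closure_def
proof (intro CollectI allI impI)
  fix R e :: real assume "0 < e"
  then have e: "0 < e / 2" by simp
  obtain g where g: "g \<in> Ck_closure k M" "Ck_small k (ball 0 R) (e / 2) (\<lambda>x. f x - g x)"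
    using assms[OF e] by blast
  obtain h where h: "h \<in> M" "Ck_small k (ball 0 R) (e / 2) (\<lambda>x. g x - h x)"
    using Ck_closureD[OF g(1) e] by blast
  show "\<exists>g\<in>M. Ck_small k (ball 0 R) e (\<lambda>x. f x - g x)"
    using Ck_small_add[OF g(2) h(2)] h(1) by (intro bexI[of _ h]) auto
qed

lemma Ck_closure_shallow_add:
  assumes "f \<in> Ck_closure k (shallow \<sigma>)" "g \<in> Ck_closure k (shallow \<sigma>)"
  shows "(\<lambda>x. f x + g x) \<in> Ck_closure k (shallow \<sigma>)"
  unfolding Ck_closure_def
proof (intro CollectI allI impI)
  fix R e :: real assume "0 < e"
  then have e: "0 < e / 2" by simp
  obtain f' where f': "f' \<in> shallow \<sigma>" "Ck_small k (ball 0 R) (e / 2) (\<lambda>x. f x - f' x)"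
    using Ck_closureD[OF assms(1) e] by blast
  obtain g' where g': "g' \<in> shallow \<sigma>" "Ck_small k (ball 0 R) (e / 2) (\<lambda>x. g x - g' x)"
    using Ck_closureD[OF assms(2) e] by blast
  show "\<exists>h\<in>shallow \<sigma>. Ck_small k (ball 0 R) e (\<lambda>x. f x + g x - h x)"
    using Ck_small_add[OF f'(2) g'(2)] by (intro bexI[OF _ shallow_add[OF f'(1) g'(1)]]) (simp add: algebra_simps)
qed

lemma Ck_closure_shallow_scaleR:
  assumes "f \<in> Ck_closure k (shallow \<sigma>)"
  shows "(\<lambda>x. a *\<^sub>R f x) \<in> Ck_closure k (shallow \<sigma>)"
  unfolding Ck_closure_def
proof (intro CollectI allI impI)
  fix R e :: real assume "0 < e"
  then have e: "0 < e / (\<bar>a\<bar> + 1)" by simp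
  obtain g where g: "g \<in> shallow \<sigma>" "Ck_small k (ball 0 R) (e / (\<bar>a\<bar> + 1)) (\<lambda>x. f x - g x)"
    using Ck_closureD[OF assms e] by blast
  have "\<bar>a\<bar> * (e / (\<bar>a\<bar> + 1)) \<le> e" using \<open>0 < e\<close> by (simp add: field_simps)
  then show "\<exists>g\<in>shallow \<sigma>. Ck_small k (ball 0 R) e (\<lambda>x. a *\<^sub>R f x - g x)"
    using Ck_small_mono[OF Ck_small_scaleR[OF g(2)] order_refl]
    by (intro bexI[OF _ shallow_scaleR[OF g(1)]]) (simp add: scaleR_diff_right)
qed

lemma Ck_closure_shallow_zero: "(\<lambda>x. 0) \<in> Ck_closure k (shallow \<sigma>)"
  by (rule Ck_closure_mem[OF shallow_zero])

lemma Ck_closure_shallow_sum: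
  "finite A \<Longrightarrow> (\<And>i. i \<in> A \<Longrightarrow> f i \<in> Ck_closure k (shallow \<sigma>)) \<Longrightarrow>
    (\<lambda>x. \<Sum>i\<in>A. f i x) \<in> Ck_closure k (shallow \<sigma>)"
  by (induction A rule: finite_induct) (auto intro: Ck_closure_shallow_zero Ck_closure_shallow_add)

lemma Ck_closure_shallow_integral:
  fixes F :: "real \<Rightarrow> 'a::euclidean_space \<Rightarrow> 'b::euclidean_space"
  assumes "Ck_family k {0..1} UNIV F" "\<And>s. s \<in> {0..1} \<Longrightarrow> F s \<in> Ck_closure k (shallow \<sigma>)"
  shows "(\<lambda>x. integral {0..1} (\<lambda>s. F s x)) \<in> Ck_closure k (shallow \<sigma>)"
proof (rule Ck_closure_closed)
  fix R e :: real assume "0 < e"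
  obtain n where n: "1 \<le> n" "Ck_small k (ball 0 R) e
    (\<lambda>x. integral {0..1} (\<lambda>s. F s x) - (1 / real n) *\<^sub>R (\<Sum>i<n. F (real i / real n) x))"
    using riemann_Ck_small[OF open_UNIV assms(1) compact_cball subset_UNIV ball_subset_cball \<open>0 < e\<close>, of 0 R] by blast
  have "(\<lambda>x. (1 / real n) *\<^sub>R (\<Sum>i<n. F (real i / real n) x)) \<in> Ck_closure k (shallow \<sigma>)"
    by (intro Ck_closure_shallow_scaleR Ck_closure_shallow_sum assms(2)) auto
  from bexI[OF _ this] n(2)
  show "\<exists>g\<in>Ck_closure k (shallow \<sigma>). Ck_small k (ball 0 R) e (\<lambda>x. integral {0..1} (\<lambda>s. F s x) - g x)"
    by fastforce
qed

section \<open>Iterated differences and ridge functions\<close>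

definition forward_diff :: "real \<Rightarrow> (real \<Rightarrow> real) \<Rightarrow> real \<Rightarrow> real" where
  "forward_diff \<delta> g t = g (t + \<delta>) - g t"

lemma bounded_forward_diff_power:
  assumes "\<And>t. \<bar>g t\<bar> \<le> B"
  shows "\<exists>C. \<forall>t. \<bar>(forward_diff \<delta> ^^ k) g t\<bar> \<le> C"
proof (induction k)
  case (Suc k)
  then obtain C where C: "\<And>t. \<bar>(forward_diff \<delta> ^^ k) g t\<bar> \<le> C" by blast
  have "\<bar>(forward_diff \<delta> ^^ Suc k) g t\<bar> \<le> C + C" for t
    using C[of t] C[of "t + \<delta>"] by (simp add: forward_diff_def)
  then show ?case by blast
qed (use assms in auto)

text \<open>If a difference of order at least two vanishes, the difference \<open>?v\<close> of one
  order less is \<open>\<delta>\<close>-periodic, so the one below it, \<open>?u\<close>, grows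
  linearly along \<open>t + n * \<delta>\<close> with increment \<open>?v t\<close>. Boundedness
  forces \<open>?v\<close> to vanish, and the order descends to one.\<close>

lemma forward_diff_power_zero:
  assumes B: "\<And>t. \<bar>g t\<bar> \<le> B" and "\<And>t. (forward_diff \<delta> ^^ Suc k) g t = 0"
  shows "forward_diff \<delta> g t = 0"
  using assms(2)
proof (induction k arbitrary: t)
  case 0
  then show ?case by simp
next
  case (Suc k)
  let ?u = "(forward_diff \<delta> ^^ k) g" and ?v = "(forward_diff \<delta> ^^ Suc k) g"
  have v: "?v t = ?u (t + \<delta>) - ?u t" for t
    by (simp only: funpow.simps o_apply forward_diff_def[of \<delta> ?u])
  have vper: "?v (t + \<delta>) = ?v t" for t
  proof -
    have "forward_diff \<delta> ?v t = 0" using Suc.prems[of t] by simp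
    then show ?thesis unfolding forward_diff_def[of \<delta> ?v] by simp
  qed
  have "?v t = 0" for t
  proof (rule ccontr)
    assume v0: "?v t \<noteq> 0"
    have v_n: "?v (t + real n * \<delta>) = ?v t" for n
    proof (induction n)
      case (Suc n)
      then show ?case using vper[of "t + real n * \<delta>"] by (simp add: algebra_simps)
    qed simp
    have u_n: "?u (t + real n * \<delta>) = ?u t + real n * ?v t" for n
    proof (induction n)
      case (Suc n)
      have "?u (t + real (Suc n) * \<delta>) = ?u (t + real n * \<delta>) + ?v (t + real n * \<delta>)"
        unfolding v by (simp add: algebra_simps)
      then show ?case unfolding v_n Suc by (simp add: algebra_simps)
    qed simp
    obtain C where C: "\<And>t. \<bar>?u t\<bar> \<le> C" using bounded_forward_diff_power[of g B, OF B] by blast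
    obtain n where n: "2 * C < real n * \<bar>?v t\<bar>" using v0 reals_Archimedean3[of "\<bar>?v t\<bar>"] by auto
    have "real n * \<bar>?v t\<bar> = \<bar>?u (t + real n * \<delta>) - ?u t\<bar>" unfolding u_n by (simp add: abs_mult)
    also have "\<dots> \<le> C + C" using C[of t] C[of "t + real n * \<delta>"] by linarith
    finally show False using n by simp
  qed
  then show ?case by (rule Suc.IH)
qed

text \<open>Vanishing for all steps would reduce to
  \<open>\<sigma> (t + \<delta>) = \<sigma> t\<close> for every \<open>\<delta>\<close>, so
  \<open>\<sigma>\<close> would be constant. The step found may depend on the order
  \<open>k\<close>.\<close>

lemma activation_forward_diff:
  assumes "bounded (range \<sigma>)" "\<not> \<sigma> constant_on UNIV"
  shows "\<exists>\<delta> t. (forward_diff \<delta> ^^ k) \<sigma> t \<noteq> 0"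
proof (rule ccontr)
  assume neg: "\<not> ?thesis"
  obtain B where B: "\<And>t. \<bar>\<sigma> t\<bar> \<le> B" using assms(1) by (auto simp: bounded_iff)
  have "forward_diff \<delta> \<sigma> t = 0" for \<delta> t
  proof (cases k)
    case 0
    then show ?thesis using neg by (auto simp: forward_diff_def)
  next
    case (Suc j)
    then show ?thesis using neg forward_diff_power_zero[OF B, where \<delta> = \<delta> and k = j and t = t] by auto
  qed
  from this[of _ 0] have "\<sigma> t = \<sigma> 0" for t by (simp add: forward_diff_def)
  then show False using assms(2) by (auto simp: constant_on_def)
qed

lemma global_antiderivative:
  fixes g :: "real \<Rightarrow> real"
  assumes "continuous_on UNIV g"
  shows "\<exists>G. \<forall>t. (G has_real_derivative g t) (at t)"
proof -
  \<comment> \<open>One of the two intervals is empty or a point, so this is the signed integral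
    from \<open>0\<close> to \<open>t\<close>.\<close>
  define G where "G t = integral {0..t} g - integral {t..0} g" for t
  have int: "g integrable_on {a..b}" for a b
    by (intro integrable_continuous_interval continuous_on_subset[OF assms]) auto
  have "(G has_real_derivative g t) (at t)" for t
  proof -
    define a where "a = min t 0 - 1"
    define b where "b = max t 0 + 1"
    have "a \<le> 0" by (simp add: a_def)
    have G_eq: "G s = integral {a..s} g - integral {a..0} g" if "a \<le> s" for s
    proof (cases "0 \<le> s")
      case True
      then show ?thesis using Henstock_Kurzweil_Integration.integral_combine[of a 0 s g] int \<open>a \<le> 0\<close>
        by (cases "s = 0") (auto simp: G_def algebra_simps)
    next
      case False
      then show ?thesis using Henstock_Kurzweil_Integration.integral_combine[of a s 0 g] int that
        by (auto simp: G_def)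
    qed
    have "((\<lambda>s. integral {a..s} g) has_real_derivative g t) (at t within {a..b})"
      by (rule integral_has_real_derivative[OF continuous_on_subset[OF assms]]) (auto simp: a_def b_def)
    moreover have "at t within {a..b} = at t"
      by (rule at_within_Icc_at) (auto simp: a_def b_def)
    ultimately have "((\<lambda>s. integral {a..s} g - integral {a..0} g) has_real_derivative g t) (at t)"
      by (auto intro!: derivative_eq_intros)
    then show ?thesis
      by (rule has_field_derivative_transform_within_open[where S = "{a<..}"]) (use G_eq in \<open>auto simp: a_def\<close>)
  qed
  then show ?thesis by blast
qed

text \<open>The type argument fixes the space on which the ridge functions live, which
  \<open>\<sigma>\<close> and \<open>g\<close> do not determine. Membership for all \<open>w\<close>
  and \<open>b\<close> at once is what permits differentiation in these parameters.\<close>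

definition ridge_profiles :: "(real \<Rightarrow> real) \<Rightarrow> 'a::euclidean_space itself \<Rightarrow> (real \<Rightarrow> real) set" where
  "ridge_profiles \<sigma> _ = {g. continuous_on UNIV g \<and>
     (\<forall>w b. (\<lambda>x::'a. g (w \<bullet> x + b)) \<in> Ck_closure 0 (shallow \<sigma>))}"

text \<open>If \<open>G\<close> is an antiderivative of \<open>g\<close>, the average is
  \<open>G (t + \<delta>) - G t\<close>, with derivative \<open>forward_diff \<delta> g\<close>.
  Repeated averaging thus supplies profiles with derivatives of any order without leaving the
  closure, whatever the smoothness of \<open>\<sigma>\<close>.\<close>

lemma ridge_profiles_average:
  assumes g: "g \<in> ridge_profiles \<sigma> TYPE('a::euclidean_space)"
  shows "(\<lambda>t. integral {0..1} (\<lambda>s. \<delta> * g (t + \<delta> * s))) \<in> ridge_profiles \<sigma> TYPE('a)"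
  unfolding ridge_profiles_def
proof (intro CollectI conjI allI)
  have cont: "continuous_on UNIV g" and mem: "\<And>w b. (\<lambda>x::'a. g (w \<bullet> x + b)) \<in> Ck_closure 0 (shallow \<sigma>)"
    using g by (auto simp: ridge_profiles_def)
  have "continuous_on (UNIV \<times> cbox 0 1) (\<lambda>(t, s). \<delta> * g (t + \<delta> * s))"
    unfolding split_beta by (intro continuous_intros continuous_on_compose2[OF cont]) auto
  from integral_continuous_on_param[OF this]
  show "continuous_on UNIV (\<lambda>t. integral {0..1} (\<lambda>s. \<delta> * g (t + \<delta> * s)))" by simp
  fix w :: 'a and b
  show "(\<lambda>x. integral {0..1} (\<lambda>s. \<delta> * g ((w \<bullet> x + b) + \<delta> * s))) \<in> Ck_closure 0 (shallow \<sigma>)"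
  proof (rule Ck_closure_shallow_integral)
    have "continuous_on ({0..1} \<times> UNIV) (\<lambda>y. \<delta> * g ((w \<bullet> snd y + b) + \<delta> * fst y))"
      by (intro continuous_intros continuous_on_compose2[OF cont]) auto
    then show "Ck_family 0 {0..1} UNIV (\<lambda>s x. \<delta> * g ((w \<bullet> x + b) + \<delta> * s))"
      by (simp add: split_beta)
    show "(\<lambda>x. \<delta> * g ((w \<bullet> x + b) + \<delta> * s)) \<in> Ck_closure 0 (shallow \<sigma>)" for s
      using Ck_closure_shallow_scaleR[OF mem[of w "b + \<delta> * s"], of \<delta>] by (simp add: add.assoc)
  qed
qed

lemma average_has_derivative:
  assumes "continuous_on UNIV g"
  shows "((\<lambda>t. integral {0..1} (\<lambda>s. \<delta> * g (t + \<delta> * s))) has_real_derivative forward_diff \<delta> g t) (at t)"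
proof -
  obtain G where G: "\<And>t. (G has_real_derivative g t) (at t)" using global_antiderivative[OF assms] by blast
  have "integral {0..1} (\<lambda>s. \<delta> * g (t + \<delta> * s)) = G (t + \<delta>) - G t" for t
  proof (rule integral_unique)
    have "((\<lambda>s. G (t + \<delta> * s)) has_vector_derivative \<delta> * g (t + \<delta> * s)) (at s within {0..1})" for s
    proof -
      have "((\<lambda>s. G (t + \<delta> * s)) has_real_derivative g (t + \<delta> * s) * \<delta>) (at s within {0..1})"
        by (rule DERIV_chain2[OF G]) (auto intro!: derivative_eq_intros)
      then show ?thesis by (simp add: has_real_derivative_iff_has_vector_derivative mult.commute)
    qed
    from fundamental_theorem_of_calculus[of 0 1, OF _ this]
    show "((\<lambda>s. \<delta> * g (t + \<delta> * s)) has_integral G (t + \<delta>) - G t) {0..1}" by simp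
  qed
  moreover have "((\<lambda>t. G (t + \<delta>) - G t) has_real_derivative forward_diff \<delta> g t) (at t)"
    unfolding forward_diff_def by (auto intro!: derivative_eq_intros DERIV_chain2[OF G] G)
  ultimately show ?thesis by simp
qed

lemma forward_diff_power_has_derivative:
  assumes "\<And>t. (g has_real_derivative g' t) (at t)"
  shows "((forward_diff \<delta> ^^ k) g has_real_derivative (forward_diff \<delta> ^^ k) g' t) (at t)"
proof (induction k arbitrary: t)
  case (Suc k)
  have "((\<lambda>t. (forward_diff \<delta> ^^ k) g (t + \<delta>)) has_real_derivative (forward_diff \<delta> ^^ k) g' (t + \<delta>)) (at t)"
    using Suc[of "t + \<delta>"] by (simp add: DERIV_shift)
  from DERIV_diff[OF this Suc[of t]] show ?case by (simp add: forward_diff_def[abs_def])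
qed (use assms in auto)

lemma continuous_forward_diff_power:
  assumes "continuous_on UNIV g"
  shows "continuous_on UNIV ((forward_diff \<delta> ^^ k) g)"
proof (induction k)
  case (Suc k)
  have "continuous_on UNIV (\<lambda>t. (forward_diff \<delta> ^^ k) g (t + \<delta>))"
    by (rule continuous_on_compose2[OF Suc]) (auto intro!: continuous_intros)
  with Suc show ?case by (auto simp: forward_diff_def[abs_def] intro!: continuous_intros)
qed (use assms in simp)

text \<open>The function in question is the derivative at \<open>\<theta> = 0\<close> of the members
  given by \<open>mem\<close>, a limit of their difference quotients. Written as the integral
  \<open>H \<theta>\<close>, the quotient is jointly continuous up to \<open>\<theta> = 0\<close>,
  which makes the convergence uniform on balls.\<close>

lemma Ck_closure_derivative:
  fixes P l a :: "'a::euclidean_space \<Rightarrow> real"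
  assumes cont: "continuous_on UNIV P" "continuous_on UNIV l" "continuous_on UNIV a" "continuous_on UNIV G'"
    and G: "\<And>t. (G has_real_derivative G' t) (at t)"
    and mem: "\<And>\<theta>. (\<lambda>x. P x * G (a x + \<theta> * l x)) \<in> Ck_closure 0 (shallow \<sigma>)"
  shows "(\<lambda>x. P x * l x * G' (a x)) \<in> Ck_closure 0 (shallow \<sigma>)"
proof (rule Ck_closure_closed)
  fix R e :: real assume "0 < e"
  define H where "H \<theta> x = integral {0..1} (\<lambda>s. P x * l x * G' (a x + s * (\<theta> * l x)))" for \<theta> x
  have "continuous_on (({0..1} \<times> UNIV) \<times> cbox 0 1)
      (\<lambda>y. P (snd (fst y)) * l (snd (fst y)) * G' (a (snd (fst y)) + snd y * (fst (fst y) * l (snd (fst y)))))"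
    by (intro continuous_intros continuous_on_compose2[OF cont(1)] continuous_on_compose2[OF cont(2)]
        continuous_on_compose2[OF cont(3)] continuous_on_compose2[OF cont(4)]) auto
  then have "continuous_on (({0..1} \<times> UNIV) \<times> cbox 0 1)
      (\<lambda>(y, s). P (snd y) * l (snd y) * G' (a (snd y) + s * (fst y * l (snd y))))"
    by (simp add: split_beta)
  from integral_continuous_on_param[OF this]
  have "Ck_family 0 {0..1} UNIV H" by (simp add: H_def split_beta)
  from Ck_family_imp_Ck_small[OF this _ compact_cball subset_UNIV ball_subset_cball \<open>0 < e\<close>, of 0 0 R]
  obtain d where d: "d > 0" "\<And>\<theta>. \<theta> \<in> {0..1} \<Longrightarrow> dist \<theta> 0 < d \<Longrightarrow> Ck_small 0 (ball 0 R) e (\<lambda>x. H \<theta> x - H 0 x)"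
    by auto
  define r where "r = min (d / 2) 1"
  have r: "0 < r" "r \<in> {0..1}" "dist r 0 < d" using d(1) by (auto simp: r_def)
  have H_r: "H r = (\<lambda>x. (1 / r) *\<^sub>R (P x * G (a x + r * l x) + (-1) *\<^sub>R (P x * G (a x + 0 * l x))))"
  proof
    fix x
    have "((\<lambda>s. P x * l x * G' (a x + s * (r * l x))) has_integral
       (P x / r * G (a x + 1 * (r * l x)) - P x / r * G (a x + 0 * (r * l x)))) {0..1}"
    proof (rule fundamental_theorem_of_calculus)
      fix s :: real
      have "((\<lambda>s. P x / r * G (a x + s * (r * l x))) has_real_derivative P x / r * (G' (a x + s * (r * l x)) * (r * l x)))
         (at s within {0..1})"
        by (rule DERIV_cmult, rule DERIV_chain2[OF G]) (auto intro!: derivative_eq_intros)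
      moreover have "P x / r * (G' (a x + s * (r * l x)) * (r * l x)) = P x * l x * G' (a x + s * (r * l x))"
        using r(1) by simp
      ultimately show "((\<lambda>s. P x / r * G (a x + s * (r * l x))) has_vector_derivative P x * l x * G' (a x + s * (r * l x)))
         (at s within {0..1})"
        by (simp only: has_real_derivative_iff_has_vector_derivative)
    qed simp
    from integral_unique[OF this]
    show "H r x = (1 / r) *\<^sub>R (P x * G (a x + r * l x) + (-1) *\<^sub>R (P x * G (a x + 0 * l x)))"
      by (simp add: H_def diff_divide_distrib)
  qed
  have "H r \<in> Ck_closure 0 (shallow \<sigma>)"
    unfolding H_r by (intro Ck_closure_shallow_scaleR Ck_closure_shallow_add mem)
  moreover have "Ck_small 0 (ball 0 R) e (\<lambda>x. P x * l x * G' (a x) - H r x)"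
    using Ck_small_minus[OF d(2)[OF r(2,3)]] by (simp add: H_def)
  ultimately show "\<exists>g\<in>Ck_closure 0 (shallow \<sigma>). Ck_small 0 (ball 0 R) e (\<lambda>x. P x * l x * G' (a x) - g x)"
    by blast
qed

section \<open>Polynomials in the closure\<close>

definition affine_prod :: "('a::euclidean_space \<times> real) list \<Rightarrow> 'a \<Rightarrow> real" where
  "affine_prod ls x = (\<Prod>(w, b)\<leftarrow>ls. w \<bullet> x + b)"

lemma affine_prod_simps [simp]:
  "affine_prod [] x = 1" "affine_prod ((w, b) # ls) x = (w \<bullet> x + b) * affine_prod ls x"
  by (simp_all add: affine_prod_def)

lemma continuous_on_affine_prod: "continuous_on S (affine_prod ls)"
proof (induction ls)
  case (Cons a ls)
  then show ?case by (cases a) (auto intro!: continuous_intros)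
qed (auto simp: affine_prod_def[abs_def])

text \<open>Perturbing the argument of the profile by \<open>\<theta>\<close> times an affine
  function and differentiating at \<open>\<theta> = 0\<close> pulls out that function as a factor.
  Each factor costs one derivative, paid for by averaging the profile once beforehand; what remains
  of the profile is therefore an iterated difference of \<open>g\<close> instead of a
  derivative.\<close>

lemma affine_prod_forward_diff_closure:
  assumes "g \<in> ridge_profiles \<sigma> TYPE('a::euclidean_space)"
  shows "(\<lambda>x::'a. affine_prod ls x * (forward_diff \<delta> ^^ length ls) g (w \<bullet> x + b)) \<in> Ck_closure 0 (shallow \<sigma>)"
  using assms
proof (induction ls arbitrary: g w b)
  case Nil
  then show ?case by (simp add: ridge_profiles_def)
next
  case (Cons l ls)
  obtain v c where l: "l = (v, c)" by fastforce
  let ?g1 = "\<lambda>t. integral {0..1} (\<lambda>s. \<delta> * g (t + \<delta> * s))"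
  let ?G = "(forward_diff \<delta> ^^ length ls) ?g1" and ?G' = "(forward_diff \<delta> ^^ length ls) (forward_diff \<delta> g)"
  have g: "continuous_on UNIV g" using Cons.prems by (simp add: ridge_profiles_def)
  have "(\<lambda>x. affine_prod ls x * (v \<bullet> x + c) * ?G' (w \<bullet> x + b)) \<in> Ck_closure 0 (shallow \<sigma>)"
  proof (rule Ck_closure_derivative[where G = ?G and P = "affine_prod ls" and l = "\<lambda>x. v \<bullet> x + c" and a = "\<lambda>x. w \<bullet> x + b"])
    show "(?G has_real_derivative ?G' t) (at t)" for t
      by (rule forward_diff_power_has_derivative[OF average_has_derivative[OF g]])
    show "continuous_on UNIV ?G'"
      using continuous_forward_diff_power[OF g, where \<delta> = \<delta> and k = "Suc (length ls)"] by (simp add: funpow_swap1)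
    show "(\<lambda>x. affine_prod ls x * ?G (w \<bullet> x + b + \<theta> * (v \<bullet> x + c))) \<in> Ck_closure 0 (shallow \<sigma>)" for \<theta>
    proof -
      have eq: "w \<bullet> x + b + \<theta> * (v \<bullet> x + c) = (w + \<theta> *\<^sub>R v) \<bullet> x + (b + \<theta> * c)" for x
        by (simp add: inner_add_left algebra_simps)
      show ?thesis unfolding eq by (rule Cons.IH[OF ridge_profiles_average[OF Cons.prems]])
    qed
  qed (auto intro!: continuous_intros continuous_on_affine_prod)
  then show ?case by (simp add: l funpow_swap1 mult_ac)
qed

lemma affine_prod_closure:
  assumes "bounded (range \<sigma>)" "\<not> \<sigma> constant_on UNIV" "continuous_on UNIV \<sigma>"
  shows "affine_prod ls \<in> Ck_closure 0 (shallow \<sigma>)"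
proof -
  have "(\<lambda>x::'a. \<sigma> (w \<bullet> x + b)) \<in> Ck_closure 0 (shallow \<sigma>)" for w b
    using Ck_closure_mem[OF shallow_single[of \<sigma> w b "1::real"]] by simp
  then have \<sigma>: "\<sigma> \<in> ridge_profiles \<sigma> TYPE('a)" using assms(3) by (simp add: ridge_profiles_def)
  obtain \<delta> t where c: "(forward_diff \<delta> ^^ length ls) \<sigma> t \<noteq> 0" (is "?c \<noteq> 0")
    using activation_forward_diff[OF assms(1,2)] by blast
  \<comment> \<open>Weight \<open>0\<close> and bias \<open>t\<close> freeze the profile at a point
    where the iterated difference does not vanish.\<close>
  have "(\<lambda>x. affine_prod ls x * ?c) \<in> Ck_closure 0 (shallow \<sigma>)"
    using affine_prod_forward_diff_closure[OF \<sigma>, of ls \<delta> 0 t] by simp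
  from Ck_closure_shallow_scaleR[OF this, of "1 / ?c"] show ?thesis using c by simp
qed

lemma polynomial_closure:
  assumes "bounded (range \<sigma>)" "\<not> \<sigma> constant_on UNIV" "continuous_on UNIV \<sigma>"
    and "real_polynomial_function (p :: 'a::euclidean_space \<Rightarrow> real)"
  shows "p \<in> Ck_closure 0 (shallow \<sigma>)"
proof -
  \<comment> \<open>The closure is not known to be stable under products, so the induction carries a
    further factor \<open>u\<close>; for a product of polynomials the two hypotheses are then
    applied one after the other.\<close>
  have *: "(\<lambda>x. affine_prod ls x * (p x * u x)) \<in> Ck_closure 0 (shallow \<sigma>)"
    if "\<And>ls. (\<lambda>x. affine_prod ls x * u x) \<in> Ck_closure 0 (shallow \<sigma>)" for u ls
    using assms(4) that
  proof (induction arbitrary: ls u)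
    case (linear f)
    obtain w where w: "f = (\<lambda>x. w \<bullet> x)"
    proof -
      have "f x = (\<Sum>b\<in>Basis. f b *\<^sub>R b) \<bullet> x" for x
        unfolding linear_expand_Basis[OF bounded_linear.linear[OF linear(1)], of x] inner_sum_left
        by (intro sum.cong) (simp_all add: inner_commute mult.commute)
      then show thesis using that by blast
    qed
    from linear(2)[of "(w, 0) # ls"] show ?case by (simp add: w mult_ac)
  next
    case (const c)
    from Ck_closure_shallow_scaleR[OF const(1)[of ls], of c] show ?case by (simp add: mult_ac)
  next
    case (add f g)
    from Ck_closure_shallow_add[OF add.IH(1)[OF add.prems, of ls] add.IH(2)[OF add.prems, of ls]]
    show ?case by (simp add: algebra_simps)
  next
    case (mult f g)
    from mult.IH(1)[OF mult.IH(2)[OF mult.prems], of ls] show ?case by (simp add: mult_ac)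
  qed
  have "(\<lambda>x. affine_prod [] x * (p x * 1)) \<in> Ck_closure 0 (shallow \<sigma>)"
    by (rule *) (simp add: affine_prod_closure[OF assms(1-3)])
  then show ?thesis by simp
qed

theorem shallow_dense_continuous:
  assumes "bounded (range \<sigma>)" "\<not> \<sigma> constant_on UNIV" "continuous_on UNIV \<sigma>"
    and "compact K" "continuous_on K f" "0 < e"
  obtains g where "g \<in> shallow \<sigma>" "\<forall>x\<in>K. \<bar>(f :: 'a::euclidean_space \<Rightarrow> real) x - g x\<bar> \<le> e"
proof -
  obtain p where p: "real_polynomial_function p" "\<And>x. x \<in> K \<Longrightarrow> \<bar>f x - p x\<bar> < e / 2"
    using Stone_Weierstrass_real_polynomial_function[OF assms(4,5), of "e / 2"] \<open>0 < e\<close> by auto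
  obtain R where R: "K \<subseteq> ball 0 R" using compact_imp_bounded[OF assms(4)] bounded_subset_ballD by blast
  obtain g where g: "g \<in> shallow \<sigma>" "Ck_small 0 (ball 0 R) (e / 2) (\<lambda>x. p x - g x)"
    using Ck_closureD[OF polynomial_closure[OF assms(1-3) p(1)], of "e / 2" R] \<open>0 < e\<close> by auto
  have "\<bar>f x - g x\<bar> \<le> e" if "x \<in> K" for x
  proof -
    have "\<bar>p x - g x\<bar> \<le> e / 2" using Ck_small_bound[OF g(2), of x] R that by auto
    then show ?thesis using p(2)[OF that] by linarith
  qed
  with g(1) that show thesis by blast
qed

section \<open>Density in higher norms by averaging\<close>

lemma Ck_SucD:
  assumes "Ck (Suc k) U f"
  shows "\<exists>f'. (\<forall>x\<in>U. (f has_derivative f' x) (at x)) \<and> (\<forall>b\<in>Basis. Ck k U (\<lambda>x. f' x b))"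
proof -
  from Ck_family_SucD[OF assms] obtain f' where
    f': "\<forall>p\<in>{0::real}. \<forall>x\<in>U. (f has_derivative f' p x) (at x)"
      "\<forall>b\<in>Basis. Ck_family k {0::real} U (\<lambda>p x. f' p x b)"
    by (elim exE conjE)
  have "Ck k U (\<lambda>x. f' 0 x b)" if "b \<in> Basis" for b
    using Ck_family_reindex[OF continuous_on_const _ bspec[OF f'(2) that], of 0 "{0}"] by simp
  with f'(1) show ?thesis by (intro exI[of _ "f' 0"]) simp
qed

text \<open>Averaging over a segment of length \<open>\<delta>\<close> needs values at distance up
  to \<open>\<delta>\<close>; the radii \<open>r + n * \<delta>\<close> in the following lemmas
  count the averagings still to come.\<close>

definition nbhd :: "'a::euclidean_space set \<Rightarrow> real \<Rightarrow> 'a set" where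
  "nbhd K r = (\<Union>x\<in>K. ball x r)"

lemma open_nbhd: "open (nbhd K r)"
  by (auto simp: nbhd_def)

lemma nbhd_mono: "r \<le> r' \<Longrightarrow> nbhd K r \<subseteq> nbhd K r'"
  by (force simp: nbhd_def)

lemma subset_nbhd: "0 < r \<Longrightarrow> K \<subseteq> nbhd K r"
  by (force simp: nbhd_def)

lemma nbhd_shift:
  assumes "x \<in> nbhd K r" "norm v \<le> \<delta>"
  shows "x + v \<in> nbhd K (r + \<delta>)"
proof -
  obtain y where y: "y \<in> K" "dist y x < r" using assms by (auto simp: nbhd_def)
  have "dist y (x + v) \<le> dist y x + norm v"
    using dist_triangle[of y "x + v" x] by (simp add: dist_norm)
  with y assms show ?thesis by (auto simp: nbhd_def intro!: bexI[of _ y])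
qed

lemma nbhd_shift_direction:
  assumes "x \<in> nbhd K r" "norm b \<le> 1" "0 \<le> \<delta>" "\<delta> \<le> \<delta>'" "s \<in> {0..1}"
  shows "x + (\<delta> * s) *\<^sub>R b \<in> nbhd K (r + \<delta>')"
proof (rule nbhd_shift[OF assms(1)])
  have "(\<delta> * s) * norm b \<le> \<delta> * 1" using assms by (intro mult_mono) (auto simp: mult_left_le)
  then show "norm ((\<delta> * s) *\<^sub>R b) \<le> \<delta>'" using assms by (simp add: abs_mult)
qed

section \<open>Directional averages\<close>

definition avg :: "real \<Rightarrow> 'a::euclidean_space \<Rightarrow> ('a \<Rightarrow> 'b::euclidean_space) \<Rightarrow> 'a \<Rightarrow> 'b" where
  "avg \<delta> b h x = integral {0..1} (\<lambda>s. h (x + (\<delta> * s) *\<^sub>R b))"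

definition avgs :: "real \<Rightarrow> 'a::euclidean_space list \<Rightarrow> ('a \<Rightarrow> 'b::euclidean_space) \<Rightarrow> 'a \<Rightarrow> 'b" where
  "avgs \<delta> bs h = foldr (avg \<delta>) bs h"

lemma avgs_simps [simp]: "avgs \<delta> [] h = h" "avgs \<delta> (b # bs) h = avg \<delta> b (avgs \<delta> bs h)"
  by (simp_all add: avgs_def)

lemma avgs_append: "avgs \<delta> (bs @ cs) h = avgs \<delta> bs (avgs \<delta> cs h)"
  by (simp add: avgs_def)

lemma avgs_0: "avgs 0 bs h = h"
  by (induction bs) (auto simp: avg_def)

lemma avg_Ck_family:
  assumes "Ck_family k {0..\<delta>'} (nbhd K (r + \<delta>')) F" "norm b \<le> 1"
  shows "Ck_family k {0..\<delta>'} (nbhd K r) (\<lambda>\<delta>. avg \<delta> b (F \<delta>))"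
proof -
  have "Ck_family k ({0..\<delta>'} \<times> {0..1}) (nbhd K r) (\<lambda>p x. F (fst p) (x + (fst p * snd p) *\<^sub>R b))"
  proof (rule Ck_family_compose[where g = "\<lambda>p. F (fst p)" and V = "nbhd K (r + \<delta>')", OF _ _ _ open_nbhd])
    show "Ck_family k ({0..\<delta>'} \<times> {0..1}) (nbhd K (r + \<delta>')) (\<lambda>p. F (fst p))"
      by (rule Ck_family_reindex[OF _ _ assms(1)]) (auto intro!: continuous_intros)
    show "Ck_family k ({0..\<delta>'} \<times> {0..1}) (nbhd K r) (\<lambda>p x. x + (fst p * snd p) *\<^sub>R b)"
      by (intro Ck_family_add Ck_family_ident Ck_family_param continuous_intros)
    show "x + (fst p * snd p) *\<^sub>R b \<in> nbhd K (r + \<delta>')" if "p \<in> {0..\<delta>'} \<times> {0..1}" "x \<in> nbhd K r" for p x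
      using that assms(2) by (intro nbhd_shift_direction) auto
  qed
  from Ck_family_integral[OF open_nbhd this] show ?thesis by (simp add: avg_def[abs_def])
qed

text \<open>The averaging length is a parameter that ranges down to \<open>0\<close>, where
  averaging is the identity by \<open>avgs_0\<close>. For a constant family this yields convergence
  of the averages to the function itself, in all derivatives up to order \<open>k\<close>.\<close>

lemma avgs_Ck_family:
  assumes "Ck_family k {0..\<delta>'} (nbhd K (r + real (length bs) * \<delta>')) F" "set bs \<subseteq> Basis"
  shows "Ck_family k {0..\<delta>'} (nbhd K r) (\<lambda>\<delta>. avgs \<delta> bs (F \<delta>))"
  using assms
proof (induction bs arbitrary: r)
  case (Cons b bs)
  have "r + real (length (b # bs)) * \<delta>' = (r + \<delta>') + real (length bs) * \<delta>'" by (simp add: algebra_simps)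
  from Cons.IH[OF Cons.prems(1)[unfolded this]] Cons.prems(2)
  have "Ck_family k {0..\<delta>'} (nbhd K (r + \<delta>')) (\<lambda>\<delta>. avgs \<delta> bs (F \<delta>))"
    by simp
  from avg_Ck_family[OF this] Cons.prems show ?case by simp
qed simp

lemma avgs_Ck:
  assumes "Ck k (nbhd K (r + real (length bs) * \<delta>)) h" "set bs \<subseteq> Basis" "0 \<le> \<delta>"
  shows "Ck k (nbhd K r) (avgs \<delta> bs h)"
  using Ck_family_reindex[OF _ _ avgs_Ck_family[OF Ck_imp_Ck_family[OF assms(1)] assms(2)], of "{0}" "\<lambda>_. \<delta>"]
    assms(3) by simp

lemma Ck_continuous_on: "Ck k U f \<Longrightarrow> continuous_on U f"
  using Ck_family_continuous_compose[of k "{0}" U "\<lambda>_. f" U "\<lambda>_. 0" "\<lambda>x. x"] by simp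

lemma avg_continuous:
  assumes "continuous_on (nbhd K (r + \<delta>)) h" "norm b \<le> 1" "0 \<le> \<delta>" "x \<in> nbhd K r"
  shows "continuous_on {0..1} (\<lambda>s. h (x + (\<delta> * s) *\<^sub>R b))"
  by (rule continuous_on_compose2[OF assms(1)])
    (use assms in \<open>auto intro!: continuous_intros nbhd_shift_direction\<close>)

lemma avg_bound:
  assumes "continuous_on (nbhd K (r + \<delta>)) h" "norm b \<le> 1" "0 \<le> \<delta>" "x \<in> nbhd K r"
    and "\<And>y. y \<in> nbhd K (r + \<delta>) \<Longrightarrow> norm (h y) \<le> C"
  shows "norm (avg \<delta> b h x) \<le> C"
proof -
  have "norm (integral {0..1} (\<lambda>s. h (x + (\<delta> * s) *\<^sub>R b))) \<le> integral {0..1} (\<lambda>s::real. C)"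
    using assms
    by (intro integral_norm_bound_integral integrable_continuous_interval avg_continuous)
      (auto intro!: nbhd_shift_direction assms(5))
  then show ?thesis by (simp add: avg_def)
qed

lemma avgs_bound:
  assumes "Ck 0 (nbhd K (r + real (length bs) * \<delta>)) h" "set bs \<subseteq> Basis" "0 \<le> \<delta>" "x \<in> nbhd K r"
    and "\<And>y. y \<in> nbhd K (r + real (length bs) * \<delta>) \<Longrightarrow> norm (h y) \<le> C"
  shows "norm (avgs \<delta> bs h x) \<le> C"
  using assms
proof (induction bs arbitrary: r x)
  case (Cons b bs)
  have eq: "r + real (length (b # bs)) * \<delta> = (r + \<delta>) + real (length bs) * \<delta>" by (simp add: algebra_simps)
  have h: "Ck 0 (nbhd K ((r + \<delta>) + real (length bs) * \<delta>)) h" using Cons.prems(1) unfolding eq .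
  have "continuous_on (nbhd K (r + \<delta>)) (avgs \<delta> bs h)"
    by (rule Ck_continuous_on[OF avgs_Ck[OF h _ Cons.prems(3)]]) (use Cons.prems(2) in auto)
  moreover have "norm (avgs \<delta> bs h y) \<le> C" if "y \<in> nbhd K (r + \<delta>)" for y
    using Cons.IH[OF h _ Cons.prems(3) that] Cons.prems(2,5) unfolding eq by auto
  ultimately show ?case using Cons.prems by (auto intro!: avg_bound[where K = K and r = r])
qed simp

lemma avg_diff:
  assumes "continuous_on (nbhd K (r + \<delta>)) f" "continuous_on (nbhd K (r + \<delta>)) g"
    "norm b \<le> 1" "0 \<le> \<delta>" "x \<in> nbhd K r"
  shows "avg \<delta> b (\<lambda>x. f x - g x) x = avg \<delta> b f x - avg \<delta> b g x"
  unfolding avg_def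
  by (intro integral_diff integrable_continuous_interval avg_continuous[OF assms(1,3-)] avg_continuous[OF assms(2,3-)])

lemma avg_cong:
  assumes "norm b \<le> 1" "0 \<le> \<delta>" "x \<in> nbhd K r" "\<And>y. y \<in> nbhd K (r + \<delta>) \<Longrightarrow> f y = g y"
  shows "avg \<delta> b f x = avg \<delta> b g x"
  unfolding avg_def by (intro integral_cong assms(4) nbhd_shift_direction assms) auto

lemma avgs_diff:
  assumes "Ck 0 (nbhd K (r + real (length bs) * \<delta>)) f" "Ck 0 (nbhd K (r + real (length bs) * \<delta>)) g"
    "set bs \<subseteq> Basis" "0 \<le> \<delta>" "x \<in> nbhd K r"
  shows "avgs \<delta> bs (\<lambda>x. f x - g x) x = avgs \<delta> bs f x - avgs \<delta> bs g x"
  using assms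
proof (induction bs arbitrary: r x)
  case (Cons b bs)
  have eq: "r + real (length (b # bs)) * \<delta> = (r + \<delta>) + real (length bs) * \<delta>" by (simp add: algebra_simps)
  note f = Cons.prems(1)[unfolded eq] and g = Cons.prems(2)[unfolded eq]
  have bs: "set bs \<subseteq> Basis" "norm b \<le> 1" using Cons.prems(3) by auto
  have "avg \<delta> b (avgs \<delta> bs (\<lambda>x. f x - g x)) x = avg \<delta> b (\<lambda>x. avgs \<delta> bs f x - avgs \<delta> bs g x) x"
    by (rule avg_cong[OF bs(2) Cons.prems(4,5)]) (rule Cons.IH[OF f g bs(1) Cons.prems(4)])
  also have "\<dots> = avg \<delta> b (avgs \<delta> bs f) x - avg \<delta> b (avgs \<delta> bs g) x"
    by (rule avg_diff[OF Ck_continuous_on[OF avgs_Ck[OF f bs(1) Cons.prems(4)]]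
          Ck_continuous_on[OF avgs_Ck[OF g bs(1) Cons.prems(4)]] bs(2) Cons.prems(4,5)])
  finally show ?case by simp
qed simp

lemma avg_has_derivative:
  assumes h: "Ck 0 (nbhd K (r + \<delta>)) h"
    and h': "\<And>y. y \<in> nbhd K (r + \<delta>) \<Longrightarrow> (h has_derivative h' y) (at y)"
    and h'_cont: "\<And>c. c \<in> Basis \<Longrightarrow> Ck 0 (nbhd K (r + \<delta>)) (\<lambda>y. h' y c)"
    and b: "norm b \<le> 1" "0 \<le> \<delta>" and x: "x \<in> nbhd K r"
  shows "(avg \<delta> b h has_derivative (\<lambda>v. avg \<delta> b (\<lambda>y. h' y v) x)) (at x)"
  unfolding avg_def[abs_def]
proof (rule has_derivative_integral_param[OF open_nbhd[of K r] _ _ _ x])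
  have c: "continuous_on ({0..1} \<times> nbhd K r) (\<lambda>(s, x). g (x + (\<delta> * s) *\<^sub>R b))"
    if "Ck 0 (nbhd K (r + \<delta>)) g" for g :: "'a \<Rightarrow> 'b"
    unfolding split_beta
    by (rule continuous_on_compose2[OF Ck_continuous_on[OF that]])
      (use b in \<open>auto intro!: continuous_intros nbhd_shift_direction\<close>)
  show "continuous_on ({0..1} \<times> nbhd K r) (\<lambda>(s, x). h (x + (\<delta> * s) *\<^sub>R b))" by (rule c[OF h])
  show "continuous_on ({0..1} \<times> nbhd K r) (\<lambda>(s, x). h' (x + (\<delta> * s) *\<^sub>R b) d)" if "d \<in> Basis" for d
    by (rule c[OF h'_cont[OF that]])
  fix s :: real and y assume "s \<in> {0..1}" "y \<in> nbhd K r"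
  then have mem: "y + (\<delta> * s) *\<^sub>R b \<in> nbhd K (r + \<delta>)" using b by (intro nbhd_shift_direction) auto
  have "((\<lambda>y. y + (\<delta> * s) *\<^sub>R b) has_derivative (\<lambda>v. v)) (at y)"
    by (auto intro!: derivative_eq_intros)
  from has_derivative_compose[OF this h'[OF mem]]
  show "((\<lambda>y. h (y + (\<delta> * s) *\<^sub>R b)) has_derivative h' (y + (\<delta> * s) *\<^sub>R b)) (at y)" .
qed

lemma avgs_has_derivative:
  assumes "Ck 0 (nbhd K (r + real (length bs) * \<delta>)) h"
    and "\<And>y. y \<in> nbhd K (r + real (length bs) * \<delta>) \<Longrightarrow> (h has_derivative h' y) (at y)"
    and "\<And>c. c \<in> Basis \<Longrightarrow> Ck 0 (nbhd K (r + real (length bs) * \<delta>)) (\<lambda>y. h' y c)"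
    and "set bs \<subseteq> Basis" "0 \<le> \<delta>" "x \<in> nbhd K r"
  shows "(avgs \<delta> bs h has_derivative (\<lambda>v. avgs \<delta> bs (\<lambda>y. h' y v) x)) (at x)"
  using assms
proof (induction bs arbitrary: r x)
  case (Cons b bs)
  have eq: "r + real (length (b # bs)) * \<delta> = (r + \<delta>) + real (length bs) * \<delta>" by (simp add: algebra_simps)
  note h = Cons.prems(1-3)[unfolded eq]
  have bs: "set bs \<subseteq> Basis" "norm b \<le> 1" using Cons.prems(4) by auto
  have "(avg \<delta> b (avgs \<delta> bs h) has_derivative (\<lambda>v. avg \<delta> b (\<lambda>y. avgs \<delta> bs (\<lambda>y. h' y v) y) x)) (at x)"
    by (rule avg_has_derivative[OF avgs_Ck[OF h(1) bs(1) Cons.prems(5)] Cons.IH[OF h bs(1) Cons.prems(5)]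
          avgs_Ck[OF h(3) bs(1) Cons.prems(5)] bs(2) Cons.prems(5,6)])
  then show ?case by simp
qed simp

lemma avg_derivative_direction:
  assumes u': "\<And>y. y \<in> nbhd K (r + \<delta>) \<Longrightarrow> (u has_derivative u' y) (at y)"
    and b: "norm b \<le> 1" "0 < \<delta>" and x: "x \<in> nbhd K r"
  shows "avg \<delta> b (\<lambda>y. u' y b) x = (1 / \<delta>) *\<^sub>R (u (x + \<delta> *\<^sub>R b) - u x)"
proof -
  have "((\<lambda>s. u' (x + (\<delta> * s) *\<^sub>R b) b) has_integral
    ((1 / \<delta>) *\<^sub>R u (x + (\<delta> * 1) *\<^sub>R b) - (1 / \<delta>) *\<^sub>R u (x + (\<delta> * 0) *\<^sub>R b))) {0..1}"
  proof (rule fundamental_theorem_of_calculus)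
    fix s :: real assume "s \<in> {0..1}"
    then have y: "x + (\<delta> * s) *\<^sub>R b \<in> nbhd K (r + \<delta>)" (is "?y \<in> _") using b x by (intro nbhd_shift_direction) auto
    have "((\<lambda>s. x + (\<delta> * s) *\<^sub>R b) has_derivative (\<lambda>r. (\<delta> * r) *\<^sub>R b)) (at s within {0..1})"
      by (auto intro!: derivative_eq_intros)
    from has_derivative_compose[OF this u'[OF y]]
    have "((\<lambda>s. (1 / \<delta>) *\<^sub>R u (x + (\<delta> * s) *\<^sub>R b)) has_derivative (\<lambda>r. (1 / \<delta>) *\<^sub>R u' ?y ((\<delta> * r) *\<^sub>R b))) (at s within {0..1})"
      by (rule has_derivative_scaleR_right)
    moreover have "(1 / \<delta>) *\<^sub>R u' ?y ((\<delta> * r) *\<^sub>R b) = r *\<^sub>R u' ?y b" for r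
      using b(2) has_derivative_linear[OF u'[OF y]] by (simp add: linear_scale)
    ultimately show "((\<lambda>s. (1 / \<delta>) *\<^sub>R u (x + (\<delta> * s) *\<^sub>R b)) has_vector_derivative u' ?y b) (at s within {0..1})"
      by (simp add: has_vector_derivative_def)
  qed simp
  from integral_unique[OF this] show ?thesis by (simp add: avg_def scaleR_diff_right)
qed

text \<open>One averaging in direction \<open>b\<close> turns the derivative into a difference
  quotient of size at most \<open>2 / \<delta> * C\<close>; the other averagings do not increase
  uniform bounds, wherever they stand in the list.\<close>

lemma avgs_derivative_bound:
  assumes "Ck 0 (nbhd K (r + real (length bs) * \<delta>)) h"
    and "\<And>y. y \<in> nbhd K (r + real (length bs) * \<delta>) \<Longrightarrow> (h has_derivative h' y) (at y)"
    and "\<And>c. c \<in> Basis \<Longrightarrow> Ck 0 (nbhd K (r + real (length bs) * \<delta>)) (\<lambda>y. h' y c)"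
    and "set bs \<subseteq> Basis" "0 < \<delta>" "x \<in> nbhd K r" "b \<in> set bs"
    and "\<And>y. y \<in> nbhd K (r + real (length bs) * \<delta>) \<Longrightarrow> norm (h y) \<le> C"
  shows "norm (avgs \<delta> bs (\<lambda>y. h' y b) x) \<le> 2 / \<delta> * C"
  using assms
proof (induction bs arbitrary: r x)
  case (Cons c bs)
  have eq: "r + real (length (c # bs)) * \<delta> = (r + \<delta>) + real (length bs) * \<delta>" by (simp add: algebra_simps)
  note h = Cons.prems(1-3)[unfolded eq]
  have bs: "set bs \<subseteq> Basis" "norm c \<le> 1" "0 \<le> \<delta>" "b \<in> Basis" using Cons.prems by auto
  show ?case
  proof (cases "c = b")
    case True
    have "(avgs \<delta> bs h has_derivative (\<lambda>v. avgs \<delta> bs (\<lambda>y. h' y v) y)) (at y)" if "y \<in> nbhd K (r + \<delta>)" for y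
      by (rule avgs_has_derivative[OF h bs(1,3) that])
    from avg_derivative_direction[OF this bs(2) \<open>0 < \<delta>\<close> Cons.prems(6)]
    have "avgs \<delta> (c # bs) (\<lambda>y. h' y b) x = (1 / \<delta>) *\<^sub>R (avgs \<delta> bs h (x + \<delta> *\<^sub>R c) - avgs \<delta> bs h x)"
      using True by simp
    also have "norm \<dots> \<le> 1 / \<delta> * (C + C)"
    proof -
      have "x + \<delta> *\<^sub>R c \<in> nbhd K (r + \<delta>)" "x \<in> nbhd K (r + \<delta>)"
        using nbhd_shift_direction[OF Cons.prems(6) bs(2,3) order_refl, of 1]
          nbhd_mono[of r "r + \<delta>" K] Cons.prems(6) \<open>0 < \<delta>\<close> by auto
      then have "norm (avgs \<delta> bs h (x + \<delta> *\<^sub>R c)) \<le> C" "norm (avgs \<delta> bs h x) \<le> C"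
        using avgs_bound[OF h(1) bs(1,3), of _ C] Cons.prems(8) unfolding eq by auto
      then have "norm (avgs \<delta> bs h (x + \<delta> *\<^sub>R c) - avgs \<delta> bs h x) \<le> C + C"
        using norm_triangle_ineq4 by (rule order_trans[rotated, OF add_mono])
      then have "1 / \<delta> * norm (avgs \<delta> bs h (x + \<delta> *\<^sub>R c) - avgs \<delta> bs h x) \<le> 1 / \<delta> * (C + C)"
        using \<open>0 < \<delta>\<close> by (intro mult_left_mono) auto
      then show ?thesis using \<open>0 < \<delta>\<close> by simp
    qed
    finally show ?thesis by simp
  next
    case False
    then have b: "b \<in> set bs" using Cons.prems(7) by simp
    have "norm (avg \<delta> c (avgs \<delta> bs (\<lambda>y. h' y b)) x) \<le> 2 / \<delta> * C"
    proof (rule avg_bound[OF _ bs(2,3) Cons.prems(6)])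
      show "continuous_on (nbhd K (r + \<delta>)) (avgs \<delta> bs (\<lambda>y. h' y b))"
        by (rule Ck_continuous_on[OF avgs_Ck[OF h(3)[OF bs(4)] bs(1,3)]])
      show "norm (avgs \<delta> bs (\<lambda>y. h' y b) y) \<le> 2 / \<delta> * C" if "y \<in> nbhd K (r + \<delta>)" for y
        using Cons.IH[OF h bs(1) \<open>0 < \<delta>\<close> that b] Cons.prems(8) unfolding eq by auto
    qed
    then show ?thesis by simp
  qed
qed simp

text \<open>Each averaging in direction \<open>b\<close> turns \<open>\<partial>\<^sub>b\<close> into a difference quotient, so a uniform bound on \<open>h\<close>
  controls the first \<open>k\<close> derivatives after \<open>k\<close> rounds of averaging.\<close>

lemma avgs_Ck_small:
  assumes "Ck k (nbhd K (r + real (k * length bs) * \<delta>)) h" "set bs = Basis" "0 < \<delta>" "\<delta> \<le> 2" "0 \<le> C"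
    and "\<And>y. y \<in> nbhd K (r + real (k * length bs) * \<delta>) \<Longrightarrow> norm (h y) \<le> C"
  shows "Ck_small k (nbhd K r) ((2 / \<delta>) ^ k * C) (avgs \<delta> (concat (replicate k bs)) h)"
  using assms
proof (induction k arbitrary: h C)
  case 0
  then show ?case by simp
next
  case (Suc k)
  let ?L = "concat (replicate k bs)"
  have repl: "concat (replicate (Suc k) bs) = ?L @ bs"
    by (induction k) auto
  have len: "length ?L = k * length bs" by (induction k) auto
  define n where "n = r + real (k * length bs) * \<delta>"
  have eq: "r + real (Suc k * length bs) * \<delta> = n + real (length bs) * \<delta>"
    "r + real (length (?L @ bs)) * \<delta> = n + real (length bs) * \<delta>"
    by (simp_all add: n_def len algebra_simps)
  note hk = Suc.prems(1)[unfolded eq(1)]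
  have bsB: "set bs \<subseteq> Basis" "set (?L @ bs) \<subseteq> Basis" using Suc.prems(2) by auto
  have \<delta>: "0 \<le> \<delta>" using Suc.prems by simp
  obtain h' where h': "\<And>x. x \<in> nbhd K (n + real (length bs) * \<delta>) \<Longrightarrow> (h has_derivative h' x) (at x)"
    "\<And>b. b \<in> Basis \<Longrightarrow> Ck k (nbhd K (n + real (length bs) * \<delta>)) (\<lambda>x. h' x b)"
    using Ck_SucD[OF hk] by blast
  have h0: "Ck 0 (nbhd K (n + real (length bs) * \<delta>)) h" by (rule Ck_family_le[OF hk]) simp
  have h'0: "Ck 0 (nbhd K (n + real (length bs) * \<delta>)) (\<lambda>x. h' x b)" if "b \<in> Basis" for b
    by (rule Ck_family_le[OF h'(2)[OF that]]) simp
  have hC: "norm (h y) \<le> C" if "y \<in> nbhd K (n + real (length bs) * \<delta>)" for y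
    using Suc.prems(6) that unfolding eq by blast
  \<comment> \<open>Since \<open>\<delta> \<le> 2\<close>, the bound for the highest order also
    covers the lower ones.\<close>
  have one: "1 \<le> 2 / \<delta>" using Suc.prems by simp
  show ?case
    unfolding repl
  proof (rule Ck_small_SucI[where h' = "\<lambda>x v. avgs \<delta> (?L @ bs) (\<lambda>y. h' y v) x"])
    fix x assume x: "x \<in> nbhd K r"
    have "norm (avgs \<delta> (?L @ bs) h x) \<le> C"
      by (rule avgs_bound[OF _ bsB(2) \<delta> x]; unfold eq; rule h0 hC)
    also have "C \<le> (2 / \<delta>) ^ Suc k * C"
      using mult_right_mono[OF one_le_power[OF one] \<open>0 \<le> C\<close>, of "Suc k"] by simp
    finally show "norm (avgs \<delta> (?L @ bs) h x) \<le> (2 / \<delta>) ^ Suc k * C" .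
    show "(avgs \<delta> (?L @ bs) h has_derivative (\<lambda>v. avgs \<delta> (?L @ bs) (\<lambda>y. h' y v) x)) (at x)"
      by (rule avgs_has_derivative[OF _ _ _ bsB(2) \<delta> x]; unfold eq; rule h0 h'(1) h'0; assumption)
  next
    fix b :: 'a assume b: "b \<in> Basis"
    \<comment> \<open>The innermost round \<open>bs\<close> absorbs the derivative in direction
      \<open>b\<close> at the price of a factor \<open>2 / \<delta>\<close>; the outer
      \<open>k\<close> rounds remain for the induction hypothesis.\<close>
    have "Ck_small k (nbhd K r) ((2 / \<delta>) ^ k * (2 / \<delta> * C)) (avgs \<delta> ?L (avgs \<delta> bs (\<lambda>y. h' y b)))"
    proof (rule Suc.IH)
      show "Ck k (nbhd K (r + real (k * length bs) * \<delta>)) (avgs \<delta> bs (\<lambda>y. h' y b))"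
        unfolding n_def[symmetric] by (rule avgs_Ck[OF h'(2)[OF b] bsB(1) \<delta>])
      show "norm (avgs \<delta> bs (\<lambda>y. h' y b) y) \<le> 2 / \<delta> * C" if "y \<in> nbhd K (r + real (k * length bs) * \<delta>)" for y
        by (rule avgs_derivative_bound[OF h0 h'(1) h'0 bsB(1) \<open>0 < \<delta>\<close> _ _ hC])
          (use b Suc.prems(2) that in \<open>auto simp: n_def\<close>)
    qed (use Suc.prems in auto)
    then show "Ck_small k (nbhd K r) ((2 / \<delta>) ^ Suc k * C) (\<lambda>x. avgs \<delta> (?L @ bs) (\<lambda>y. h' y b) x)"
      by (simp add: avgs_append mult_ac)
  qed
qed

section \<open>Shallow networks in higher norms\<close>

lemma shallow_avgs_closure:
  assumes \<sigma>: "Ck k UNIV \<sigma>" and g: "g \<in> shallow \<sigma>"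
  shows "avgs \<delta> bs g \<in> Ck_closure k (shallow \<sigma>)"
proof -
  \<comment> \<open>All translates are treated together because the next averaging integrates over
    translates; smoothness is carried along for the Riemann sums.\<close>
  have "Ck k UNIV (avgs \<delta> bs g) \<and> (\<forall>v. (\<lambda>x. avgs \<delta> bs g (x + v)) \<in> Ck_closure k (shallow \<sigma>))"
  proof (induction bs)
    case Nil
    show ?case using shallow_Ck[OF \<sigma> g] Ck_closure_mem[OF shallow_translate[OF g]] by auto
  next
    case (Cons b bs)
    let ?u = "avgs \<delta> bs g"
    have shift: "Ck_family k P UNIV (\<lambda>p x. ?u (x + c p))" if "continuous_on P c" for P :: "real set" and c
      by (rule Ck_family_compose[OF Ck_imp_Ck_family[OF Cons.IH[THEN conjunct1]]
            Ck_family_add[OF Ck_family_ident Ck_family_param[OF that]]]) auto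
    have "Ck k UNIV (\<lambda>x. integral {0..1} (\<lambda>s. ?u (x + (\<delta> * s) *\<^sub>R b)))"
    proof (rule Ck_family_integral[OF open_UNIV, where f = "\<lambda>p x. ?u (x + (\<delta> * snd p) *\<^sub>R b)" and P = "{0::real}", simplified])
      have "Ck_family k {0..1} UNIV (\<lambda>s x. ?u (x + (\<delta> * s) *\<^sub>R b))"
        by (rule shift) (auto intro!: continuous_intros)
      then show "Ck_family k ({0::real} \<times> {0..1}) UNIV (\<lambda>p x. ?u (x + (\<delta> * snd p) *\<^sub>R b))"
        by (rule Ck_family_reindex[where \<pi> = snd, rotated 2]) (auto intro!: continuous_intros)
    qed
    moreover have "(\<lambda>x. integral {0..1} (\<lambda>s. ?u (x + v + (\<delta> * s) *\<^sub>R b))) \<in> Ck_closure k (shallow \<sigma>)" for v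
    proof (rule Ck_closure_shallow_integral)
      show "Ck_family k {0..1} UNIV (\<lambda>s x. ?u (x + v + (\<delta> * s) *\<^sub>R b))"
        unfolding add.assoc by (rule shift) (auto intro!: continuous_intros)
      show "(\<lambda>x. ?u (x + v + (\<delta> * s) *\<^sub>R b)) \<in> Ck_closure k (shallow \<sigma>)" for s
        using Cons.IH by (simp add: add.assoc)
    qed
    ultimately show ?case by (simp add: avg_def[abs_def])
  qed
  then have "(\<lambda>x. avgs \<delta> bs g (x + 0)) \<in> Ck_closure k (shallow \<sigma>)" by (elim conjE allE)
  then show ?thesis by simp
qed

lemma compact_closed_nbhd:
  fixes K :: "'a::euclidean_space set"
  shows "compact K \<Longrightarrow> compact (\<Union>x\<in>K. cball x r)"
proof -
  assume "compact K"
  then have "compact {x + y | x y. x \<in> K \<and> y \<in> cball 0 r}" by (intro compact_sums compact_cball)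
  also have "{x + y | x y. x \<in> K \<and> y \<in> cball 0 r} = (\<Union>x\<in>K. cball x r)"
  proof (intro equalityI subsetI)
    fix z assume "z \<in> (\<Union>x\<in>K. cball x r)"
    then obtain x where "x \<in> K" "dist x z \<le> r" by auto
    then show "z \<in> {x + y | x y. x \<in> K \<and> y \<in> cball 0 r}"
      by (intro CollectI exI[of _ x] exI[of _ "z - x"]) (auto simp: dist_norm norm_minus_commute)
  next
    fix z assume "z \<in> {x + y | x y. x \<in> K \<and> y \<in> cball 0 r}"
    then obtain x y where "x \<in> K" "norm y \<le> r" "z = x + y" by auto
    then show "z \<in> (\<Union>x\<in>K. cball x r)" by (intro UN_I[of x]) (auto simp: dist_norm)
  qed
  finally show ?thesis .
qed

text \<open>Three errors of size \<open>e / 3\<close>: averaging \<open>f\<close>, exchanging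
  \<open>f\<close> for a uniformly close \<open>g\<close> under the averages, and exchanging the
  averages of \<open>g\<close> for a network. The second is amplified by
  \<open>(2 / \<delta>) ^ k\<close>, so \<open>\<delta>\<close> must be fixed before
  \<open>g\<close> is chosen.\<close>

theorem shallow_dense_real:
  fixes f :: "'a::euclidean_space \<Rightarrow> real"
  assumes \<sigma>: "bounded (range \<sigma>)" "\<not> \<sigma> constant_on UNIV" "Ck k UNIV \<sigma>"
    and "open U" and f: "Ck k U f" and "compact K" "K \<subseteq> U" "0 < e"
  obtains g \<rho> where "g \<in> shallow \<sigma>" "0 < \<rho>" "nbhd K \<rho> \<subseteq> U" "Ck_small k (nbhd K \<rho>) e (\<lambda>x. f x - g x)"
proof -
  obtain \<rho> where \<rho>: "\<rho> > 0" "(\<Union>x\<in>K. cball x \<rho>) \<subseteq> U"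
    using compact_subset_open_imp_cball_epsilon_subset[OF \<open>compact K\<close> \<open>open U\<close> \<open>K \<subseteq> U\<close>] by blast
  have cb: "nbhd K s \<subseteq> (\<Union>x\<in>K. cball x s)" for s by (auto simp: nbhd_def)
  have \<rho>U: "nbhd K \<rho> \<subseteq> U" using \<rho>(2) cb by blast
  obtain bs :: "'a list" where bs: "set bs = Basis" using finite_list[OF finite_Basis] by blast
  define L where "L = concat (replicate k bs)"
  have L: "set L \<subseteq> Basis" "length L = k * length bs"
    using bs by (auto simp: L_def length_concat sum_list_replicate)
  \<comment> \<open>All averagings together displace a point by at most \<open>\<rho> / 4\<close>,
    which keeps them inside \<open>U\<close>; the cap \<open>2\<close> is the bound on
    \<open>\<delta>\<close> in \<open>avgs_Ck_small\<close>.\<close>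
  define \<delta>' where "\<delta>' = min 2 (\<rho> / (4 * (real (length L) + 1)))"
  have \<delta>': "0 < \<delta>'" "\<delta>' \<le> 2" using \<rho> by (auto simp: \<delta>'_def)
  have L\<delta>: "real (length L) * \<delta> \<le> \<rho> / 4" if "\<delta> \<le> \<delta>'" for \<delta>
  proof -
    have "real (length L) * \<delta> \<le> (real (length L) + 1) * (\<rho> / (4 * (real (length L) + 1)))"
      using that \<rho> by (intro order_trans[OF mult_left_mono[of \<delta> "\<rho> / (4 * (real (length L) + 1))"]] mult_right_mono) (auto simp: \<delta>'_def)
    also have "\<dots> = \<rho> / 4" by (simp add: field_simps)
    finally show ?thesis .
  qed
  have "Ck_family k {0..\<delta>'} (nbhd K (\<rho> / 2)) (\<lambda>\<delta>. avgs \<delta> L f)"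
  proof (rule avgs_Ck_family[OF Ck_imp_Ck_family[OF Ck_family_subset[OF f]] L(1)])
    show "nbhd K (\<rho> / 2 + real (length L) * \<delta>') \<subseteq> U"
      using nbhd_mono[of "\<rho> / 2 + real (length L) * \<delta>'" \<rho> K] L\<delta>[of \<delta>'] \<rho> \<rho>U by auto
  qed simp
  note fam = this
  obtain d where d: "d > 0" "\<And>\<delta>. \<delta> \<in> {0..\<delta>'} \<Longrightarrow> dist \<delta> 0 < d \<Longrightarrow>
      Ck_small k (nbhd K (\<rho> / 4)) (e / 3) (\<lambda>x. avgs \<delta> L f x - f x)"
  proof -
    have "(\<Union>x\<in>K. cball x (\<rho> / 4)) \<subseteq> nbhd K (\<rho> / 2)" using \<rho> by (force simp: nbhd_def)
    from Ck_family_imp_Ck_small[OF fam _ compact_closed_nbhd[OF \<open>compact K\<close>] this cb, of 0 "e / 3"]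
    have "\<exists>d>0. \<forall>p\<in>{0..\<delta>'}. dist p 0 < d \<longrightarrow> Ck_small k (nbhd K (\<rho> / 4)) (e / 3) (\<lambda>x. avgs p L f x - f x)"
      using \<delta>' \<open>0 < e\<close> unfolding avgs_0 by simp
    then show thesis by (elim exE conjE) (rule that, auto)
  qed
  define \<delta> where "\<delta> = min \<delta>' (d / 2)"
  have \<delta>: "0 < \<delta>" "\<delta> \<le> 2" "\<delta> \<le> \<delta>'" "dist \<delta> 0 < d" using \<delta>' d by (auto simp: \<delta>_def)
  have 1: "Ck_small k (nbhd K (\<rho> / 4)) (e / 3) (\<lambda>x. avgs \<delta> L f x - f x)"
    using d(2)[of \<delta>] \<delta> by auto
  define C where "C = e / 3 / (2 / \<delta>) ^ k"
  have C: "0 < C" "(2 / \<delta>) ^ k * C = e / 3" using \<open>0 < e\<close> \<delta> by (auto simp: C_def)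
  have contf: "continuous_on (\<Union>x\<in>K. cball x \<rho>) f"
    by (rule continuous_on_subset[OF Ck_continuous_on[OF f] \<rho>(2)])
  obtain g where g: "g \<in> shallow \<sigma>" "\<And>x. x \<in> (\<Union>x\<in>K. cball x \<rho>) \<Longrightarrow> \<bar>f x - g x\<bar> \<le> C"
    by (rule shallow_dense_continuous[OF \<sigma>(1,2) Ck_continuous_on[OF \<sigma>(3)] compact_closed_nbhd[OF \<open>compact K\<close>] contf C(1)]) (rule that; blast)
  let ?r = "\<rho> / 4 + real (length L) * \<delta>"
  have r: "nbhd K ?r \<subseteq> nbhd K \<rho>" using L\<delta>[OF \<delta>(3)] \<rho> by (intro nbhd_mono) auto
  have fg: "Ck k (nbhd K ?r) f" "Ck k (nbhd K ?r) g"
    using Ck_family_subset[OF f order_refl, of "nbhd K ?r"] Ck_family_subset[OF shallow_Ck[OF \<sigma>(3) g(1)], of "{0}" "nbhd K ?r"]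
      r \<rho>U by auto
  have "Ck_small k (nbhd K (\<rho> / 4)) ((2 / \<delta>) ^ k * C) (avgs \<delta> L (\<lambda>x. f x - g x))"
    unfolding L_def
  proof (rule avgs_Ck_small[OF _ bs \<delta>(1,2)]; (unfold L(2)[symmetric])?)
    show "Ck k (nbhd K ?r) (\<lambda>x. f x - g x)" by (intro Ck_family_diff fg)
    show "norm (f y - g y) \<le> C" if "y \<in> nbhd K ?r" for y
      using g(2)[OF subsetD[OF cb subsetD[OF r that]]] by simp
  qed (use C in auto)
  then have 2: "Ck_small k (nbhd K (\<rho> / 4)) (e / 3) (\<lambda>x. avgs \<delta> L f x - avgs \<delta> L g x)"
    unfolding C(2)
  proof (rule Ck_small_cong[OF open_nbhd, rotated])
    show "avgs \<delta> L (\<lambda>x. f x - g x) x = avgs \<delta> L f x - avgs \<delta> L g x" if "x \<in> nbhd K (\<rho> / 4)" for x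
      by (rule avgs_diff[OF fg[THEN Ck_family_le, OF le0] L(1) less_imp_le[OF \<delta>(1)] that])
  qed
  obtain R where R: "(\<Union>x\<in>K. cball x \<rho>) \<subseteq> ball 0 R"
    using compact_imp_bounded[OF compact_closed_nbhd[OF \<open>compact K\<close>]] bounded_subset_ballD by blast
  have sub: "nbhd K (\<rho> / 4) \<subseteq> ball 0 R" "nbhd K (\<rho> / 4) \<subseteq> U"
    using nbhd_mono[of "\<rho> / 4" \<rho> K] cb[of \<rho>] R \<rho>U \<rho>(1) by auto
  have e3: "0 < e / 3" using \<open>0 < e\<close> by simp
  obtain h where h: "h \<in> shallow \<sigma>" "Ck_small k (ball 0 R) (e / 3) (\<lambda>x. avgs \<delta> L g x - h x)"
    using Ck_closureD[OF shallow_avgs_closure[OF \<sigma>(3) g(1)] e3] by blast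
  have 3: "Ck_small k (nbhd K (\<rho> / 4)) (e / 3) (\<lambda>x. avgs \<delta> L g x - h x)"
    by (rule Ck_small_mono[OF h(2) sub(1)]) simp
  from Ck_small_add[OF Ck_small_minus[OF 1] Ck_small_add[OF 2 3]]
  have "Ck_small k (nbhd K (\<rho> / 4)) e (\<lambda>x. f x - h x)" by simp
  then show thesis using that[of h "\<rho> / 4"] h(1) sub(2) \<rho>(1) by simp
qed

theorem shallow_dense:
  fixes f :: "'a::euclidean_space \<Rightarrow> 'b::euclidean_space"
  assumes \<sigma>: "bounded (range \<sigma>)" "\<not> \<sigma> constant_on UNIV" "Ck k UNIV \<sigma>"
    and "open U" and f: "Ck k U f" and "compact K" "K \<subseteq> U" "0 < e"
  obtains g \<rho> where "g \<in> shallow \<sigma>" "0 < \<rho>" "nbhd K \<rho> \<subseteq> U" "Ck_small k (nbhd K \<rho>) e (\<lambda>x. f x - g x)"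
proof -
  let ?e = "e / DIM('b)"
  have e: "0 < ?e" using \<open>0 < e\<close> by simp
  have "\<exists>g\<in>shallow \<sigma>. \<exists>\<rho>>0. nbhd K \<rho> \<subseteq> U \<and> Ck_small k (nbhd K \<rho>) ?e (\<lambda>x. f x \<bullet> c - g x)" for c
    by (rule shallow_dense_real[OF \<sigma> \<open>open U\<close> Ck_family_inner_left[OF f] \<open>compact K\<close> \<open>K \<subseteq> U\<close> e]) blast
  then have "\<forall>c\<in>Basis. \<exists>g\<in>shallow \<sigma>. \<exists>\<rho>>0. nbhd K \<rho> \<subseteq> U \<and> Ck_small k (nbhd K \<rho>) ?e (\<lambda>x. f x \<bullet> c - g x)" ..
  then obtain g where "\<forall>c\<in>Basis. g c \<in> shallow \<sigma> \<and> (\<exists>\<rho>>0. nbhd K \<rho> \<subseteq> U \<and> Ck_small k (nbhd K \<rho>) ?e (\<lambda>x. f x \<bullet> c - g c x))"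
    unfolding Bex_def bchoice_iff by blast
  then have g: "\<And>c. c \<in> Basis \<Longrightarrow> g c \<in> shallow \<sigma>"
    and "\<forall>c\<in>Basis. \<exists>\<rho>. \<rho> > 0 \<and> nbhd K \<rho> \<subseteq> U \<and> Ck_small k (nbhd K \<rho>) ?e (\<lambda>x. f x \<bullet> c - g c x)"
    by auto
  from bchoice[OF this(2)] obtain \<rho> where
    \<rho>: "\<forall>c\<in>Basis. \<rho> c > 0 \<and> nbhd K (\<rho> c) \<subseteq> U \<and> Ck_small k (nbhd K (\<rho> c)) ?e (\<lambda>x. f x \<bullet> c - g c x)" ..
  define \<rho>' where "\<rho>' = Min (\<rho> ` Basis)"
  have pos: "\<rho>' > 0" unfolding \<rho>'_def using \<rho> by (subst Min_gr_iff) auto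
  have le: "\<rho>' \<le> \<rho> c" if "c \<in> Basis" for c using that by (simp add: \<rho>'_def)
  have small: "Ck_small k (nbhd K \<rho>') ?e (\<lambda>x. (f x \<bullet> c - g c x) *\<^sub>R c)" if c: "c \<in> Basis" for c
  proof -
    have "Ck_small k (nbhd K \<rho>') ?e (\<lambda>x. f x \<bullet> c - g c x)"
      by (rule Ck_small_mono[OF _ nbhd_mono[OF le[OF c]] order_refl]) (use \<rho> c in auto)
    from Ck_small_linear[OF bounded_linear_scaleR_left[of c] _ zero_le_one this]
    show ?thesis using c by simp
  qed
  have "Ck_small k (nbhd K \<rho>') (\<Sum>c\<in>(Basis::'b set). ?e) (\<lambda>x. \<Sum>c\<in>Basis. (f x \<bullet> c - g c x) *\<^sub>R c)"
    by (intro Ck_small_sum small finite_Basis)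
  moreover have "(\<Sum>c\<in>Basis. (f x \<bullet> c - g c x) *\<^sub>R c) = f x - (\<Sum>c\<in>Basis. g c x *\<^sub>R c)" for x
    by (simp add: scaleR_diff_left sum_subtractf euclidean_representation)
  ultimately have "Ck_small k (nbhd K \<rho>') e (\<lambda>x. f x - (\<Sum>c\<in>Basis. g c x *\<^sub>R c))"
    by simp
  moreover have "(\<lambda>x. \<Sum>c\<in>Basis. g c x *\<^sub>R c) \<in> shallow \<sigma>"
    by (intro shallow_sum shallow_scaleR_const g finite_Basis)
  moreover have "nbhd K \<rho>' \<subseteq> U"
  proof -
    obtain c :: 'b where "c \<in> Basis" using nonempty_Basis by blast
    then show ?thesis using nbhd_mono[OF le, of c K] \<rho> by blast
  qed
  ultimately show thesis using that pos by blast
qed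

text \<open>A sequence \<open>G\<close> with limit \<open>f\<close> is indexed by the time grid at time \<open>1\<close>, \<open>G N\<close> sitting at step size \<open>1 / N\<close>.\<close>

definition approx_grid :: "(real \<times> real) set" where
  "approx_grid = {p \<in> time_grid. snd p = 1}"

definition approx_family :: "('a \<Rightarrow> 'b) \<Rightarrow> (nat \<Rightarrow> 'a \<Rightarrow> 'b) \<Rightarrow> real \<times> real \<Rightarrow> 'a \<Rightarrow> 'b" where
  "approx_family f G p = (if fst p = 0 then f else G (nat (round (1 / fst p))))"

lemma approx_family_simps [simp]:
  "approx_family f G (0, t) = f"
  "1 \<le> N \<Longrightarrow> approx_family f G (1 / real N, t) = G N"
  by (simp_all add: approx_family_def)

lemma approx_grid_0: "(0, 1) \<in> approx_grid"
  by (auto simp: approx_grid_def intro: time_grid_0)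

lemma approx_grid_node: "1 \<le> N \<Longrightarrow> (1 / real N, 1) \<in> approx_grid"
  using time_grid_node[of N N] by (simp add: approx_grid_def)

lemma approx_grid_cases:
  assumes "p \<in> approx_grid"
  obtains "p = (0, 1)" | N where "1 \<le> N" "p = (1 / real N, 1)"
proof -
  from assms have "p \<in> time_grid" "snd p = 1" by (auto simp: approx_grid_def)
  from this(1) show thesis
    by (cases rule: time_grid_cases) (use that \<open>snd p = 1\<close> in auto)
qed

section \<open>Approximating sequences as families\<close>

lemma approx_family_continuous:
  assumes "open U"
    and C: "\<And>K. compact K \<Longrightarrow> K \<subseteq> U \<Longrightarrow> \<exists>N. \<forall>n\<ge>N. K \<subseteq> C n"
    and f: "continuous_on U f" and G: "\<And>N. 1 \<le> N \<Longrightarrow> continuous_on U (G N)"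
    and close: "\<And>N x. 1 \<le> N \<Longrightarrow> x \<in> interior (C N) \<Longrightarrow> norm (f x - G N x) \<le> 1 / real N"
  shows "continuous_on (approx_grid \<times> U) (\<lambda>(p, x). approx_family f G p (x::'a::euclidean_space) :: 'b::real_normed_vector)"
  unfolding continuous_on_iff
proof (intro ballI allI impI)
  fix px and e :: real assume px: "px \<in> approx_grid \<times> U" and "0 < e"
  obtain p x where [simp]: "px = (p, x)" by fastforce
  from px have p: "p \<in> approx_grid" and x: "x \<in> U" by auto
  have "\<exists>d>0. \<forall>q\<in>approx_grid. \<forall>y\<in>U. dist q p < d \<longrightarrow> dist y x < d \<longrightarrow> dist (approx_family f G q y) (approx_family f G p x) < e"
    using p
  proof (cases rule: approx_grid_cases)
    case (2 N)
    obtain d where d: "d > 0" "\<And>q. q \<in> time_grid \<Longrightarrow> dist q (1 / real N, real N / real N) < d \<Longrightarrow> q = (1 / real N, real N / real N)"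
      using time_grid_isolated[OF 2(1), of N] by metis
    obtain d' where d': "d' > 0" "\<And>y. y \<in> U \<Longrightarrow> dist y x < d' \<Longrightarrow> dist (G N y) (G N x) < e"
      using G[OF 2(1)] x \<open>0 < e\<close> unfolding continuous_on_iff by metis
    have "(1 / real N, real N / real N) = p" using 2 by simp
    then have qp: "q = p" if "q \<in> approx_grid" "dist q p < d" for q using d(2)[of q] that by (auto simp: approx_grid_def)
    show ?thesis
    proof (intro exI[of _ "min d d'"] conjI ballI impI)
      fix q y assume "q \<in> approx_grid" "y \<in> U" "dist q p < min d d'" "dist y x < min d d'"
      then show "dist (approx_family f G q y) (approx_family f G p x) < e"
        using qp[of q] d'(2)[of y] 2 by simp
    qed (use d d' in auto)
  next
    case 1
    obtain r where r: "r > 0" "cball x r \<subseteq> U" using \<open>open U\<close> x open_contains_cball by blast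
    obtain N0 where N0: "\<And>n. n \<ge> N0 \<Longrightarrow> cball x r \<subseteq> C n" using C[OF compact_cball r(2)] by blast
    have e2: "e / 2 > 0" using \<open>0 < e\<close> by simp
    obtain d where d: "d > 0" "\<And>y. y \<in> U \<Longrightarrow> dist y x < d \<Longrightarrow> dist (f y) (f x) < e / 2"
      using f x e2 unfolding continuous_on_iff by metis
    define d' where "d' = min (min d r) (min (e / 2) (1 / (real N0 + 1)))"
    have d': "d' > 0" using d r e2 by (auto simp: d'_def)
    have "dist (approx_family f G q y) (f x) < e" if q: "q \<in> approx_grid" "dist q p < d'" and y: "y \<in> U" "dist y x < d'" for q y
      using q(1)
    proof (cases rule: approx_grid_cases)
      case 1
      then show ?thesis using d(2)[OF y(1)] y(2) e2 by (auto simp: d'_def)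
    next
      case (2 N)
      have "dist (fst q) (fst p) < d'" using dist_fst_le[of q p] q(2) by linarith
      then have h: "1 / real N < d'" using 2 \<open>p = (0, 1)\<close> by simp
      then have "1 / real N < 1 / (real N0 + 1)" by (simp add: d'_def)
      then have "N0 \<le> N" using 2(1) by (simp add: field_simps)
      then have "ball x r \<subseteq> interior (C N)" using N0[of N] by (intro interior_maximal) auto
      then have "y \<in> interior (C N)" using y(2) by (auto simp: d'_def dist_commute)
      from close[OF 2(1) this] have "dist (G N y) (f y) \<le> 1 / real N" by (simp add: dist_norm norm_minus_commute)
      moreover have "dist (f y) (f x) < e / 2" using d(2)[OF y(1)] y(2) by (simp add: d'_def)
      moreover have "1 / real N < e / 2" using h by (simp add: d'_def)
      ultimately show ?thesis using dist_triangle[of "G N y" "f x" "f y"] 2 by simp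
    qed
    then show ?thesis using d' 1 by auto
  qed
  then obtain d where d: "d > 0" "\<And>q y. q \<in> approx_grid \<Longrightarrow> y \<in> U \<Longrightarrow> dist q p < d \<Longrightarrow> dist y x < d \<Longrightarrow>
      dist (approx_family f G q y) (approx_family f G p x) < e"
    by blast
  show "\<exists>d>0. \<forall>x'\<in>approx_grid \<times> U. dist x' px < d \<longrightarrow>
      dist (case x' of (p, x) \<Rightarrow> approx_family f G p x) (case px of (p, x) \<Rightarrow> approx_family f G p x) < e"
  proof (intro exI[of _ d] conjI ballI impI d(1))
    fix x' assume "x' \<in> approx_grid \<times> U" "dist x' px < d"
    then show "dist (case x' of (p, x) \<Rightarrow> approx_family f G p x) (case px of (p, x) \<Rightarrow> approx_family f G p x) < e"
      using dist_fst_le[of x' px] dist_snd_le[of x' px] by (auto simp: split_beta intro!: d(2))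
  qed
qed

text \<open>Closeness to \<open>f\<close> is demanded on the exhausting sets \<open>C N\<close>
  only; each compact part of \<open>U\<close> lies in almost all of them, which suffices for joint
  continuity at the limit. Differentiating \<open>f\<close> and the sequence gives data of the same
  kind.\<close>

lemma approx_family_Ck_family:
  assumes "open U"
    and C: "\<And>n. C n \<subseteq> U" "\<And>K. compact K \<Longrightarrow> K \<subseteq> U \<Longrightarrow> \<exists>N. \<forall>n\<ge>N. K \<subseteq> C n"
    and "Ck k U f" "\<And>N. 1 \<le> N \<Longrightarrow> Ck k U (G N)"
    and "\<And>N. 1 \<le> N \<Longrightarrow> Ck_small k (interior (C N)) (1 / real N) (\<lambda>x. f x - G N x)"
  shows "Ck_family k approx_grid U (approx_family f G)"
  using assms(4-)
proof (induction k arbitrary: f G)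
  have *: "continuous_on (approx_grid \<times> U) (\<lambda>(p, x). approx_family f G p x)"
    if "Ck k U f" "\<And>N. 1 \<le> N \<Longrightarrow> Ck k U (G N)"
    "\<And>N. 1 \<le> N \<Longrightarrow> Ck_small k (interior (C N)) (1 / real N) (\<lambda>x. f x - G N x)" for k f G
    using that by (intro approx_family_continuous[OF \<open>open U\<close> C(2)] Ck_continuous_on Ck_small_bound)
  {
    case 0
    then show ?case using *[of 0 f G] by simp
  next
    case (Suc k)
    obtain f' where f': "\<And>x. x \<in> U \<Longrightarrow> (f has_derivative f' x) (at x)" "\<And>b. b \<in> Basis \<Longrightarrow> Ck k U (\<lambda>x. f' x b)"
      using Ck_SucD[OF Suc.prems(1)] by blast
    have "\<exists>G'. 1 \<le> N \<longrightarrow> (\<forall>x\<in>U. (G N has_derivative G' x) (at x)) \<and> (\<forall>b\<in>Basis. Ck k U (\<lambda>x. G' x b))" for N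
      using Ck_SucD[OF Suc.prems(2)[of N]] by (cases "1 \<le> N") simp_all
    then obtain G' where "\<forall>N. 1 \<le> N \<longrightarrow> (\<forall>x\<in>U. (G N has_derivative G' N x) (at x)) \<and> (\<forall>b\<in>Basis. Ck k U (\<lambda>x. G' N x b))"
      using choice[of "\<lambda>N G'. 1 \<le> N \<longrightarrow> (\<forall>x\<in>U. (G N has_derivative G' x) (at x)) \<and> (\<forall>b\<in>Basis. Ck k U (\<lambda>x. G' x b))"] by blast
    then have G': "\<And>N x. 1 \<le> N \<Longrightarrow> x \<in> U \<Longrightarrow> (G N has_derivative G' N x) (at x)"
      "\<And>N b. 1 \<le> N \<Longrightarrow> b \<in> Basis \<Longrightarrow> Ck k U (\<lambda>x. G' N x b)" by auto
    have small: "Ck_small k (interior (C N)) (1 / real N) (\<lambda>x. f' x b - G' N x b)" if N: "1 \<le> N" and b: "b \<in> Basis" for N b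
    proof -
      obtain h' where h': "\<And>x. x \<in> interior (C N) \<Longrightarrow> ((\<lambda>x. f x - G N x) has_derivative h' x) (at x)"
        "\<And>b. b \<in> Basis \<Longrightarrow> Ck_small k (interior (C N)) (1 / real N) (\<lambda>x. h' x b)"
        using Ck_small_SucD[OF Suc.prems(3)[OF N]] by blast
      have "h' x b = f' x b - G' N x b" if "x \<in> interior (C N)" for x
      proof -
        have "x \<in> U" using that C(1) interior_subset by blast
        from has_derivative_diff[OF f'(1)[OF this] G'(1)[OF N this]] has_derivative_unique[OF h'(1)[OF that]]
        show ?thesis by metis
      qed
      from Ck_small_cong[OF open_interior this h'(2)[OF b]] show ?thesis .
    qed
    show ?case
    proof (rule Ck_family_SucI[OF *[OF Suc.prems], where f' = "approx_family f' G'"])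
      show "(approx_family f G p has_derivative approx_family f' G' p x) (at x)" if "p \<in> approx_grid" "x \<in> U" for p x
        using that(1) by (cases rule: approx_grid_cases) (use f'(1) G'(1) that in auto)
      fix b :: 'a assume b: "b \<in> Basis"
      have "Ck_family k approx_grid U (approx_family (\<lambda>x. f' x b) (\<lambda>N x. G' N x b))"
        by (rule Suc.IH) (use f'(2) G'(2) small b in auto)
      moreover have "approx_family (\<lambda>x. f' x b) (\<lambda>N x. G' N x b) = (\<lambda>p x. approx_family f' G' p x b)"
        by (auto simp: approx_family_def fun_eq_iff)
      ultimately show "Ck_family k approx_grid U (\<lambda>p x. approx_family f' G' p x b)" by simp
    qed
  }
qed

text \<open>One sequence serves all compact sets, instead of one network per set and tolerance.
  Approximations can then be composed by \<open>Ck_family_compose\<close> without tracking which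
  sets the earlier maps reach.\<close>

theorem network_sequence:
  fixes f :: "'a::euclidean_space \<Rightarrow> 'b::euclidean_space"
  assumes \<sigma>: "\<sigma> \<in> activations s" "k \<le> s" and "open U" and f: "Ck k U f"
  obtains G where "\<forall>N. G N \<in> networks \<sigma>" "Ck_family k approx_grid U (approx_family f G)"
proof -
  have \<sigma>': "bounded (range \<sigma>)" "\<not> \<sigma> constant_on UNIV" "Ck k UNIV \<sigma>"
    using \<sigma> Ck_family_le[OF Ck_on_imp_Ck[OF open_UNIV, of s \<sigma>]] by (auto simp: activations_def)
  obtain C where C: "\<And>n. compact (C n)" "\<And>n. C n \<subseteq> U"
    and "\<And>n. C n \<subseteq> interior (C (Suc n))" "\<Union> (range C) = U"
    and C_exhaust: "\<And>K. compact K \<Longrightarrow> K \<subseteq> U \<Longrightarrow> \<exists>N. \<forall>n\<ge>N. K \<subseteq> C n"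
    by (rule open_Union_compact_subsets[OF \<open>open U\<close>], rule that)
  \<comment> \<open>\<open>max N 1\<close> gives the index \<open>0\<close>, which corresponds to no
    grid point, a positive tolerance.\<close>
  have "\<exists>g. g \<in> shallow \<sigma> \<and> Ck_small k (interior (C N)) (1 / real (max N 1)) (\<lambda>x. f x - g x)" for N
  proof -
    have "0 < 1 / real (max N 1)" by simp
    from shallow_dense[OF \<sigma>' \<open>open U\<close> f C(1,2)[of N] this]
    obtain g \<rho> where g: "g \<in> shallow \<sigma>" "\<rho> > 0" "Ck_small k (nbhd (C N) \<rho>) (1 / real (max N 1)) (\<lambda>x. f x - g x)" .
    have "interior (C N) \<subseteq> nbhd (C N) \<rho>" using subset_nbhd[OF g(2)] interior_subset by blast
    from Ck_small_mono[OF g(3) this order_refl] g(1) show ?thesis by blast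
  qed
  then obtain G where G: "\<And>N. G N \<in> shallow \<sigma>"
    "\<And>N. Ck_small k (interior (C N)) (1 / real (max N 1)) (\<lambda>x. f x - G N x)"
    by metis
  have "Ck_family k approx_grid U (approx_family f G)"
  proof (rule approx_family_Ck_family[OF \<open>open U\<close> C(2) C_exhaust f])
    show "Ck k U (G N)" for N
      by (rule Ck_family_subset[OF shallow_Ck[OF \<sigma>'(3) G(1)]]) auto
    show "Ck_small k (interior (C N)) (1 / real N) (\<lambda>x. f x - G N x)" if "1 \<le> N" for N
      using G(2)[of N] that by (simp add: max_absorb1)
  qed
  then show thesis using that G(1) shallow_imp_networks by blast
qed

section \<open>Splitting into Lagrange-d'Alembert-Euler maps\<close>

lemma dir_deriv_cong:
  assumes "open S" "\<And>x. x \<in> S \<Longrightarrow> f x = g x"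
  shows "x \<in> S \<Longrightarrow> dir_deriv vs f x = dir_deriv vs g x"
proof (induction vs arbitrary: x)
  case (Cons v vs)
  have "(dir_deriv vs f has_derivative D) (at x) \<longleftrightarrow> (dir_deriv vs g has_derivative D) (at x)" for D
    using Cons has_derivative_transform_within_open[OF _ \<open>open S\<close> Cons.prems] by metis
  then show ?case by (simp add: frechet_derivative_def)
qed (use assms in simp)

lemma dir_deriv_Nil: "dir_deriv [] h = h"
  by (simp add: fun_eq_iff)

text \<open>\<open>dir_deriv\<close> exposes the derivative taken last, at the head of the list,
  whereas \<open>Ck_small\<close> unfolds from the derivative taken first; this moves the latter, at
  the end of the list, inside.\<close>

lemma dir_deriv_snoc: "dir_deriv (vs @ [v]) h = dir_deriv vs (dir_deriv [v] h)"
proof (induction vs)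
  case (Cons a vs)
  show ?case by (rule ext) (simp only: append_Cons dir_deriv.simps(2)[of a] Cons.IH)
qed (simp add: fun_eq_iff)

lemma Ck_small_direction:
  fixes h' :: "'a::euclidean_space \<Rightarrow> 'a \<Rightarrow> 'b::real_normed_vector" and e :: real
  assumes "open S" "\<And>x. x \<in> S \<Longrightarrow> linear (h' x)" "\<And>b. b \<in> Basis \<Longrightarrow> Ck_small k S e (\<lambda>x. h' x b)"
    and "norm v \<le> 1" "0 \<le> e"
  shows "Ck_small k S (DIM('a) * e) (\<lambda>x. h' x v)"
proof -
  have "Ck_small k S (\<Sum>b\<in>(Basis::'a set). e) (\<lambda>x. \<Sum>b\<in>Basis. (v \<bullet> b) *\<^sub>R h' x b)"
  proof (rule Ck_small_sum[OF finite_Basis])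
    fix b :: 'a assume b: "b \<in> Basis"
    have "\<bar>v \<bullet> b\<bar> \<le> 1" using Basis_le_norm[OF b, of v] assms(4) by linarith
    then have "\<bar>v \<bullet> b\<bar> * e \<le> e" using assms(5) by (simp add: mult_left_le_one_le)
    then show "Ck_small k S e (\<lambda>x. (v \<bullet> b) *\<^sub>R h' x b)"
      by (rule Ck_small_mono[OF Ck_small_scaleR[OF assms(3)[OF b]] order_refl])
  qed
  from Ck_small_cong[OF \<open>open S\<close> _ this, of "\<lambda>x. h' x v"] show ?thesis
    using linear_expand_Basis[OF assms(2)] by simp
qed

text \<open>A derivative in a direction of norm at most one combines \<open>DIM('a)\<close> basis
  derivatives with coefficients of absolute value at most one, so every order costs one such
  factor.\<close>

lemma Ck_small_dir_deriv:
  fixes h :: "'a::euclidean_space \<Rightarrow> 'b::real_normed_vector" and e :: real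
  assumes "open S" "Ck_small k S e h" "0 \<le> e" "length vs \<le> k" "\<And>v. v \<in> set vs \<Longrightarrow> norm v \<le> 1" "x \<in> S"
  shows "norm (dir_deriv vs h x) \<le> DIM('a) ^ k * e"
  using assms(2-)
proof (induction k arbitrary: h vs e)
  case 0
  then show ?case by simp
next
  case (Suc k)
  have D: "1 \<le> real DIM('a)" using DIM_positive[where 'a = 'a] by linarith
  show ?case
  proof (cases vs rule: rev_cases)
    case Nil
    have "norm (h x) \<le> 1 * e" using Ck_small_bound[OF Suc.prems(1,5)] by simp
    also have "\<dots> \<le> DIM('a) ^ Suc k * e"
      using one_le_power[OF D, of "Suc k"] Suc.prems(2) by (intro mult_right_mono) auto
    finally show ?thesis using Nil by simp
  next
    case (snoc us v)
    obtain h' where h': "\<And>x. x \<in> S \<Longrightarrow> (h has_derivative h' x) (at x)"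
      "\<And>b. b \<in> Basis \<Longrightarrow> Ck_small k S e (\<lambda>x. h' x b)"
      using Ck_small_SucD[OF Suc.prems(1)] by blast
    have v: "norm v \<le> 1" using Suc.prems(4) snoc by auto
    have dd: "dir_deriv [v] h y = h' y v" if "y \<in> S" for y
      using frechet_derivative_at[OF h'(1)[OF that]] by (simp add: dir_deriv_Nil)
    have "dir_deriv vs h x = dir_deriv us (\<lambda>x. h' x v) x"
      unfolding snoc dir_deriv_snoc by (rule dir_deriv_cong[OF \<open>open S\<close> dd Suc.prems(5)])
    also have "norm \<dots> \<le> DIM('a) ^ k * (DIM('a) * e)"
      by (rule Suc.IH[OF Ck_small_direction[OF \<open>open S\<close> has_derivative_linear[OF h'(1)] h'(2) v Suc.prems(2)]])
        (use Suc.prems snoc in auto)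
    finally show ?thesis by (simp add: mult_ac)
  qed
qed

lemma Ck_small_Cr_norm:
  fixes h :: "'a::euclidean_space \<Rightarrow> 'b::real_normed_vector" and e :: real
  assumes "open S" "Ck_small k S e h" "0 \<le> e" "K \<subseteq> S"
  shows "Cr_norm k K h \<le> ennreal (DIM('a) ^ k * e)"
  unfolding Cr_norm_def
proof (intro SUP_least ennreal_leI)
  fix j x and vs :: "'a list"
  assume j: "j \<in> {0..k}" "x \<in> K" "vs \<in> {vs. length vs = j \<and> (\<forall>v\<in>set vs. norm v \<le> 1)}"
  show "norm (dir_deriv vs h x) \<le> DIM('a) ^ k * e"
    by (rule Ck_small_dir_deriv[OF assms(1-3)]) (use j assms(4) in auto)
qed

text \<open>Time turns into a parameter and only the derivatives in the other variables are kept.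
  These lie in the open set \<open>UNIV \<times> I\<close>, where derivatives within the set are
  ordinary ones even at the ends of the time interval.\<close>

lemma Ck_on_imp_Ck_family:
  fixes g :: "'n::finite phase \<times> real \<times> (real ^ 'l::finite) \<Rightarrow> 'b::real_normed_vector"
  assumes "open I"
  shows "Ck_on k (UNIV \<times> {0..T} \<times> I) g \<Longrightarrow> Ck_family k {0..T} (UNIV \<times> I) (\<lambda>t x. g (fst x, t, snd x))"
proof (induction k arbitrary: g)
  let ?S = "UNIV \<times> {0..T} \<times> I"
  have *: "continuous_on ({0..T} \<times> UNIV \<times> I) (\<lambda>(t, x). g (fst x, t, snd x))"
    if "continuous_on ?S g" for g :: "'n phase \<times> real \<times> (real ^ 'l) \<Rightarrow> 'b"
    unfolding split_beta by (rule continuous_on_compose2[OF that]) (auto intro!: continuous_intros)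
  {
    case 0
    then show ?case using * by simp
  next
    case (Suc k)
    from Suc.prems obtain g' where "\<forall>y\<in>?S. (g has_derivative g' y) (at y within ?S)" "\<forall>v. Ck_on k ?S (\<lambda>y. g' y v)"
      unfolding Ck_on.simps(2) by (elim exE conjE)
    note g' = this(1)[THEN bspec] this(2)[THEN spec]
    have "continuous_on ?S g"
      using g'(1) by (meson continuous_on_eq_continuous_within has_derivative_continuous)
    note cont = *[OF this]
    have U: "open (UNIV \<times> I :: ('n phase \<times> (real ^ 'l)) set)" using \<open>open I\<close> by (intro open_Times) auto
    show ?case
    proof (rule Ck_family_SucI[OF cont, where f' = "\<lambda>t x v. g' (fst x, t, snd x) (fst v, 0, snd v)"])
      fix t :: real and x :: "'n phase \<times> (real ^ 'l)" assume t: "t \<in> {0..T}" and x: "x \<in> UNIV \<times> I"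
      let ?c = "\<lambda>x. (fst x, t, snd x)"
      have "(?c has_derivative (\<lambda>v. (fst v, 0, snd v))) (at x within UNIV \<times> I)"
        by (auto intro!: derivative_eq_intros)
      moreover have "(g has_derivative g' (?c x)) (at (?c x) within ?c ` (UNIV \<times> I))"
        by (rule has_derivative_subset[OF g'(1)]) (use t x in auto)
      ultimately have "((\<lambda>x. g (?c x)) has_derivative (\<lambda>v. g' (?c x) (fst v, 0, snd v))) (at x within UNIV \<times> I)"
        by (rule has_derivative_in_compose)
      then show "((\<lambda>x. g (?c x)) has_derivative (\<lambda>v. g' (?c x) (fst v, 0, snd v))) (at x)"
        using at_within_open[OF x U] by simp
    qed (rule Suc.IH[OF g'(2)])
  }
qed

section \<open>Gradients of the Hamiltonian\<close>

lemma GDERIV_from_has_derivative: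
  assumes "(h has_derivative h') (at a)"
  shows "GDERIV h a :> (\<Sum>b\<in>Basis. h' b *\<^sub>R b)"
proof -
  have "h' = (\<lambda>v. v \<bullet> (\<Sum>b\<in>Basis. h' b *\<^sub>R b))"
  proof
    fix v
    show "h' v = v \<bullet> (\<Sum>b\<in>Basis. h' b *\<^sub>R b)"
      using has_derivative_expand_Basis[OF assms, of v] by (simp add: inner_sum_right mult.commute)
  qed
  with assms show ?thesis unfolding gderiv_def by simp
qed

lemmas grad_from_has_derivative = grad_eqI[OF GDERIV_from_has_derivative]

lemma hamiltonian_grad_Ck_family:
  fixes H :: "'n::finite phase \<times> real \<times> (real ^ 'l::finite) \<Rightarrow> real"
  assumes "open I" and H: "Ck_on (Suc k) (UNIV \<times> {0..T} \<times> I) H"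
  shows "Ck_family k {0..T} (UNIV \<times> I) (\<lambda>t x. grad (\<lambda>p. H ((fst (fst x), p), t, snd x)) (snd (fst x)))" (is ?P)
    and "Ck_family k {0..T} (UNIV \<times> I) (\<lambda>t x. grad (\<lambda>q. H ((q, snd (fst x)), t, snd x)) (fst (fst x)))" (is ?Q)
proof -
  have U: "open (UNIV \<times> I :: ('n phase \<times> (real ^ 'l)) set)" using \<open>open I\<close> by (intro open_Times) auto
  obtain h' where h':
    "\<And>t x. t \<in> {0..T} \<Longrightarrow> x \<in> UNIV \<times> I \<Longrightarrow> ((\<lambda>x. H (fst x, t, snd x)) has_derivative h' t x) (at x)"
    "\<And>b. b \<in> Basis \<Longrightarrow> Ck_family k {0..T} (UNIV \<times> I) (\<lambda>t x. h' t x b)"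
    using Ck_family_SucD[OF Ck_on_imp_Ck_family[OF assms]] by blast
  have "grad (\<lambda>p. H ((fst (fst x), p), t, snd x)) (snd (fst x)) = (\<Sum>b\<in>Basis. h' t x ((0, b), 0) *\<^sub>R b)"
    if "t \<in> {0..T}" "x \<in> UNIV \<times> I" for t x
  proof (rule grad_from_has_derivative)
    have "((\<lambda>p. ((fst (fst x), p), snd x)) has_derivative (\<lambda>v. ((0, v), 0))) (at (snd (fst x)))"
      by (auto intro!: derivative_eq_intros)
    from has_derivative_compose[OF this, of "\<lambda>x. H (fst x, t, snd x)" "h' t x"] h'(1)[OF that]
    show "((\<lambda>p. H ((fst (fst x), p), t, snd x)) has_derivative (\<lambda>v. h' t x ((0, v), 0))) (at (snd (fst x)))"
      by simp
  qed
  note grad_P = this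
  have "Ck_family k {0..T} (UNIV \<times> I) (\<lambda>t x. \<Sum>b\<in>Basis. h' t x ((0, b), 0) *\<^sub>R b)"
    by (intro Ck_family_sum Ck_family_scaleR Ck_family_const h'(2)) (auto simp: Basis_prod_def)
  then show ?P by (rule Ck_family_cong[OF U, rotated]) (simp only: grad_P)
  have "grad (\<lambda>q. H ((q, snd (fst x)), t, snd x)) (fst (fst x)) = (\<Sum>b\<in>Basis. h' t x ((b, 0), 0) *\<^sub>R b)"
    if "t \<in> {0..T}" "x \<in> UNIV \<times> I" for t x
  proof (rule grad_from_has_derivative)
    have "((\<lambda>q. ((q, snd (fst x)), snd x)) has_derivative (\<lambda>v. ((v, 0), 0))) (at (fst (fst x)))"
      by (auto intro!: derivative_eq_intros)
    from has_derivative_compose[OF this, of "\<lambda>x. H (fst x, t, snd x)" "h' t x"] h'(1)[OF that]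
    show "((\<lambda>q. H ((q, snd (fst x)), t, snd x)) has_derivative (\<lambda>v. h' t x ((v, 0), 0))) (at (fst (fst x)))"
      by simp
  qed
  note grad_Q = this
  have "Ck_family k {0..T} (UNIV \<times> I) (\<lambda>t x. \<Sum>b\<in>Basis. h' t x ((b, 0), 0) *\<^sub>R b)"
    by (intro Ck_family_sum Ck_family_scaleR Ck_family_const h'(2)) (auto simp: Basis_prod_def)
  then show ?Q by (rule Ck_family_cong[OF U, rotated]) (simp only: grad_Q)
qed

text \<open>The map \<open>LDE_aug\<close> for \<open>T (p, \<mu>) = c * (p \<bullet> p) / 2\<close>, \<open>U = 0\<close> and \<open>f = g\<close>.\<close>

definition sheared_kick ::
  "real \<Rightarrow> ('n::finite phase \<times> (real ^ 'l::finite) \<Rightarrow> real ^ 'n) \<Rightarrow> 'n phase \<times> (real ^ 'l) \<Rightarrow> 'n phase \<times> (real ^ 'l)"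
where
  "sheared_kick c g = (\<lambda>((q, p), \<mu>). ((q + c *\<^sub>R p, p + g ((q + c *\<^sub>R p, p), \<mu>)), \<mu>))"

text \<open>The value at \<open>(0, 1)\<close> is the map to be reproduced, the value at
  \<open>(1 / N, 1)\<close> its realization by networks. Preservation of
  \<open>UNIV \<times> I\<close> is included so that such families can be composed.\<close>

definition lde_approximable ::
  "nat \<Rightarrow> (real ^ 'l) set \<Rightarrow> (real \<Rightarrow> real) \<Rightarrow>
    (real \<times> real \<Rightarrow> 'n::finite phase \<times> (real ^ 'l::finite) \<Rightarrow> 'n phase \<times> (real ^ 'l)) \<Rightarrow> bool"
where
  "lde_approximable r I \<sigma> L \<longleftrightarrow> Ck_family r approx_grid (UNIV \<times> I) L \<and>
     (\<forall>p\<in>approx_grid. \<forall>x\<in>UNIV \<times> I. L p x \<in> UNIV \<times> I) \<and> (\<forall>N\<ge>1. L (1 / real N, 1) \<in> LDE_networks \<sigma>)"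

section \<open>Realizing sheared kicks by networks\<close>

lemma zero_network: "(\<lambda>x. 0) \<in> networks \<sigma>"
  by (rule shallow_imp_networks[OF shallow_zero])

lemma grad_zero: "grad (\<lambda>x. 0) x = 0"
  by (rule grad_eqI) (rule GDERIV_const)

lemma grad_half_norm: "grad (\<lambda>p. c * (p \<bullet> p) / 2) a = c *\<^sub>R (a::real ^ 'n::finite)"
proof (rule grad_eqI)
  have "((\<lambda>p. c * (p \<bullet> p) / 2) has_derivative (\<lambda>h. h \<bullet> (c *\<^sub>R a))) (at a)"
    by (auto intro!: derivative_eq_intros simp: inner_commute)
  then show "GDERIV (\<lambda>p. c * (p \<bullet> p) / 2) a :> c *\<^sub>R a" by (simp add: gderiv_def)
qed

text \<open>The kinetic term enters through its gradient, so it is approximated to order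
  \<open>r + 1\<close>, the force to order \<open>r\<close>; the map built from them then converges
  to order \<open>r\<close>. The potential is the zero network.\<close>

lemma sheared_kick_approximable:
  fixes g :: "'n::finite phase \<times> (real ^ 'l::finite) \<Rightarrow> real ^ 'n"
  assumes \<sigma>: "\<sigma> \<in> activations (r + 2)" and "open I" and g: "Ck r (UNIV \<times> I) g"
  obtains L where "lde_approximable r I \<sigma> L" "\<forall>x\<in>UNIV \<times> I. L (0, 1) x = sheared_kick c g x"
proof -
  have U: "open (UNIV \<times> I :: ('n phase \<times> (real ^ 'l)) set)" using \<open>open I\<close> by (intro open_Times) auto
  let ?T = "\<lambda>(p::real ^ 'n, \<mu>::real ^ 'l). c / 2 * (p \<bullet> p)"
  have T: "Ck (Suc r) UNIV ?T"
    unfolding split_beta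
    by (intro Ck_family_mult Ck_family_const Ck_family_bilinear[OF bounded_bilinear_inner] Ck_family_fst Ck_family_ident)
  have "Suc r \<le> r + 2" "r \<le> r + 2" by simp_all
  note network = network_sequence[OF \<sigma> this(1) open_UNIV T] network_sequence[OF \<sigma> this(2) U g]
  obtain Tn where Tn: "\<And>N. Tn N \<in> networks \<sigma>" "Ck_family (Suc r) approx_grid UNIV (approx_family ?T Tn)"
    by (rule network(1)) (rule that; blast)
  obtain gn where gn: "\<And>N. gn N \<in> networks \<sigma>" "Ck_family r approx_grid (UNIV \<times> I) (approx_family g gn)"
    by (rule network(2)) (rule that; blast)
  define L where "L p = LDE_aug (approx_family ?T Tn p) (\<lambda>x. 0) (approx_family g gn p)" for p
  let ?G = "\<lambda>p (x :: 'n phase \<times> (real ^ 'l)). grad (\<lambda>a. approx_family ?T Tn p (a, snd x)) (snd (fst x))"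
  let ?q = "\<lambda>p x. fst (fst x) + ?G p x"
  have L: "L p x = ((?q p x, snd (fst x) + approx_family g gn p ((?q p x, snd (fst x)), snd x)), snd x)" for p x
    by (simp add: L_def LDE_aug_def Let_def split_beta grad_zero)
  obtain T' where T': "\<And>p x. p \<in> approx_grid \<Longrightarrow> (approx_family ?T Tn p has_derivative T' p x) (at x)"
    "\<And>b. b \<in> Basis \<Longrightarrow> Ck_family r approx_grid UNIV (\<lambda>p x. T' p x b)"
    using Ck_family_SucD[OF Tn(2)] by blast
  have G: "Ck_family r approx_grid (UNIV \<times> I) ?G"
  proof (rule Ck_family_cong[OF U, rotated])
    show "Ck_family r approx_grid (UNIV \<times> I) (\<lambda>p (x :: 'n phase \<times> (real ^ 'l)). \<Sum>b\<in>Basis. T' p (snd (fst x), snd x) (b, 0) *\<^sub>R b)"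
    proof (intro Ck_family_sum Ck_family_scaleR Ck_family_const finite_Basis)
      fix b :: "real ^ 'n" assume "b \<in> Basis"
      then have "(b, 0) \<in> (Basis :: ((real ^ 'n) \<times> (real ^ 'l)) set)" by (auto simp: Basis_prod_def)
      note T'b = T'(2)[OF this]
      have "Ck_family r approx_grid (UNIV \<times> I) (\<lambda>p (x :: 'n phase \<times> (real ^ 'l)). (snd (fst x), snd x))"
        by (intro Ck_family_Pair Ck_family_snd Ck_family_fst Ck_family_ident)
      from Ck_family_compose[OF T'b this _ U]
      show "Ck_family r approx_grid (UNIV \<times> I) (\<lambda>p (x :: 'n phase \<times> (real ^ 'l)). T' p (snd (fst x), snd x) (b, 0))"
        by simp
    qed
    fix p and x :: "'n phase \<times> (real ^ 'l)" assume p: "p \<in> approx_grid"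
    have "((\<lambda>a. (a, snd x)) has_derivative (\<lambda>v. (v, 0))) (at (snd (fst x)))"
      by (auto intro!: derivative_eq_intros)
    from grad_from_has_derivative[OF has_derivative_compose[OF this T'(1)[OF p]]]
    show "(\<Sum>b\<in>Basis. T' p (snd (fst x), snd x) (b, 0) *\<^sub>R b) = ?G p x" by simp
  qed
  have q: "Ck_family r approx_grid (UNIV \<times> I) ?q"
    by (intro Ck_family_add G Ck_family_fst Ck_family_ident)
  have "Ck_family r approx_grid (UNIV \<times> I) L"
    unfolding L
    by (intro Ck_family_Pair Ck_family_add q Ck_family_fst Ck_family_snd Ck_family_ident
        Ck_family_compose[OF gn(2) _ _ U]) auto
  moreover have "L p x \<in> UNIV \<times> I" if "x \<in> UNIV \<times> I" for p x
    using that by (auto simp: L)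
  moreover have "L (1 / real N, 1) \<in> LDE_networks \<sigma>" if "1 \<le> N" for N
  proof -
    have "L (1 / real N, 1) = LDE_aug (Tn N) (\<lambda>x. 0) (gn N)" using that by (simp add: L_def)
    then show ?thesis unfolding LDE_networks_def using Tn(1)[of N] gn(1)[of N] zero_network by blast
  qed
  moreover have "L (0, 1) x = sheared_kick c g x" for x
    by (simp add: L sheared_kick_def split_beta grad_half_norm)
  ultimately show thesis using that unfolding lde_approximable_def by blast
qed

text \<open>With the list of factors fixed, all of them are replaced by networks simultaneously
  along one common parameter, and convergence of the composition is an instance of
  \<open>Ck_family_compose\<close>. Reverse induction matches \<open>fold\<close>, which applies the
  last map last.\<close>

lemma fold_lde_approximable:
  assumes "open I" and "\<And>L. L \<in> set Ls \<Longrightarrow> lde_approximable r I \<sigma> L"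
  shows "Ck_family r approx_grid (UNIV \<times> I) (\<lambda>p. fold (\<lambda>L y. L y) (map (\<lambda>L. L p) Ls)) \<and>
    (\<forall>p\<in>approx_grid. \<forall>x\<in>UNIV \<times> I. fold (\<lambda>L y. L y) (map (\<lambda>L. L p) Ls) x \<in> UNIV \<times> I)"
  using assms(2)
proof (induction Ls rule: rev_induct)
  case Nil
  show ?case by (simp add: Ck_family_ident id_def)
next
  case (snoc L Ls)
  have U: "open (UNIV \<times> I)" using \<open>open I\<close> by (intro open_Times) auto
  have L: "lde_approximable r I \<sigma> L" using snoc.prems by simp
  have IH: "Ck_family r approx_grid (UNIV \<times> I) (\<lambda>p. fold (\<lambda>L y. L y) (map (\<lambda>L. L p) Ls))"
    "\<And>p x. p \<in> approx_grid \<Longrightarrow> x \<in> UNIV \<times> I \<Longrightarrow> fold (\<lambda>L y. L y) (map (\<lambda>L. L p) Ls) x \<in> UNIV \<times> I"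
    using snoc by auto
  have "Ck_family r approx_grid (UNIV \<times> I) (\<lambda>p x. L p (fold (\<lambda>L y. L y) (map (\<lambda>L. L p) Ls) x))"
    by (rule Ck_family_compose[OF _ IH U]) (use L in \<open>auto simp: lde_approximable_def\<close>)
  moreover have "(\<lambda>p. fold (\<lambda>L y. L y) (map (\<lambda>L. L p) (Ls @ [L]))) = (\<lambda>p x. L p (fold (\<lambda>L y. L y) (map (\<lambda>L. L p) Ls) x))"
    by (auto simp: fun_eq_iff)
  moreover have "L p (fold (\<lambda>L y. L y) (map (\<lambda>L. L p) Ls) x) \<in> UNIV \<times> I" if "p \<in> approx_grid" "x \<in> UNIV \<times> I" for p x
  proof -
    have "\<forall>p\<in>approx_grid. \<forall>x\<in>UNIV \<times> I. L p x \<in> UNIV \<times> I" using L by (simp add: lde_approximable_def)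
    from bspec[OF bspec[OF this that(1)] IH(2)[OF that]] show ?thesis .
  qed
  ultimately show ?case by (simp only: fold_append map_append list.map fold_simps o_apply simp_thms Ball_def) blast
qed

text \<open>The parameter \<open>\<mu>\<close> is treated as a state variable with zero velocity, so
  derivatives in \<open>\<mu>\<close> are derivatives in the initial value, and iterates and flow
  form one \<open>Ck_family\<close> on \<open>U\<close>. All iterates stay in \<open>U\<close>
  because the phase space is unrestricted and \<open>\<mu>\<close> does not move.\<close>

lemma LdA_euler_splitting:
  fixes \<phi> :: "'n::finite phase \<times> (real ^ 'l::finite) \<Rightarrow> 'n phase" and I :: "(real ^ 'l) set"
  defines "U \<equiv> UNIV \<times> I"
  assumes "open I" and \<sigma>: "\<sigma> \<in> activations (r + 2)" and \<phi>: "\<phi> \<in> LdA (r + 1) I"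
  obtains w where "Ck_family r time_grid U w" "\<forall>x\<in>U. \<phi> x = fst (w (0, 1) x)"
    "\<forall>N\<ge>1. \<exists>Ls. length Ls = 2 * N \<and> (\<forall>L\<in>set Ls. lde_approximable r I \<sigma> L) \<and>
       (\<forall>x\<in>U. w (grid_node N N) x = fold (\<lambda>L y. L y) (map (\<lambda>L. L (0, 1)) Ls) x)"
proof -
  have U: "open U" unfolding U_def using \<open>open I\<close> by (intro open_Times) auto
  obtain T H f where T: "0 < T" and adm: "admissible_system r T I H f"
    and flow: "\<And>x. x \<in> U \<Longrightarrow> \<phi> x = ham_flow H f T T 0 x"
    using \<phi> by (auto simp: LdA_def U_def)
  define X where "X t x = grad (\<lambda>p. H ((fst (fst x), p), t, snd x)) (snd (fst x))" for t and x :: "'n phase \<times> (real ^ 'l)"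
  define Y where "Y t x = - grad (\<lambda>q. H ((q, snd (fst x)), t, snd x)) (fst (fst x)) + f (fst x, t, snd x)"
    for t and x :: "'n phase \<times> (real ^ 'l)"
  have HC: "Ck_on (Suc (r + 1)) (UNIV \<times> {0..T} \<times> I) H" and fC: "Ck_on (r + 1) (UNIV \<times> {0..T} \<times> I) f"
    using adm by (auto simp: admissible_system_def)
  have X: "Ck_family (r + 1) {0..T} U X"
    unfolding X_def U_def by (rule hamiltonian_grad_Ck_family(1)[OF \<open>open I\<close> HC])
  have Y: "Ck_family (r + 1) {0..T} U Y"
    unfolding Y_def U_def
    by (intro Ck_family_add Ck_family_minus hamiltonian_grad_Ck_family(2)[OF \<open>open I\<close> HC] Ck_on_imp_Ck_family[OF \<open>open I\<close> fC])
  \<comment> \<open>Time is rescaled to the unit interval, hence the factors \<open>T\<close>. The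
    field \<open>A\<close> preserves \<open>q + p\<close>, and \<open>B\<close> preserves
    \<open>q\<close>.\<close>
  define A where "A t x = ((T *\<^sub>R X (T * t) x, - T *\<^sub>R X (T * t) x), 0 :: real ^ 'l)" for t x
  define B where "B t x = ((0 :: real ^ 'n, T *\<^sub>R (X (T * t) x + Y (T * t) x)), 0 :: real ^ 'l)" for t x
  \<comment> \<open>A step of size \<open>fst p\<close> along \<open>A\<close> followed by one along
    \<open>B\<close>, written as a single Euler step; at step size zero the sum of the two fields,
    that is, the rescaled original field, remains.\<close>
  define W where "W p x = A (snd p) x + B (snd p) (x + fst p *\<^sub>R A (snd p) x)" for p :: "real \<times> real" and x
  have time: "T * t \<in> {0..T}" if "t \<in> {0..1}" for t using that T by (auto simp: mult_left_le)
  have snd_grid: "snd p \<in> {0..1}" if "p \<in> time_grid" for p using that by (cases rule: time_grid_cases) auto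
  have XT: "Ck_family (r + 1) time_grid U (\<lambda>p. X (T * snd p))"
    by (rule Ck_family_reindex[OF _ _ X]) (use time snd_grid in \<open>auto intro!: continuous_intros\<close>)
  have YT: "Ck_family (r + 1) time_grid U (\<lambda>p. Y (T * snd p))"
    by (rule Ck_family_reindex[OF _ _ Y]) (use time snd_grid in \<open>auto intro!: continuous_intros\<close>)
  have A: "Ck_family (r + 1) time_grid U (\<lambda>p. A (snd p))"
    unfolding A_def by (intro Ck_family_Pair Ck_family_scaleR Ck_family_const XT)
  have B: "Ck_family (r + 1) time_grid U (\<lambda>p. B (snd p))"
    unfolding B_def by (intro Ck_family_Pair Ck_family_scaleR Ck_family_add Ck_family_const XT YT)
  have step_A: "x + s *\<^sub>R A t x \<in> U" if "x \<in> U" for x s t using that by (auto simp: U_def A_def)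
  have step_B: "x + s *\<^sub>R B t x \<in> U" if "x \<in> U" for x s t using that by (auto simp: U_def B_def)
  have "Ck_family (r + 1) time_grid U (\<lambda>p x. x + fst p *\<^sub>R A (snd p) x)"
    by (intro Ck_family_add Ck_family_ident Ck_family_scaleR[OF Ck_family_param A] continuous_intros)
  from Ck_family_compose[OF B this step_A U] A have W: "Ck_family (Suc r) time_grid U W"
    unfolding W_def by (auto intro!: Ck_family_add simp del: Ck_family.simps)
  have W0: "W (0, t) x = ((T *\<^sub>R X (T * t) x, T *\<^sub>R Y (T * t) x), 0)" for t x
    unfolding W_def A_def B_def by (simp add: scaleR_add_right zero_prod_def[symmetric])

  have curve: "((\<lambda>t. (z (T * t), \<mu>)) has_vector_derivative W (0, t) (z (T * t), \<mu>)) (at t within {0..1})"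
    if z: "ham_solution H f T \<mu> z" and t: "t \<in> {0..1}" for z \<mu> t
  proof -
    have "(z has_vector_derivative (X (T * t) (z (T * t), \<mu>), Y (T * t) (z (T * t), \<mu>))) (at (T * t) within {0..T})"
      using z time[OF t] by (auto simp: ham_solution_def X_def Y_def split_beta)
    then have "(z has_vector_derivative (X (T * t) (z (T * t), \<mu>), Y (T * t) (z (T * t), \<mu>))) (at (T * t) within (\<lambda>t. T * t) ` {0..1})"
      by (rule has_vector_derivative_within_subset) (use time in auto)
    moreover have "((\<lambda>t. T * t) has_vector_derivative T) (at t within {0..1})"
      by (auto intro!: derivative_eq_intros)
    note chain = vector_diff_chain_within[OF this calculation]
    have "((\<lambda>t. z (T * t)) has_vector_derivative T *\<^sub>R (X (T * t) (z (T * t), \<mu>), Y (T * t) (z (T * t), \<mu>))) (at t within {0..1})"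
      using chain unfolding o_def .
    from has_vector_derivative_Pair[OF this has_vector_derivative_const[of \<mu>]] show ?thesis
      by (simp add: W0)
  qed
  have "\<exists>z. ham_solution H f T (snd x) z \<and> z 0 = fst x" if "x \<in> U" for x
    using adm T that by (auto simp: admissible_system_def U_def)
  then obtain z where z: "\<And>x. x \<in> U \<Longrightarrow> ham_solution H f T (snd x) (z x)" "\<And>x. x \<in> U \<Longrightarrow> z x 0 = fst x"
    by metis
  obtain w where w: "euler_flow U (\<lambda>p x. W p) (\<lambda>x. x) w" and w0: "\<And>x t. w (0, t) x = (z x (T * t), snd x)"
    by (rule euler_flow_exists[of U "\<lambda>x t. (z x (T * t), snd x)" "\<lambda>x. x" "\<lambda>p x. W p"]) (use curve z in auto)

  \<comment> \<open>\<open>?kick_A\<close> shears by \<open>p\<close> and then kicks in sheared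
    coordinates, which is why \<open>X\<close> is evaluated at position \<open>q - p\<close>. The
    shear with \<open>-1\<close> in \<open>?kick_B\<close> subtracts the already updated momentum,
    so that the position gains exactly the step along \<open>X\<close>; the kick that follows is the
    step along \<open>B\<close>.\<close>
  let ?kick_A = "\<lambda>N t. sheared_kick 1 (\<lambda>x. - (T / real N) *\<^sub>R X (T * t) ((fst (fst x) - snd (fst x), snd (fst x)), snd x))"
  let ?kick_B = "\<lambda>N t. sheared_kick (-1) (\<lambda>x. (T / real N) *\<^sub>R (X (T * t) x + Y (T * t) x))"
  have step: "x + (1 / real N) *\<^sub>R W (1 / real N, t) x = ?kick_B N t (?kick_A N t x)" for N t x
    by (cases x) (auto simp: W_def A_def B_def sheared_kick_def algebra_simps)
  have lists: "\<exists>Ls. length Ls = 2 * j \<and> (\<forall>L\<in>set Ls. lde_approximable r I \<sigma> L) \<and>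
      (\<forall>x\<in>U. w (grid_node N j) x = fold (\<lambda>L y. L y) (map (\<lambda>L. L (0, 1)) Ls) x \<and>
        w (grid_node N j) x \<in> U)"
    if N: "1 \<le> N" and "j \<le> N" for N j
    using that(2)
  proof (induction j)
    case 0
    then show ?case using euler_flow_node(1)[OF w _ N] by simp
  next
    case (Suc j)
    let ?t = "real j / real N"
    have t: "?t \<in> {0..1}" using Suc.prems by auto
    have Xt: "Ck (r + 1) U (X (T * ?t))" "Ck (r + 1) U (Y (T * ?t))"
      using Ck_family_reindex[OF continuous_on_const _ X, of "T * ?t" "{0}"]
        Ck_family_reindex[OF continuous_on_const _ Y, of "T * ?t" "{0}"] time[OF t] by auto
    have "Ck (r + 1) U (\<lambda>x. X (T * ?t) ((fst (fst x) - snd (fst x), snd (fst x)), snd x))"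
    proof (rule Ck_family_compose[OF Xt(1) _ _ U])
      show "Ck (r + 1) U (\<lambda>x :: 'n phase \<times> (real ^ 'l). ((fst (fst x) - snd (fst x), snd (fst x)), snd x))"
        by (intro Ck_family_Pair Ck_family_diff Ck_family_fst Ck_family_snd Ck_family_ident)
    qed (auto simp: U_def)
    then have "Ck r U (\<lambda>x. - (T / real N) *\<^sub>R X (T * ?t) ((fst (fst x) - snd (fst x), snd (fst x)), snd x))"
      by (intro Ck_family_scaleR Ck_family_const) (rule Ck_family_le, auto simp del: Ck_family.simps)
    from sheared_kick_approximable[OF \<sigma> \<open>open I\<close> this[unfolded U_def], where c = "1", folded U_def]
    obtain LA where "lde_approximable r I \<sigma> LA" "\<forall>x\<in>U. LA (0, 1) x = ?kick_A N ?t x" .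
    note LA = this(1) this(2)[THEN bspec]
    have "Ck r U (\<lambda>x. (T / real N) *\<^sub>R (X (T * ?t) x + Y (T * ?t) x))"
      by (intro Ck_family_scaleR Ck_family_const Ck_family_add Ck_family_le[OF Xt(1)] Ck_family_le[OF Xt(2)]) auto
    from sheared_kick_approximable[OF \<sigma> \<open>open I\<close> this[unfolded U_def], where c = "-1", folded U_def]
    obtain LB where "lde_approximable r I \<sigma> LB" "\<forall>x\<in>U. LB (0, 1) x = ?kick_B N ?t x" .
    note LB = this(1) this(2)[THEN bspec]
    have "j \<le> N" using Suc.prems by simp
    from Suc.IH[OF this] obtain Ls where len: "length Ls = 2 * j" and appr: "\<forall>L\<in>set Ls. lde_approximable r I \<sigma> L"
      and w_Ls: "\<forall>x\<in>U. w (1 / real N, ?t) x = fold (\<lambda>L y. L y) (map (\<lambda>L. L (0, 1)) Ls) x \<and> w (1 / real N, ?t) x \<in> U"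
      by (elim exE conjE)
    note Ls = len appr[THEN bspec] w_Ls[THEN bspec, THEN conjunct1] w_Ls[THEN bspec, THEN conjunct2]
    have kick_U: "?kick_A N ?t x \<in> U" if "x \<in> U" for x
      using that by (auto simp: sheared_kick_def U_def)
    have next_w: "w (grid_node N (Suc j)) x = ?kick_B N ?t (?kick_A N ?t (w (1 / real N, ?t) x))" if "x \<in> U" for x
      using euler_flow_node(2)[OF w that N, of j] Suc.prems step by simp
    show ?case
    proof (intro exI[of _ "Ls @ [LA, LB]"] conjI ballI)
      fix x assume x: "x \<in> U"
      show "w (grid_node N (Suc j)) x = fold (\<lambda>L y. L y) (map (\<lambda>L. L (0, 1)) (Ls @ [LA, LB])) x"
        unfolding next_w[OF x] using LA(2)[OF Ls(4)[OF x]] LB(2)[OF kick_U[OF Ls(4)[OF x]]] Ls(3)[OF x] by simp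
      show "w (grid_node N (Suc j)) x \<in> U"
        unfolding next_w[OF x] using Ls(4)[OF x] by (auto simp: sheared_kick_def U_def split_beta)
    qed (use Ls LA LB in auto)
  qed
  have wU: "w p x \<in> U" if "p \<in> time_grid" "x \<in> U" for p x
    using that(1)
  proof (cases rule: time_grid_cases)
    case (1 t)
    then show ?thesis using that(2) by (auto simp: w0 U_def)
  next
    case (2 N j)
    then show ?thesis using lists[OF 2(1,2)] that(2) by blast
  qed
  have w_Ck: "Ck_family r time_grid U w"
    by (rule Ck_family_Suc_imp[OF euler_flow_Ck_family[OF U W w wU]])

  have \<phi>_w: "\<phi> x = fst (w (0, 1) x)" if x: "x \<in> U" for x
  proof -
    \<comment> \<open>Every solution starting at \<open>x\<close> is the limit of the same iterates,
      so the definite description in \<open>ham_flow\<close> denotes \<open>z x T\<close>.\<close>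
    have lim: "(\<lambda>n. w (grid_seq 1 n) x) \<longlonglongrightarrow> (u T, snd x)" if u: "ham_solution H f T (snd x) u" "u 0 = fst x" for u
    proof -
      let ?c = "\<lambda>t. (u (T * t), snd x)"
      have c: "continuous_on {0..1} ?c"
        using curve[OF u(1)] by (force simp: continuous_on_eq_continuous_within intro: has_vector_derivative_continuous)
      have cU: "?c t \<in> U" for t using x by (auto simp: U_def)
      have "(\<lambda>n. w (grid_seq 1 n) x) \<longlonglongrightarrow> ?c 1"
      proof (rule euler_flow_grid_seq_lim[OF w _ _ x])
        show "continuous_on (time_grid \<times> U \<times> U) (\<lambda>(p, x, y). W p y)"
          unfolding split_beta by (rule Ck_family_continuous_compose[OF W]) (auto intro!: continuous_intros)
        show "lipschitz_along U (\<lambda>p x. W p) x ?c"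
          by (rule lipschitz_along_C1[OF U W c cU])
      qed (use curve[OF u(1)] u(2) cU in auto)
      then show ?thesis by simp
    qed
    have "(THE y. \<exists>u. ham_solution H f T (snd x) u \<and> u 0 = fst x \<and> u T = y) = z x T"
    proof (rule the_equality)
      fix y assume "\<exists>u. ham_solution H f T (snd x) u \<and> u 0 = fst x \<and> u T = y"
      then obtain u where u: "ham_solution H f T (snd x) u" "u 0 = fst x" "u T = y" by blast
      show "y = z x T" using LIMSEQ_unique[OF lim[OF u(1,2)] lim[OF z[OF x]]] u(3) by simp
    qed (use z[OF x] in blast)
    then show ?thesis unfolding flow[OF x] by (simp add: ham_flow_def split_beta w0)
  qed
  have "\<exists>Ls. length Ls = 2 * N \<and> (\<forall>L\<in>set Ls. lde_approximable r I \<sigma> L) \<and>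
       (\<forall>x\<in>U. w (grid_node N N) x = fold (\<lambda>L y. L y) (map (\<lambda>L. L (0, 1)) Ls) x)" if "1 \<le> N" for N
    using lists[OF that order_refl] by blast
  with w_Ck \<phi>_w show thesis by (intro that) auto
qed

theorem theorem4p1:
  fixes r :: nat
    and I :: "(real ^ 'l::finite) set"
    and \<sigma> :: "real \<Rightarrow> real"
    and \<phi> :: "'n::finite phase \<times> (real ^ 'l) \<Rightarrow> 'n phase"
    and K :: "('n phase \<times> (real ^ 'l)) set"
    and \<epsilon> :: real
  assumes "open I"
    and "\<sigma> \<in> activations (r + 2)"
    and "\<phi> \<in> LdA (r + 1) I"
    and "compact K" and "K \<subseteq> UNIV \<times> I"
    and "0 < \<epsilon>"
  shows "\<exists>Ls. Ls \<noteq> [] \<and> set Ls \<subseteq> LDE_networks \<sigma> \<and>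
           Cr_norm r K (\<lambda>x. \<phi> x - fst (fold (\<lambda>L y. L y) Ls x)) < ennreal \<epsilon>"
proof -
  define U where "U = (UNIV \<times> I :: ('n phase \<times> (real ^ 'l)) set)"
  have U: "open U" unfolding U_def using \<open>open I\<close> by (intro open_Times) auto
  from LdA_euler_splitting[OF assms(1-3), folded U_def]
  obtain w where w_Ck: "Ck_family r time_grid U w" and "\<forall>x\<in>U. \<phi> x = fst (w (0, 1) x)"
    and lists: "\<forall>N\<ge>1. \<exists>Ls. length Ls = 2 * N \<and> (\<forall>L\<in>set Ls. lde_approximable r I \<sigma> L) \<and>
       (\<forall>x\<in>U. w (grid_node N N) x = fold (\<lambda>L y. L y) (map (\<lambda>L. L (0, 1)) Ls) x)" .
  note \<phi>_w = this(2)[THEN bspec]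
  obtain \<rho> where \<rho>: "\<rho> > 0" "(\<Union>x\<in>K. cball x \<rho>) \<subseteq> U"
    using compact_subset_open_imp_cball_epsilon_subset[OF \<open>compact K\<close> U] assms(5) unfolding U_def by blast
  \<comment> \<open>The comparison of \<open>Ck_small\<close> with \<open>Cr_norm\<close> takes
    place on an open set; \<open>S\<close> is one that lies between \<open>K\<close> and a compact
    part of \<open>U\<close>.\<close>
  define S where "S = nbhd K \<rho>"
  have "S \<subseteq> (\<Union>x\<in>K. cball x \<rho>)" unfolding S_def nbhd_def by (intro UN_mono order_refl ball_subset_cball)
  then have S: "open S" "K \<subseteq> S" "S \<subseteq> (\<Union>x\<in>K. cball x \<rho>)" "S \<subseteq> U"
    using open_nbhd[of K \<rho>] subset_nbhd[OF \<rho>(1), of K] \<rho>(2) by (simp_all add: S_def)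
  note C = compact_closed_nbhd[OF \<open>compact K\<close>, of \<rho>]
  define D where "D = real DIM('n phase \<times> (real ^ 'l)) ^ r"
  have D: "0 < D" unfolding D_def by (intro zero_less_power) (use DIM_positive[where 'a = "'n phase \<times> (real ^ 'l)"] in linarith)
  \<comment> \<open>The Euler scheme and the networks contribute an error \<open>e\<close> each;
    passing to operator norms multiplies their sum by \<open>D\<close>, which leaves
    \<open>\<epsilon> / 2\<close>.\<close>
  define e where "e = \<epsilon> / (4 * D)"
  have e: "0 < e" using \<open>0 < \<epsilon>\<close> D by (simp add: e_def)
  obtain d where d: "d > 0" "\<And>p. p \<in> time_grid \<Longrightarrow> dist p (0, 1) < d \<Longrightarrow> Ck_small r S e (\<lambda>x. w p x - w (0, 1) x)"
    using Ck_family_imp_Ck_small[OF w_Ck time_grid_0 C \<rho>(2) S(3) e, of 1] by auto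
  obtain N where N: "1 / real (Suc N) < d" using d(1) nat_approx_posE by blast
  obtain Ls where Ls: "length Ls = 2 * Suc N" "\<And>L. L \<in> set Ls \<Longrightarrow> lde_approximable r I \<sigma> L"
    "\<And>x. x \<in> U \<Longrightarrow> w (1 / real (Suc N), 1) x = fold (\<lambda>L y. L y) (map (\<lambda>L. L (0, 1)) Ls) x"
    using lists[THEN spec, of "Suc N"] by (auto simp del: of_nat_Suc)
  have small1: "Ck_small r S e (\<lambda>x. w (1 / real (Suc N), 1) x - w (0, 1) x)"
  proof (rule d(2))
    show "(1 / real (Suc N), 1) \<in> time_grid" using time_grid_node[of "Suc N" "Suc N"] by simp
    show "dist (1 / real (Suc N), 1) (0, 1 :: real) < d" using N by (simp add: dist_Pair_Pair del: of_nat_Suc)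
  qed
  \<comment> \<open>The list, and with it the number of Euler steps, is fixed from here on; only the
    quality of the networks varies with the parameter \<open>p\<close>.\<close>
  let ?F = "\<lambda>p. fold (\<lambda>L y. L y) (map (\<lambda>L. L p) Ls)"
  have F: "Ck_family r approx_grid U ?F"
    using fold_lde_approximable[OF \<open>open I\<close> Ls(2)] by (simp add: U_def)
  obtain d' where d': "d' > 0" "\<And>p. p \<in> approx_grid \<Longrightarrow> dist p (0, 1) < d' \<Longrightarrow> Ck_small r S e (\<lambda>x. ?F p x - ?F (0, 1) x)"
    using Ck_family_imp_Ck_small[OF F approx_grid_0 C \<rho>(2) S(3) e] by auto
  obtain M where M: "1 / real (Suc M) < d'" using d'(1) nat_approx_posE by blast
  let ?p = "(1 / real (Suc M), 1 :: real)"
  have small2: "Ck_small r S e (\<lambda>x. ?F ?p x - ?F (0, 1) x)"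
  proof (rule d'(2))
    show "?p \<in> approx_grid" by (rule approx_grid_node) simp
    show "dist ?p (0, 1) < d'" using M by (simp add: dist_Pair_Pair del: of_nat_Suc)
  qed
  have "Ck_small r S (1 * (e + e)) (\<lambda>x. fst (- (w (1 / real (Suc N), 1) x - w (0, 1) x) + - (?F ?p x - ?F (0, 1) x)))"
    by (rule Ck_small_linear[OF bounded_linear_fst _ _ Ck_small_add[OF Ck_small_minus[OF small1] Ck_small_minus[OF small2]]])
      (auto intro: norm_fst_le)
  then have small: "Ck_small r S (1 * (e + e)) (\<lambda>x. \<phi> x - fst (?F ?p x))"
  proof (rule Ck_small_cong[OF S(1), rotated])
    fix x assume "x \<in> S"
    then have "x \<in> U" using S(4) by blast
    then show "fst (- (w (1 / real (Suc N), 1) x - w (0, 1) x) + - (?F ?p x - ?F (0, 1) x)) = \<phi> x - fst (?F ?p x)"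
      using \<phi>_w Ls(3) by simp
  qed
  show ?thesis
  proof (intro exI[of _ "map (\<lambda>L. L ?p) Ls"] conjI)
    show "map (\<lambda>L. L ?p) Ls \<noteq> []" using Ls(1) by auto
    show "set (map (\<lambda>L. L ?p) Ls) \<subseteq> LDE_networks \<sigma>"
      using Ls(2) by (auto simp: lde_approximable_def simp del: of_nat_Suc)
    have "Cr_norm r K (\<lambda>x. \<phi> x - fst (?F ?p x)) \<le> ennreal (D * (1 * (e + e)))"
      unfolding D_def using Ck_small_Cr_norm[OF S(1) small _ S(2)] e by simp
    also have "D * (1 * (e + e)) < \<epsilon>" using D \<open>0 < \<epsilon>\<close> by (simp add: e_def)
    then have "ennreal (D * (1 * (e + e))) < ennreal \<epsilon>" using \<open>0 < \<epsilon>\<close> by (intro ennreal_lessI) auto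
    finally show "Cr_norm r K (\<lambda>x. \<phi> x - fst (?F ?p x)) < ennreal \<epsilon>" .
  qed
qed

end
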